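(* Let $n\ge 3$, let $\Omega\subset\mathbb{R}^n$ be a bounded domain with smooth boundary, and let $p_1,\dots,p_n\in\mathcal{C}(\overline{\Omega})$ with $p_i^->1$ for all $i=1,\dots,n$. Put $\mathbf{p}(x)=(p_1(x),\dots,p_n(x))$, $p_M(x)=\max\{p_1(x),\dots,p_n(x)\}$ and $p_m=\min\{p_M^-,p_1^-,\dots,p_n^-\}$. Let $f:\Omega\times\mathbb{R}\times\mathbb{R}^n\to\mathbb{R}$ satisfy the following two conditions. (f1) $f$ is a Carathéodory function: $x\mapsto f(x,u,\xi)$ is measurable for all $u\in\mathbb{R}$ and all $\xi\in\mathbb{R}^n$, and $(u,\xi)\mapsto f(x,u,\xi)$ is continuous for all $x\in\Omega$. (f2) There exist $q\in\mathcal{C}(\overline{\Omega})$ with $q(x)>1$, a function $k\in L^{q'(x)}(\Omega)$, nonnegative measurable functions $r_1,\dots,r_n$ on $\Omega$, and a constant $C>0$ such that $$|f(x,u,\xi)|\le C\Big(|k(x)|+|u|^{q(x)-1}+\sum_{i=1}^n|\xi_i|^{r_i(x)}\Big)$$ for a.e. $x\in\Omega$ and all $u\in\mathbb{R}$, $\xi=(\xi_1,\dots,\xi_n)\in\mathbb{R}^n$, where $$1<q(x)\le q^+<p_m,$$ and, for all $i=1,\dots,n$, $$1<r_i(x)q'(x)\le p_i(x)\quad\text{and}\quad r_i^+<\frac{p_i^-}{p_m}(p_m-1).$$ Then the Dirichlet problem $$\begin{cases}-\displaystyle\sum_{i=1}^n\partial_{x_i}\big(|\partial_{x_i}u|^{p_i(x)-2}\partial_{x_i}u\big)+|u|^{p_M(x)-2}u=f(x,u,Du)&\text{in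 }\Omega,\\ u=0&\text{on }\partial\Omega\end{cases}$$ has a weak solution $u\in W_0^{1,\mathbf{p}(x)}(\Omega)$.
   Context: For a bounded measurable function $s$ on $\Omega$, $s^+=\sup_{x\in\Omega}s(x)$ and $s^-=\inf_{x\in\Omega}s(x)$. For an exponent $s:\Omega\to(1,\infty)$, the conjugate exponent $s'$ is defined pointwise by $\frac1{s(x)}+\frac1{s'(x)}=1$. For a measurable $s:\Omega\to[1,\infty)$, bounded, $L^{s(x)}(\Omega)$ is the space of (classes of) measurable $u:\Omega\to\mathbb{R}$ with $\int_\Omega|u(x)|^{s(x)}\,dx<\infty$, with Luxemburg norm $|u|_{s(x)}=\inf\{\lambda>0:\int_\Omega|u(x)/\lambda|^{s(x)}\,dx\le1\}$. The anisotropic Sobolev space is $W^{1,\mathbf{p}(x)}(\Omega)=\{u\in L^{p_M(x)}(\Omega):\partial_{x_i}u\in L^{p_i(x)}(\Omega),\ i=1,\dots,n\}$ (distributional derivatives), with norm $|u|_{p_M(x)}+\sum_{i=1}^n|\partial_{x_i}u|_{p_i(x)}$. $W_0^{1,\mathbf{p}(x)}(\Omega)$ is the closure of $C_0^\infty(\Omega)$ (smooth compactly supported functions) in this norm. $Du$ is the distributional gradient of $u$. A weak solution is a function $u\in W_0^{1,\mathbf{p}(x)}(\Omega)$ such that for every $v\in W_0^{1,\mathbf{p}(x)}(\Omega)$, $$\sum_{i=1}^n\int_\Omega|\partial_{x_i}u|^{p_i(x)-2}\partial_{x_i}u\,\partial_{x_i}v\,dx+\int_\Omega|u|^{p_M(x)-2}uv\,dx=\int_\Omega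 f(x,u,Du)\,v\,dx.$$ The expression $|t|^{s-2}t$ is understood as $0$ when $t=0$. *)

theory Defs
  imports "HOL-Analysis.Analysis"
begin

definition pderiv_at :: "'n::finite \<Rightarrow> (real^'n \<Rightarrow> real) \<Rightarrow> real^'n \<Rightarrow> real" where
  "pderiv_at i \<phi> x = frechet_derivative \<phi> (at x) (axis i 1)"

primrec Ck :: "nat \<Rightarrow> (real^'n::finite \<Rightarrow> real) \<Rightarrow> bool" where
  "Ck 0 \<phi> \<longleftrightarrow> continuous_on UNIV \<phi>"
| "Ck (Suc k) \<phi> \<longleftrightarrow> (\<forall>x. \<phi> differentiable (at x)) \<and> (\<forall>i. Ck k (pderiv_at i \<phi>))"

definition smooth :: "(real^'n::finite \<Rightarrow> real) \<Rightarrow> bool" where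
  "smooth \<phi> \<longleftrightarrow> (\<forall>k. Ck k \<phi>)"

text \<open>Near every boundary point, \<open>\<Omega>\<close> is the region strictly on one side of the graph
  \<open>x\<^sub>i = \<plusminus> \<gamma>\<close> of a smooth function of the remaining \<open>n - 1\<close> coordinates. Such a function is
  encoded as a smooth function on the whole space that does not depend on \<open>x\<^sub>i\<close>.\<close>

definition smooth_boundary :: "(real^'n::finite) set \<Rightarrow> bool" where
  "smooth_boundary \<Omega> \<longleftrightarrow>
     (\<forall>a\<in>frontier \<Omega>. \<exists>r>0. \<exists>i. \<exists>\<sigma>\<in>{-1, 1}. \<exists>\<gamma>.
        smooth \<gamma> \<and> (\<forall>x y. (\<forall>j. j \<noteq> i \<longrightarrow> x $ j = y $ j) \<longrightarrow> \<gamma> x = \<gamma> y) \<and>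
        \<Omega> \<inter> ball a r = {x \<in> ball a r. \<gamma> x < \<sigma> * x $ i})"

definition bounded_smooth_domain :: "(real^'n::finite) set \<Rightarrow> bool" where
  "bounded_smooth_domain \<Omega> \<longleftrightarrow>
     \<Omega> \<noteq> {} \<and> open \<Omega> \<and> connected \<Omega> \<and> bounded \<Omega> \<and> smooth_boundary \<Omega>"

definition exp_sup :: "(real^'n::finite) set \<Rightarrow> (real^'n \<Rightarrow> real) \<Rightarrow> real" where
  "exp_sup \<Omega> s = (SUP x\<in>\<Omega>. s x)"

definition exp_inf :: "(real^'n::finite) set \<Rightarrow> (real^'n \<Rightarrow> real) \<Rightarrow> real" where
  "exp_inf \<Omega> s = (INF x\<in>\<Omega>. s x)"

definition conj_exp :: "(real^'n::finite \<Rightarrow> real) \<Rightarrow> real^'n \<Rightarrow> real" where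
  "conj_exp s x = s x / (s x - 1)"

lemma conj_exp_eq_iff:
  assumes "s x > 1"
  shows "1 / s x + 1 / t = 1 \<longleftrightarrow> t = conj_exp s x"
proof (cases "t = 0")
  case True
  with assms show ?thesis by (auto simp: conj_exp_def)
next
  case False
  have "1 / s x + 1 / t = 1 \<longleftrightarrow> t + s x = s x * t"
    using assms False by (auto simp: field_simps)
  also have "\<dots> \<longleftrightarrow> t = conj_exp s x"
    using assms by (auto simp: conj_exp_def field_simps)
  finally show ?thesis .
qed

definition modular :: "(real^'n::finite) set \<Rightarrow> (real^'n \<Rightarrow> real) \<Rightarrow> (real^'n \<Rightarrow> real) \<Rightarrow> ennreal" where
  "modular \<Omega> s u = (\<integral>\<^sup>+x. ennreal (\<bar>u x\<bar> powr s x) \<partial>lebesgue_on \<Omega>)"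

text \<open>Elements of the function spaces are functions, not classes; only their values on \<open>\<Omega>\<close>,
  up to null sets, matter.\<close>

definition Lvar :: "(real^'n::finite) set \<Rightarrow> (real^'n \<Rightarrow> real) \<Rightarrow> (real^'n \<Rightarrow> real) set" where
  "Lvar \<Omega> s = {u \<in> borel_measurable (lebesgue_on \<Omega>). modular \<Omega> s u < \<infinity>}"

definition lux_norm :: "(real^'n::finite) set \<Rightarrow> (real^'n \<Rightarrow> real) \<Rightarrow> (real^'n \<Rightarrow> real) \<Rightarrow> real" where
  "lux_norm \<Omega> s u = Inf {l. l > 0 \<and> modular \<Omega> s (\<lambda>x. u x / l) \<le> 1}"

definition test_functions :: "(real^'n::finite) set \<Rightarrow> (real^'n \<Rightarrow> real) set" where
  "test_functions \<Omega> =
     {\<phi>. smooth \<phi> \<and> compact (closure {x. \<phi> x \<noteq> 0}) \<and> closure {x. \<phi> x \<noteq> 0} \<subseteq> \<Omega>}"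

definition locally_integrable :: "(real^'n::finite) set \<Rightarrow> (real^'n \<Rightarrow> real) \<Rightarrow> bool" where
  "locally_integrable \<Omega> u \<longleftrightarrow> (\<forall>K. compact K \<and> K \<subseteq> \<Omega> \<longrightarrow> u absolutely_integrable_on K)"

definition has_weak_pderiv ::
  "(real^'n::finite) set \<Rightarrow> 'n \<Rightarrow> (real^'n \<Rightarrow> real) \<Rightarrow> (real^'n \<Rightarrow> real) \<Rightarrow> bool" where
  "has_weak_pderiv \<Omega> i u g \<longleftrightarrow>
     locally_integrable \<Omega> u \<and> locally_integrable \<Omega> g \<and>
     (\<forall>\<phi>\<in>test_functions \<Omega>.
        (\<integral>x. u x * pderiv_at i \<phi> x \<partial>lebesgue_on \<Omega>) = - (\<integral>x. g x * \<phi> x \<partial>lebesgue_on \<Omega>))"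

text \<open>A representative of the distributional derivative; for open \<open>\<Omega>\<close> it is unique up to null
  subsets of \<open>\<Omega>\<close> whenever it exists.\<close>

definition weak_pderiv ::
  "(real^'n::finite) set \<Rightarrow> 'n \<Rightarrow> (real^'n \<Rightarrow> real) \<Rightarrow> real^'n \<Rightarrow> real" where
  "weak_pderiv \<Omega> i u = (SOME g. has_weak_pderiv \<Omega> i u g)"

definition weak_grad :: "(real^'n::finite) set \<Rightarrow> (real^'n \<Rightarrow> real) \<Rightarrow> real^'n \<Rightarrow> real^'n" where
  "weak_grad \<Omega> u x = (\<chi> i. weak_pderiv \<Omega> i u x)"

definition p_Max :: "('n::finite \<Rightarrow> real^'n \<Rightarrow> real) \<Rightarrow> real^'n \<Rightarrow> real" where
  "p_Max p x = Max (range (\<lambda>i. p i x))"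

definition p_min :: "(real^'n::finite) set \<Rightarrow> ('n \<Rightarrow> real^'n \<Rightarrow> real) \<Rightarrow> real" where
  "p_min \<Omega> p = Min (insert (exp_inf \<Omega> (p_Max p)) (range (\<lambda>i. exp_inf \<Omega> (p i))))"

definition W1 ::
  "(real^'n::finite) set \<Rightarrow> ('n \<Rightarrow> real^'n \<Rightarrow> real) \<Rightarrow> (real^'n \<Rightarrow> real) set" where
  "W1 \<Omega> p = {u \<in> Lvar \<Omega> (p_Max p). \<forall>i. \<exists>g\<in>Lvar \<Omega> (p i). has_weak_pderiv \<Omega> i u g}"

definition W1_norm ::
  "(real^'n::finite) set \<Rightarrow> ('n \<Rightarrow> real^'n \<Rightarrow> real) \<Rightarrow> (real^'n \<Rightarrow> real) \<Rightarrow> real" where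
  "W1_norm \<Omega> p u = lux_norm \<Omega> (p_Max p) u + (\<Sum>i\<in>UNIV. lux_norm \<Omega> (p i) (weak_pderiv \<Omega> i u))"

definition W1_0 ::
  "(real^'n::finite) set \<Rightarrow> ('n \<Rightarrow> real^'n \<Rightarrow> real) \<Rightarrow> (real^'n \<Rightarrow> real) set" where
  "W1_0 \<Omega> p =
     {u \<in> W1 \<Omega> p. \<forall>e>0. \<exists>\<phi>\<in>test_functions \<Omega>. W1_norm \<Omega> p (\<lambda>x. u x - \<phi> x) < e}"

definition caratheodory ::
  "(real^'n::finite) set \<Rightarrow> (real^'n \<Rightarrow> real \<Rightarrow> real^'n \<Rightarrow> real) \<Rightarrow> bool" where
  "caratheodory \<Omega> f \<longleftrightarrow>
     (\<forall>u \<xi>. (\<lambda>x. f x u \<xi>) \<in> borel_measurable (lebesgue_on \<Omega>)) \<and>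
     (\<forall>x\<in>\<Omega>. continuous_on UNIV (\<lambda>(u, \<xi>). f x u \<xi>))"

definition growth_condition ::
  "(real^'n::finite) set \<Rightarrow> ('n \<Rightarrow> real^'n \<Rightarrow> real) \<Rightarrow>
   (real^'n \<Rightarrow> real \<Rightarrow> real^'n \<Rightarrow> real) \<Rightarrow> bool" where
  "growth_condition \<Omega> p f \<longleftrightarrow>
     (\<exists>(q :: real^'n \<Rightarrow> real) (k :: real^'n \<Rightarrow> real) (r :: 'n \<Rightarrow> real^'n \<Rightarrow> real) (C :: real).
        continuous_on (closure \<Omega>) q \<and> (\<forall>x\<in>closure \<Omega>. 1 < q x) \<and>
        k \<in> Lvar \<Omega> (conj_exp q) \<and>
        (\<forall>i. r i \<in> borel_measurable (lebesgue_on \<Omega>) \<and> (\<forall>x\<in>\<Omega>. 0 \<le> r i x)) \<and>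
        C > 0 \<and>
        (AE x in lebesgue_on \<Omega>. \<forall>u \<xi>.
           \<bar>f x u \<xi>\<bar> \<le> C * (\<bar>k x\<bar> + \<bar>u\<bar> powr (q x - 1) + (\<Sum>i\<in>UNIV. \<bar>\<xi> $ i\<bar> powr r i x))) \<and>
        exp_sup \<Omega> q < p_min \<Omega> p \<and>
        (\<forall>i. (\<forall>x\<in>\<Omega>. 1 < r i x * conj_exp q x \<and> r i x * conj_exp q x \<le> p i x) \<and>
             exp_sup \<Omega> (r i) < exp_inf \<Omega> (p i) / p_min \<Omega> p * (p_min \<Omega> p - 1)))"

text \<open>\<open>|t|\<^bsup>s-2\<^esup>t\<close>; since \<open>0 powr a = 0\<close>, this is \<open>0\<close> for \<open>t = 0\<close>.\<close>

definition signed_pow :: "real \<Rightarrow> real \<Rightarrow> real" where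
  "signed_pow s t = \<bar>t\<bar> powr (s - 2) * t"

text \<open>The integrability clauses say that the integrals in the weak formulation exist;
  the Bochner integral of a non-integrable function is \<open>0\<close> by convention.\<close>

definition weak_solution ::
  "(real^'n::finite) set \<Rightarrow> ('n \<Rightarrow> real^'n \<Rightarrow> real) \<Rightarrow>
   (real^'n \<Rightarrow> real \<Rightarrow> real^'n \<Rightarrow> real) \<Rightarrow> (real^'n \<Rightarrow> real) \<Rightarrow> bool" where
  "weak_solution \<Omega> p f u \<longleftrightarrow> u \<in> W1_0 \<Omega> p \<and>
     (\<forall>v\<in>W1_0 \<Omega> p.
        (\<forall>i. integrable (lebesgue_on \<Omega>)
               (\<lambda>x. signed_pow (p i x) (weak_pderiv \<Omega> i u x) * weak_pderiv \<Omega> i v x)) \<and>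
        integrable (lebesgue_on \<Omega>) (\<lambda>x. signed_pow (p_Max p x) (u x) * v x) \<and>
        integrable (lebesgue_on \<Omega>) (\<lambda>x. f x (u x) (weak_grad \<Omega> u x) * v x) \<and>
        (\<Sum>i\<in>UNIV. \<integral>x. signed_pow (p i x) (weak_pderiv \<Omega> i u x) * weak_pderiv \<Omega> i v x
                     \<partial>lebesgue_on \<Omega>)
          + (\<integral>x. signed_pow (p_Max p x) (u x) * v x \<partial>lebesgue_on \<Omega>)
        = (\<integral>x. f x (u x) (weak_grad \<Omega> u x) * v x \<partial>lebesgue_on \<Omega>))"

end

theory Submission
  imports Defs "HOL-Complex_Analysis.Great_Picard" "HOL-Computational_Algebra.Polynomial"
begin

text \<open>Write \<open>A\<close> for the derivative of the convex functional
\<open>J u = (\<Sum>i. \<integral>|D\<^sub>i u|\<^bsup>p\<^sub>i\<^esup> / p\<^sub>i) + \<integral>|u|\<^bsup>p\<^sub>M\<^esup> / p\<^sub>M\<close>. The equation reads \<open>A u = f(x, u, Du)\<close>. Its right-hand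
side depends on the gradient and is not a derivative, so \<open>u\<close> cannot be found by minimisation. The
proof solves the problem on an increasing sequence of finite-dimensional convex sets and shows that
the solutions converge strongly, gradients included; strong convergence is what makes the limit in
\<open>f(x, u, Du)\<close> possible.

\<^bold>\<open>Finite dimensions.\<close> Let \<open>\<phi>\<^sub>0, \<phi>\<^sub>1, \<dots>\<close> be test functions that are dense among all test functions
together with their first derivatives (\<open>test_functions_separable\<close>), and let \<open>K\<^sub>m\<close> consist of the
combinations of the first \<open>m\<close> of them with coefficients bounded by \<open>m + 1\<close>. A continuous vector field
on a cube always solves the variational inequality of that cube (\<open>cube_variational_inequality\<close>, a form
of Brouwer's theorem). Applied to coefficients this gives \<open>u\<^sub>m \<in> K\<^sub>m\<close> with
\<open>\<langle>A u\<^sub>m, w - u\<^sub>m\<rangle> \<ge> \<integral> f(x, u\<^sub>m, Du\<^sub>m) (w - u\<^sub>m)\<close> for all \<open>w \<in> K\<^sub>m\<close>. The choice \<open>w = 0\<close> and the growth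
condition bound the energy \<open>\<integral>|u\<^sub>m|\<^bsup>p\<^sub>M\<^esup> + (\<Sum>i. \<integral>|D\<^sub>i u\<^sub>m|\<^bsup>p\<^sub>i\<^esup>)\<close> (\<open>growth_structure\<close>, \<open>energy_apriori\<close>).

\<^bold>\<open>Strong convergence.\<close> By convexity \<open>J w \<ge> J u\<^sub>m + \<integral> f(x, u\<^sub>m, Du\<^sub>m) (w - u\<^sub>m)\<close> for \<open>w \<in> K\<^sub>m\<close>.
Rellich's theorem (\<open>rellich\<close>) makes a subsequence converge in \<open>L\<^sup>1\<close>; since \<open>q\<^sup>+ < p\<^sub>m\<close>, the pairings
\<open>\<integral> f(x, u\<^sub>m, Du\<^sub>m) (u\<^sub>k - u\<^sub>m)\<close> then tend to \<open>0\<close> (\<open>convection_absorb\<close>). For \<open>k \<le> m\<close> the midpoint of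
\<open>u\<^sub>k\<close> and \<open>u\<^sub>m\<close> lies in \<open>K\<^sub>m\<close>, and the inequality at the midpoint says that \<open>J\<close> is there at least
\<open>J u\<^sub>m - o(1)\<close>. Along a further subsequence \<open>J u\<^sub>m\<close> converges, and the uniform convexity of the powers
(\<open>uniform_convexity\<close>) forces \<open>u\<^sub>m\<close> to be Cauchy in energy (\<open>trial_solutions_Cauchy\<close>).

\<^bold>\<open>Passage to the limit.\<close> An energy-Cauchy sequence has a subsequence that converges almost everywhere
below a dominating function of finite energy (\<open>energy_Cauchy_limit\<close>). Dominated convergence therefore
carries the inequality to the limit \<open>u\<close> and then, by density, to all \<open>w\<close> in \<open>W\<^sub>0\<^bsup>1,p(x)\<^esup>(\<Omega>)\<close>; the choices
\<open>w = u \<plusminus> v\<close> turn it into the equation (\<open>convection_problem_solvable\<close>). That \<open>W\<^sub>0\<^bsup>1,p(x)\<^esup>(\<Omega>)\<close> is the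
closure of the test functions in energy, with the components of the limits as weak derivatives, rests on
the uniqueness of weak derivatives, hence on the fundamental lemma of the calculus of variations
(\<open>fundamental_lemma\<close>).\<close>

section \<open>Variational inequalities on cubes\<close>

text \<open>The dimension is a natural number here, not a type, because it has to grow with the Galerkin step. Points
of \<open>\<real>\<^sup>m\<close> are therefore sequences that vanish from index \<open>m\<close> on.\<close>

definition cube :: "nat \<Rightarrow> real \<Rightarrow> (nat \<Rightarrow> real) set" where
  "cube m R = {x. (\<forall>i<m. \<bar>x i\<bar> \<le> R) \<and> (\<forall>i\<ge>m. x i = 0)}"

text \<open>Kuhn's combinatorial lemma on a grid with \<open>N\<close> steps per side, where a grid point is labelled in direction
\<open>i\<close> by the sign of \<open>F\<^sub>i\<close> (by the face on the two faces orthogonal to \<open>i\<close>). It yields a small cell with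
both labels in every direction: a point \<open>X\<close> with nearby points \<open>Y\<^sub>i\<close>, \<open>Z\<^sub>i\<close> of opposite signs.\<close>

lemma cube_sign_points:
  fixes F :: "(nat \<Rightarrow> real) \<Rightarrow> nat \<Rightarrow> real"
  assumes R: "R > 0" and N: "N > 0"
  shows "\<exists>X Y Z. X \<in> cube m R \<and> (\<forall>i<m.
           Y i \<in> cube m R \<and> Z i \<in> cube m R \<and>
           (\<forall>j. \<bar>Y i j - X j\<bar> \<le> 2 * R / real N \<and> \<bar>Z i j - X j\<bar> \<le> 2 * R / real N) \<and>
           (Y i i = R \<or> F (Y i) i \<ge> 0) \<and> (Z i i = - R \<or> F (Z i) i \<le> 0))"
proof -
  define pt where "pt z = (\<lambda>i. if i < m then - R + 2 * R * real (z i) / real N else 0)" for z :: "nat \<Rightarrow> nat"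
  define label where "label z = (\<lambda>i. if z i = 0 then 0::nat else if z i = N then 1 else if F (pt z) i \<ge> 0 then 1 else 0)"
    for z :: "nat \<Rightarrow> nat"
  have pt_cube: "pt z \<in> cube m R" if "\<forall>i<m. z i \<le> N" for z
  proof -
    have "\<bar>- R + 2 * R * real (z i) / real N\<bar> \<le> R" if "i < m" for i
    proof -
      have "real (z i) / real N \<le> 1" using \<open>\<forall>i<m. z i \<le> N\<close> that N by (simp add: divide_simps)
      moreover have "0 \<le> real (z i) / real N" by simp
      ultimately have "0 \<le> R * (real (z i) / real N)" "R * (real (z i) / real N) \<le> R * 1"
        using R mult_left_mono[of "real (z i) / real N" 1 R] by auto
      moreover have "2 * R * real (z i) / real N = 2 * (R * (real (z i) / real N))" by simp
      ultimately show ?thesis by linarith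
    qed
    then show ?thesis by (auto simp: cube_def pt_def)
  qed
  have pt_close: "\<bar>pt z j - pt w j\<bar> \<le> 2 * R / real N"
    if "\<forall>j<m. w j \<le> z j \<and> z j \<le> w j + 1" for z w j
  proof (cases "j < m")
    case True
    then have "\<bar>real (z j) - real (w j)\<bar> \<le> 1" using that by (smt (verit) of_nat_1 of_nat_add of_nat_mono)
    then have "2 * R / real N * \<bar>real (z j) - real (w j)\<bar> \<le> 2 * R / real N * 1"
      using R by (intro mult_left_mono) auto
    moreover have "\<bar>pt z j - pt w j\<bar> = 2 * R / real N * \<bar>real (z j) - real (w j)\<bar>"
    proof -
      have "pt z j - pt w j = 2 * R / real N * (real (z j) - real (w j))"
        using True by (simp add: pt_def right_diff_distrib diff_divide_distrib)
      then show ?thesis using R by (simp add: abs_mult)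
    qed
    ultimately show ?thesis by simp
  qed (use R in \<open>simp add: pt_def\<close>)
  obtain w where w: "\<forall>i<m. w i < N"
    and rs: "\<forall>i<m. \<exists>r s. (\<forall>j<m. w j \<le> r j \<and> r j \<le> w j + 1) \<and> (\<forall>j<m. w j \<le> s j \<and> s j \<le> w j + 1)
             \<and> label r i \<noteq> label s i"
    by (rule kuhn_lemma[of N m label]) (use N in \<open>auto simp: label_def\<close>)
  have "\<forall>i<m. \<exists>r s. (\<forall>j<m. w j \<le> r j \<and> r j \<le> w j + 1) \<and> (\<forall>j<m. w j \<le> s j \<and> s j \<le> w j + 1)
             \<and> label r i = 1 \<and> label s i = 0"
  proof (intro allI impI)
    fix i assume "i < m"
    then obtain r s where 1: "(\<forall>j<m. w j \<le> r j \<and> r j \<le> w j + 1)" "(\<forall>j<m. w j \<le> s j \<and> s j \<le> w j + 1)"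
      "label r i \<noteq> label s i" using rs by blast
    then have "label r i = 1 \<and> label s i = 0 \<or> label s i = 1 \<and> label r i = 0"
      by (auto simp: label_def split: if_splits)
    then show "\<exists>r s. (\<forall>j<m. w j \<le> r j \<and> r j \<le> w j + 1) \<and> (\<forall>j<m. w j \<le> s j \<and> s j \<le> w j + 1)
             \<and> label r i = 1 \<and> label s i = 0" using 1 by blast
  qed
  then obtain r s where rs: "\<And>i. i < m \<Longrightarrow> (\<forall>j<m. w j \<le> r i j \<and> r i j \<le> w j + 1)"
     "\<And>i. i < m \<Longrightarrow> (\<forall>j<m. w j \<le> s i j \<and> s i j \<le> w j + 1)"
     "\<And>i. i < m \<Longrightarrow> label (r i) i = 1" "\<And>i. i < m \<Longrightarrow> label (s i) i = 0" by metis
  have le: "\<forall>j<m. w j \<le> N" using w by (auto intro: less_imp_le)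
  have le': "\<forall>j<m. r i j \<le> N" "\<forall>j<m. s i j \<le> N" if "i < m" for i
    using rs(1,2)[OF that] w by (metis Suc_eq_plus1 Suc_leI le_trans)+
  have Y: "pt (r i) i = R \<or> F (pt (r i)) i \<ge> 0" if i: "i < m" for i
    using rs(3)[OF i] i N by (auto simp: label_def pt_def split: if_splits)
  have Z: "pt (s i) i = - R \<or> F (pt (s i)) i \<le> 0" if i: "i < m" for i
    using rs(4)[OF i] i N by (auto simp: label_def pt_def split: if_splits)
  have "\<bar>pt (r i) j - pt w j\<bar> \<le> 2 * R / real N \<and> \<bar>pt (s i) j - pt w j\<bar> \<le> 2 * R / real N" if "i < m" for i j
    using pt_close rs(1,2)[OF that] by blast
  then have "\<forall>i<m. pt (r i) \<in> cube m R \<and> pt (s i) \<in> cube m R \<and>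
           (\<forall>j. \<bar>pt (r i) j - pt w j\<bar> \<le> 2 * R / real N \<and> \<bar>pt (s i) j - pt w j\<bar> \<le> 2 * R / real N) \<and>
           (pt (r i) i = R \<or> F (pt (r i)) i \<ge> 0) \<and> (pt (s i) i = - R \<or> F (pt (s i)) i \<le> 0)"
    using Y Z pt_cube[OF le'(1)] pt_cube[OF le'(2)] by simp
  with pt_cube[OF le] show ?thesis
    by (intro exI[of _ "pt w"] exI[of _ "\<lambda>i. pt (r i)"] exI[of _ "\<lambda>i. pt (s i)"] conjI)
qed

text \<open>Refining the grid, the cells of the previous lemma accumulate at a point \<open>x\<close> where, for each \<open>i\<close>, either
\<open>F\<^sub>i x = 0\<close>, or \<open>x\<^sub>i\<close> lies on a face and \<open>F\<^sub>i x\<close> points into the cube. Each summand of the variational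
inequality is then nonnegative.\<close>

proposition cube_variational_inequality:
  fixes F :: "(nat \<Rightarrow> real) \<Rightarrow> nat \<Rightarrow> real"
  assumes R: "R > 0"
    and cont: "\<And>X x i. i < m \<Longrightarrow> (\<And>k. X k \<in> cube m R) \<Longrightarrow> x \<in> cube m R \<Longrightarrow>
                 (\<And>j. (\<lambda>k. X k j) \<longlonglongrightarrow> x j) \<Longrightarrow> (\<lambda>k. F (X k) i) \<longlonglongrightarrow> F x i"
  obtains x where "x \<in> cube m R" "\<And>y. y \<in> cube m R \<Longrightarrow> (\<Sum>i<m. F x i * (y i - x i)) \<ge> 0"
proof -
  have "\<forall>n. \<exists>X Y Z. X \<in> cube m R \<and> (\<forall>i<m.
           Y i \<in> cube m R \<and> Z i \<in> cube m R \<and>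
           (\<forall>j. \<bar>Y i j - X j\<bar> \<le> 2 * R / real (Suc n) \<and> \<bar>Z i j - X j\<bar> \<le> 2 * R / real (Suc n)) \<and>
           (Y i i = R \<or> F (Y i) i \<ge> 0) \<and> (Z i i = - R \<or> F (Z i) i \<le> 0))"
    by (intro allI cube_sign_points R) simp
  then obtain X Y Z where XYZ: "\<And>n. X n \<in> cube m R \<and> (\<forall>i<m.
           Y n i \<in> cube m R \<and> Z n i \<in> cube m R \<and>
           (\<forall>j. \<bar>Y n i j - X n j\<bar> \<le> 2 * R / real (Suc n) \<and> \<bar>Z n i j - X n j\<bar> \<le> 2 * R / real (Suc n)) \<and>
           (Y n i i = R \<or> F (Y n i) i \<ge> 0) \<and> (Z n i i = - R \<or> F (Z n i) i \<le> 0))" by metis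
  have "norm (X n j) \<le> R" for n j
    using XYZ[of n] R by (cases "j < m") (auto simp: cube_def)
  then obtain k where k: "strict_mono (k::nat\<Rightarrow>nat)"
    and kl: "\<And>j. j \<in> UNIV \<Longrightarrow> \<exists>l. (\<lambda>n. X (k n) j) \<longlonglongrightarrow> l"
    using function_convergent_subsequence[of "UNIV::nat set" X R] by blast
  then obtain x where x: "\<And>j. (\<lambda>n. X (k n) j) \<longlonglongrightarrow> x j" by (metis UNIV_I)
  have xc: "x \<in> cube m R"
  proof -
    have "\<bar>x i\<bar> \<le> R" if "i < m" for i
      using tendsto_rabs[OF x[of i]] by (rule LIMSEQ_le_const2) (use XYZ that in \<open>auto simp: cube_def\<close>)
    moreover have "x i = 0" if "i \<ge> m" for i
    proof -
      have "(\<lambda>n. X (k n) i) = (\<lambda>_. 0)" using XYZ that by (auto simp: cube_def)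
      then show ?thesis using x[of i] by (simp add: LIMSEQ_const_iff)
    qed
    ultimately show ?thesis by (auto simp: cube_def)
  qed
  have e0: "(\<lambda>n. 2 * R / real (Suc (k n))) \<longlonglongrightarrow> 0"
    using LIMSEQ_subseq_LIMSEQ[OF _ k, of "\<lambda>n. 2 * R / real (Suc n)" 0] LIMSEQ_Suc[OF lim_const_over_n[of "2 * R"]]
    by (simp add: o_def)
  have Yl: "(\<lambda>n. Y (k n) i j) \<longlonglongrightarrow> x j" and Zl: "(\<lambda>n. Z (k n) i j) \<longlonglongrightarrow> x j" if "i < m" for i j
  proof -
    have "(\<lambda>n. Y (k n) i j - X (k n) j) \<longlonglongrightarrow> 0"
      by (rule Lim_null_comparison[OF _ e0]) (use XYZ that in auto)
    from tendsto_add[OF this x[of j]] show "(\<lambda>n. Y (k n) i j) \<longlonglongrightarrow> x j" by simp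
    have "(\<lambda>n. Z (k n) i j - X (k n) j) \<longlonglongrightarrow> 0"
      by (rule Lim_null_comparison[OF _ e0]) (use XYZ that in auto)
    from tendsto_add[OF this x[of j]] show "(\<lambda>n. Z (k n) i j) \<longlonglongrightarrow> x j" by simp
  qed
  have up: "x i = R \<or> F x i \<ge> 0" if i: "i < m" for i
  proof (rule ccontr)
    assume "\<not> ?thesis"
    then have a: "x i < R" "F x i < 0" using xc i by (auto simp: cube_def abs_le_iff less_le)
    have "(\<lambda>n. F (Y (k n) i) i) \<longlonglongrightarrow> F x i" by (rule cont) (use i XYZ xc Yl in auto)
    then have "\<forall>\<^sub>F n in sequentially. F (Y (k n) i) i < 0" using a(2) by (rule order_tendstoD)
    moreover have "\<forall>\<^sub>F n in sequentially. Y (k n) i i < R" using Yl[OF i] a(1) by (rule order_tendstoD)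
    ultimately have "\<forall>\<^sub>F n in sequentially. False"
    proof eventually_elim
      case (elim n) then show ?case using XYZ[of "k n"] i by force
    qed
    then show False by simp
  qed
  have dn: "x i = - R \<or> F x i \<le> 0" if i: "i < m" for i
  proof (rule ccontr)
    assume "\<not> ?thesis"
    then have a: "x i > - R" "F x i > 0" using xc i by (auto simp: cube_def abs_le_iff less_le)
    have "(\<lambda>n. F (Z (k n) i) i) \<longlonglongrightarrow> F x i" by (rule cont) (use i XYZ xc Zl in auto)
    then have "\<forall>\<^sub>F n in sequentially. F (Z (k n) i) i > 0" using a(2) by (rule order_tendstoD)
    moreover have "\<forall>\<^sub>F n in sequentially. Z (k n) i i > - R" using Zl[OF i] a(1) by (rule order_tendstoD)
    ultimately have "\<forall>\<^sub>F n in sequentially. False"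
    proof eventually_elim
      case (elim n) then show ?case using XYZ[of "k n"] i by force
    qed
    then show False by simp
  qed
  show thesis
  proof (rule that[OF xc])
    fix y assume y: "y \<in> cube m R"
    show "(\<Sum>i<m. F x i * (y i - x i)) \<ge> 0"
    proof (rule sum_nonneg)
      fix i assume "i \<in> {..<m}"
      then have i: "i < m" by simp
      have "\<bar>y i\<bar> \<le> R" using y i by (auto simp: cube_def)
      then have "F x i = 0 \<or> (F x i \<ge> 0 \<and> y i - x i \<ge> 0) \<or> (F x i \<le> 0 \<and> y i - x i \<le> 0)"
        using up[OF i] dn[OF i] by linarith
      then show "0 \<le> F x i * (y i - x i)" by (auto simp: mult_nonneg_nonneg mult_nonpos_nonpos)
    qed
  qed
qed

section \<open>Powers with bounded exponents\<close>

lemma signed_pow_abs: "\<bar>signed_pow s t\<bar> = \<bar>t\<bar> powr (s - 1)"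
proof (cases "t = 0")
  case False
  then have "\<bar>t\<bar> powr (s - 2) * \<bar>t\<bar> = \<bar>t\<bar> powr (s - 2) * \<bar>t\<bar> powr 1" by simp
  also have "\<dots> = \<bar>t\<bar> powr (s - 1)" by (subst powr_add[symmetric]) simp
  finally show ?thesis by (simp add: signed_pow_def abs_mult)
qed (simp add: signed_pow_def)

lemma signed_pow_sgn: "signed_pow s t = sgn t * \<bar>t\<bar> powr (s - 1)"
  using signed_pow_abs[of s t]
  by (cases "t > 0"; cases "t = 0") (auto simp: signed_pow_def abs_mult sgn_if split: if_splits)

lemma signed_pow_mult_self: "signed_pow s t * t = \<bar>t\<bar> powr s"
proof (cases "t = 0")
  case False
  have "signed_pow s t * t = \<bar>t\<bar> powr (s - 2) * \<bar>t\<bar> powr 2"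
    using False by (simp add: signed_pow_def power2_eq_square mult.assoc)
  also have "\<dots> = \<bar>t\<bar> powr s" by (subst powr_add[symmetric]) simp
  finally show ?thesis .
qed (simp add: signed_pow_def)

lemma powr_abs_tendsto:
  fixes x :: "nat \<Rightarrow> real"
  assumes "x \<longlonglongrightarrow> y" "0 < s"
  shows "(\<lambda>n. \<bar>x n\<bar> powr s) \<longlonglongrightarrow> \<bar>y\<bar> powr s"
  by (rule tendsto_powr2) (use assms in \<open>auto intro!: tendsto_intros\<close>)

lemma signed_pow_tendsto:
  assumes x: "x \<longlonglongrightarrow> y" and s: "1 < s"
  shows "(\<lambda>n. signed_pow s (x n)) \<longlonglongrightarrow> signed_pow s y"
proof (cases "y = 0")
  case True
  have "(\<lambda>n. \<bar>x n\<bar> powr (s - 1)) \<longlonglongrightarrow> \<bar>y\<bar> powr (s - 1)"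
    by (rule powr_abs_tendsto[OF x]) (use s in auto)
  then have "(\<lambda>n. \<bar>x n\<bar> powr (s - 1)) \<longlonglongrightarrow> 0" using True by simp
  then have "(\<lambda>n. signed_pow s (x n)) \<longlonglongrightarrow> 0"
    by (rule Lim_null_comparison[rotated]) (simp add: signed_pow_abs)
  then show ?thesis using True by (simp add: signed_pow_def)
next
  case False
  have "(\<lambda>n. \<bar>x n\<bar> powr (s - 2) * x n) \<longlonglongrightarrow> \<bar>y\<bar> powr (s - 2) * y"
    by (intro tendsto_intros x) (use False in auto)
  then show ?thesis by (simp add: signed_pow_def)
qed

lemma signed_pow_strict_mono:
  assumes "1 < s" "x < y"
  shows "signed_pow s x < signed_pow s y"
proof -
  consider "0 \<le> x" | "y \<le> 0" | "x < 0" "0 < y" using assms by linarith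
  then show ?thesis
  proof cases
    case 1
    then have "x powr (s - 1) < y powr (s - 1)" using assms by (intro powr_less_mono2) auto
    then show ?thesis using 1 assms by (auto simp: signed_pow_sgn sgn_if)
  next
    case 2
    then have "(- y) powr (s - 1) < (- x) powr (s - 1)" using assms by (intro powr_less_mono2) auto
    then show ?thesis using 2 assms by (auto simp: signed_pow_sgn sgn_if)
  next
    case 3
    then show ?thesis by (auto simp: signed_pow_def mult_neg_pos) (smt (verit) powr_gt_zero mult_pos_pos mult_pos_neg)
  qed
qed

lemma young:
  fixes a b s :: real
  assumes "1 < s" "0 \<le> a" "0 \<le> b"
  shows "a * b \<le> a powr (s / (s - 1)) / (s / (s - 1)) + b powr s / s"
  by (rule Youngs_inequality) (use assms in \<open>auto simp: field_simps\<close>)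

lemma young_weak:
  fixes a b s :: real
  assumes "1 < s" "0 \<le> a" "0 \<le> b"
  shows "a * b \<le> a powr (s / (s - 1)) + b powr s"
proof -
  have "a powr (s / (s - 1)) / (s / (s - 1)) \<le> a powr (s / (s - 1)) / 1"
    by (rule divide_left_mono) (use assms in auto)
  moreover have "b powr s / s \<le> b powr s / 1"
    by (rule divide_left_mono) (use assms in auto)
  ultimately show ?thesis using young[OF assms] by simp
qed

text \<open>The graph of the convex function \<open>|t|\<^sup>s / s\<close> lies above its tangents; in this form the claim is Young's
inequality for the exponents \<open>s/(s-1)\<close> and \<open>s\<close>.\<close>

lemma signed_pow_tangent:
  assumes s: "1 < s"
  shows "\<bar>a\<bar> powr s / s + signed_pow s a * (b - a) \<le> \<bar>b\<bar> powr s / s"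
proof -
  have "signed_pow s a * b \<le> \<bar>a\<bar> powr (s - 1) * \<bar>b\<bar>"
    using abs_mult[of "signed_pow s a" b] signed_pow_abs[of s a] abs_ge_self[of "signed_pow s a * b"] by simp
  also have "\<dots> \<le> (\<bar>a\<bar> powr (s - 1)) powr (s / (s - 1)) / (s / (s - 1)) + \<bar>b\<bar> powr s / s"
    by (rule young) (use s in auto)
  also have "(\<bar>a\<bar> powr (s - 1)) powr (s / (s - 1)) = \<bar>a\<bar> powr s" using s by (simp add: powr_powr)
  also have "\<bar>a\<bar> powr s / (s / (s - 1)) = \<bar>a\<bar> powr s - \<bar>a\<bar> powr s / s" using s by (simp add: field_simps)
  finally show ?thesis by (simp add: right_diff_distrib signed_pow_mult_self)
qed

text \<open>Going from \<open>a\<close> to \<open>b\<close> in two tangent steps through the midpoint gains strictly, because the slope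
\<open>signed_pow s\<close> increases strictly.\<close>

lemma signed_pow_tangent_strict:
  assumes s: "1 < s" and ab: "a \<noteq> b"
  shows "\<bar>a\<bar> powr s / s + signed_pow s a * (b - a) < \<bar>b\<bar> powr s / s"
proof -
  define d where "d = (a + b) / 2"
  have d: "b - d = (b - a) / 2" "d - a = (b - a) / 2" by (auto simp: d_def field_simps)
  have 1: "\<bar>d\<bar> powr s / s + signed_pow s d * (b - d) \<le> \<bar>b\<bar> powr s / s"
   and 2: "\<bar>a\<bar> powr s / s + signed_pow s a * (d - a) \<le> \<bar>d\<bar> powr s / s"
    using signed_pow_tangent[OF s] by auto
  \<comment> \<open>the strict gain at the midpoint \<open>d\<close>\<close>
  have "0 < (signed_pow s d - signed_pow s a) * (b - a)"
  proof (cases "a < b")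
    case True
    then have "signed_pow s a < signed_pow s d" by (intro signed_pow_strict_mono s) (auto simp: d_def)
    then show ?thesis using True by simp
  next
    case False
    then have "signed_pow s d < signed_pow s a" using ab by (intro signed_pow_strict_mono s) (auto simp: d_def)
    then show ?thesis using False ab by (intro mult_neg_neg) auto
  qed
  then have "signed_pow s a * (b - a) < signed_pow s d * (b - d) + signed_pow s a * (d - a)"
    unfolding d by (simp add: field_simps)
  then show ?thesis using 1 2 by linarith
qed

definition convexity_gap :: "real \<Rightarrow> real \<Rightarrow> real \<Rightarrow> real" where
  "convexity_gap s a b = (\<bar>a\<bar> powr s + \<bar>b\<bar> powr s) / 2 - \<bar>(a + b) / 2\<bar> powr s"

lemma convexity_gap_pos:
  assumes "1 < s" "a \<noteq> b" shows "0 < convexity_gap s a b"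
proof -
  define c where "c = (a + b) / 2"
  have "c \<noteq> a" "c \<noteq> b" using assms by (auto simp: c_def field_simps)
  then have "\<bar>c\<bar> powr s / s + signed_pow s c * (a - c) < \<bar>a\<bar> powr s / s"
     "\<bar>c\<bar> powr s / s + signed_pow s c * (b - c) < \<bar>b\<bar> powr s / s"
    using signed_pow_tangent_strict[OF assms(1)] by auto
  moreover have "signed_pow s c * (a - c) + signed_pow s c * (b - c) = 0"
    by (simp add: distrib_left[symmetric] c_def)
  ultimately have "2 * \<bar>c\<bar> powr s / s < (\<bar>a\<bar> powr s + \<bar>b\<bar> powr s) / s" by (simp add: add_divide_distrib)
  then show ?thesis using assms by (simp add: convexity_gap_def c_def divide_less_cancel)
qed

lemma convexity_gap_nonneg: "1 < s \<Longrightarrow> 0 \<le> convexity_gap s a b"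
  using convexity_gap_pos[of s a b] by (cases "a = b") (auto simp: convexity_gap_def)

lemma convexity_gap_scale:
  assumes "0 \<le> M" shows "convexity_gap s (M * a) (M * b) = M powr s * convexity_gap s a b"
proof -
  have "(M * a + M * b) / 2 = M * ((a + b) / 2)" by (simp add: field_simps)
  then show ?thesis using assms
    by (simp only: convexity_gap_def abs_mult powr_mult abs_ge_zero abs_of_nonneg)
       (simp add: algebra_simps add_divide_distrib)
qed

text \<open>By homogeneity it suffices to consider \<open>max |a| |b| = 1\<close>. There, on the compact set of all triples
\<open>(s, a, b)\<close> with \<open>s \<in> [lo, hi]\<close> and \<open>|a - b| \<ge> e\<close>, the positive continuous function
\<open>convexity_gap\<close> has a positive minimum; where \<open>|a - b|\<close> is small compared with the maximum, the first
term on the right already suffices. The constant is uniform in the exponent, as variable exponents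
require.\<close>

lemma uniform_convexity:
  fixes lo hi e :: real
  assumes lo: "1 < lo" and e: "0 < e"
  obtains C where "0 < C" "\<And>s a b. lo \<le> s \<Longrightarrow> s \<le> hi \<Longrightarrow>
      \<bar>a - b\<bar> powr s \<le> e * (\<bar>a\<bar> powr s + \<bar>b\<bar> powr s) + C * convexity_gap s a b"
proof -
  define e' where "e' = min e 1"
  have e': "0 < e'" "e' \<le> e" "e' \<le> 1" using e by (auto simp: e'_def)
  define S where "S = ({lo..hi} \<times> ({-1..1} \<times> {-1..1})) \<inter> {z::real\<times>real\<times>real. e' \<le> \<bar>fst (snd z) - snd (snd z)\<bar>}"
  have "compact S" unfolding S_def
    by (intro compact_Int_closed compact_Times compact_Icc closed_Collect_le continuous_intros)
  have "continuous_on S (\<lambda>z. convexity_gap (fst z) (fst (snd z)) (snd (snd z)))"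
    unfolding convexity_gap_def
    by (intro continuous_intros continuous_on_powr') (use lo in \<open>auto simp: S_def\<close>)
  have "\<exists>\<delta>>0. \<forall>z\<in>S. \<delta> \<le> convexity_gap (fst z) (fst (snd z)) (snd (snd z))"
  proof (cases "S = {}")
    case True then show ?thesis by (auto intro: exI[of _ 1])
  next
    case False
    then obtain z where z: "z \<in> S" "\<And>y. y \<in> S \<Longrightarrow>
      convexity_gap (fst z) (fst (snd z)) (snd (snd z)) \<le> convexity_gap (fst y) (fst (snd y)) (snd (snd y))"
      using continuous_attains_inf[OF \<open>compact S\<close> False \<open>continuous_on S _\<close>] by blast
    have "0 < convexity_gap (fst z) (fst (snd z)) (snd (snd z))"
      using z(1) lo e' by (intro convexity_gap_pos) (auto simp: S_def)
    then show ?thesis using z(2) by blast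
  qed
  then obtain \<delta> where \<delta>: "0 < \<delta>"
    "\<And>s a b. (s, a, b) \<in> S \<Longrightarrow> \<delta> \<le> convexity_gap s a b"
    by (metis fst_conv snd_conv)
  show thesis
  proof (rule that[of "2 powr hi / \<delta>"])
    fix s a b :: real assume s: "lo \<le> s" "s \<le> hi"
    then have s1: "1 < s" using lo by simp
    define M where "M = max \<bar>a\<bar> \<bar>b\<bar>"
    have M0: "0 \<le> M" by (auto simp: M_def)
    have Ms: "M powr s \<le> \<bar>a\<bar> powr s + \<bar>b\<bar> powr s" by (auto simp: M_def max_def)
    have gn: "0 \<le> convexity_gap s a b" by (rule convexity_gap_nonneg[OF s1])
    show "\<bar>a - b\<bar> powr s \<le> e * (\<bar>a\<bar> powr s + \<bar>b\<bar> powr s) + 2 powr hi / \<delta> * convexity_gap s a b"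
    proof (cases "\<bar>a - b\<bar> \<le> e' * M")
      case True
      then have "\<bar>a - b\<bar> powr s \<le> (e' * M) powr s" using s1 by (intro powr_mono2) auto
      also have "\<dots> = e' powr s * M powr s" using e' M0 by (simp add: powr_mult)
      also have "\<dots> \<le> e' powr 1 * M powr s" 
        using e' s1 by (intro mult_right_mono powr_mono') auto
      also have "\<dots> \<le> e * M powr s" using e' by (intro mult_right_mono) auto
      also have "\<dots> \<le> e * (\<bar>a\<bar> powr s + \<bar>b\<bar> powr s)" using e Ms by (intro mult_left_mono) auto
      finally show ?thesis using gn \<delta>(1) by (smt (verit) divide_nonneg_pos mult_nonneg_nonneg powr_ge_zero)
    next
      case False
      have Mp: "0 < M"
      proof (rule ccontr)
        assume "\<not> 0 < M"
        then have "a = 0" "b = 0" using M0 by (auto simp: M_def max_def split: if_splits)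
        then show False using False M0 e' by simp
      qed
      define a' b' where "a' = a / M" and "b' = b / M"
      have ab: "a = M * a'" "b = M * b'" using Mp by (auto simp: a'_def b'_def)
      have "\<bar>a\<bar> \<le> M" "\<bar>b\<bar> \<le> M" by (auto simp: M_def)
      then have "\<bar>a'\<bar> \<le> 1" "\<bar>b'\<bar> \<le> 1" using Mp by (auto simp: a'_def b'_def)
      moreover have "e' \<le> \<bar>a' - b'\<bar>"
      proof -
        have "a' - b' = (a - b) / M" by (simp add: a'_def b'_def diff_divide_distrib)
        then have "\<bar>a' - b'\<bar> = \<bar>a - b\<bar> / M" using Mp by simp
        then show ?thesis using False Mp by (simp add: pos_le_divide_eq not_le less_imp_le)
      qed
      ultimately have "(s, a', b') \<in> S" using s by (auto simp: S_def abs_le_iff)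
      then have "M powr s * \<delta> \<le> convexity_gap s a b"
        unfolding ab using \<delta>(2) M0 by (subst convexity_gap_scale) (auto intro!: mult_left_mono)
      then have "2 powr hi * M powr s \<le> 2 powr hi / \<delta> * convexity_gap s a b"
        using \<delta>(1) by (simp add: field_simps)
      moreover have "\<bar>a - b\<bar> powr s \<le> (2 * M) powr s"
        using s1 by (intro powr_mono2) (auto simp: M_def)
      moreover have "(2 * M) powr s \<le> 2 powr hi * M powr s"
        using s M0 by (auto simp: powr_mult intro!: mult_right_mono powr_mono)
      moreover have "0 \<le> e * (\<bar>a\<bar> powr s + \<bar>b\<bar> powr s)" using e by simp
      ultimately show ?thesis by linarith
    qed
  qed (use \<delta> in auto)
qed

text \<open>A lower power is absorbed into a small multiple of a higher one, uniformly for exponents on the two sides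
of a gap: compare \<open>t\<close> with a threshold \<open>T\<close> so large that \<open>T\<^bsup>ah - bl\<^esup> \<le> e\<close>.\<close>

lemma powr_absorb:
  fixes ah bl e :: real
  assumes "ah < bl" and e: "0 < e"
  obtains C where "1 \<le> C" "\<And>a b t. 0 \<le> a \<Longrightarrow> a \<le> ah \<Longrightarrow> bl \<le> b \<Longrightarrow> 0 \<le> t \<Longrightarrow> t powr a \<le> C + e * t powr b"
proof -
  \<comment> \<open>the exponent \<open>ah - bl\<close> is negative, so a large threshold makes \<open>T\<^bsup>ah - bl\<^esup>\<close> small\<close>
  define T where "T = max 1 (e powr (1 / (ah - bl)))"
  have T: "1 \<le> T" by (simp add: T_def)
  have "T powr (ah - bl) \<le> (e powr (1 / (ah - bl))) powr (ah - bl)"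
    using assms e by (intro powr_mono2') (auto simp: T_def)
  also have "\<dots> = e" using assms by (simp add: powr_powr)
  finally have Te: "T powr (ah - bl) \<le> e" .
  show thesis
  proof (rule that[of "max 1 (T powr ah)"])
    fix a b t :: real assume h: "0 \<le> a" "a \<le> ah" "bl \<le> b" "0 \<le> t"
    have e0: "0 \<le> e * t powr b" using e by simp
    show "t powr a \<le> max 1 (T powr ah) + e * t powr b"
    proof (cases "t \<le> T")
      case True
      then have "t powr a \<le> T powr a" using h by (intro powr_mono2) auto
      also have "\<dots> \<le> T powr ah" using h T by (intro powr_mono) auto
      finally show ?thesis using e0 by simp
    next
      case False
      then have t: "1 < t" "T < t" using T by auto
      have "t powr a = t powr (a - b) * t powr b" by (simp add: powr_add[symmetric])
      also have "\<dots> \<le> T powr (a - b) * t powr b"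
        using t h T assms by (intro mult_right_mono powr_mono2') auto
      also have "\<dots> \<le> T powr (ah - bl) * t powr b" using T h by (intro mult_right_mono powr_mono) auto
      also have "\<dots> \<le> e * t powr b" using Te by (intro mult_right_mono) auto
      finally show ?thesis by simp
    qed
  qed auto
qed

text \<open>For exponents \<open>a \<ge> 1\<close> the lower-order term can be taken linear in \<open>t\<close>; this is what turns \<open>L\<^sup>1\<close> convergence
and an energy bound into convergence in lower powers.\<close>

lemma powr_interpolate:
  fixes ah bl e :: real
  assumes "ah < bl" and e: "0 < e"
  obtains C where "1 \<le> C" "\<And>a b t. 1 \<le> a \<Longrightarrow> a \<le> ah \<Longrightarrow> bl \<le> b \<Longrightarrow> 0 \<le> t \<Longrightarrow> t powr a \<le> C * t + e * t powr b"
proof -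
  obtain C where C: "1 \<le> C" "\<And>a b t. 0 \<le> a \<Longrightarrow> a \<le> ah - 1 \<Longrightarrow> bl - 1 \<le> b \<Longrightarrow> 0 \<le> t \<Longrightarrow> t powr a \<le> C + e * t powr b"
    by (rule powr_absorb[of "ah - 1" "bl - 1" e]) (use assms in auto)
  show thesis
  proof (rule that[OF C(1)])
    fix a b t :: real assume h: "1 \<le> a" "a \<le> ah" "bl \<le> b" "0 \<le> t"
    have "t powr (a - 1) * t \<le> (C + e * t powr (b - 1)) * t"
      using h C(2)[of "a - 1" "b - 1" t] by (intro mult_right_mono) auto
    moreover have "t powr (s - 1) * t = t powr s" for s
      using powr_mult_base[of t "s - 1"] h by (simp add: mult.commute)
    ultimately show "t powr a \<le> C * t + e * t powr b"
      by (simp add: distrib_right mult.assoc)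
  qed
qed

lemma powr_add_le:
  fixes x y s :: real
  assumes "0 \<le> x" "0 \<le> y" "0 \<le> s"
  shows "(x + y) powr s \<le> 2 powr s * (x powr s + y powr s)"
proof -
  have "(x + y) powr s \<le> (2 * max x y) powr s" using assms by (intro powr_mono2) auto
  also have "\<dots> = 2 powr s * max x y powr s" using assms by (simp add: powr_mult)
  also have "\<dots> \<le> 2 powr s * (x powr s + y powr s)" by (intro mult_left_mono) (auto simp: max_def)
  finally show ?thesis .
qed

section \<open>Energies with variable exponents\<close>

locale exponents = finite_measure M
  for M :: "'a measure" +
  fixes P :: "'j::finite \<Rightarrow> 'a \<Rightarrow> real" and lo hi :: real
  assumes P_measurable [measurable]: "P j \<in> borel_measurable M"
    and lo_gt_1: "1 < lo"
    and P_bounds: "x \<in> space M \<Longrightarrow> lo \<le> P j x \<and> P j x \<le> hi"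
begin

text \<open>The functions that occur together -- a Sobolev function and its partial derivatives -- are kept in one
family indexed by \<open>'j\<close>, each with its own exponent. Energies are modulars; the norms enter only where the
Sobolev spaces of the theorem are compared with them.\<close>

definition finite_energy :: "('j \<Rightarrow> 'a \<Rightarrow> real) \<Rightarrow> bool" where
  "finite_energy U \<longleftrightarrow> (\<forall>j. U j \<in> borel_measurable M \<and> integrable M (\<lambda>x. \<bar>U j x\<bar> powr P j x))"

definition energy :: "('j \<Rightarrow> 'a \<Rightarrow> real) \<Rightarrow> real" where
  "energy U = (\<Sum>j\<in>UNIV. \<integral>x. \<bar>U j x\<bar> powr P j x \<partial>M)"

lemma P_gt_1: "x \<in> space M \<Longrightarrow> 1 < P j x" using P_bounds[of x j] lo_gt_1 by simp

lemma finite_energyD [measurable_dest]: "finite_energy U \<Longrightarrow> U j \<in> borel_measurable M"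
  by (auto simp: finite_energy_def)

lemma finite_energy_integrable: "finite_energy U \<Longrightarrow> integrable M (\<lambda>x. \<bar>U j x\<bar> powr P j x)"
  by (auto simp: finite_energy_def)

lemma energy_nonneg: "0 \<le> energy U"
  by (simp add: energy_def sum_nonneg)

lemma energy_component: "(\<integral>x. \<bar>U j x\<bar> powr P j x \<partial>M) \<le> energy U"
  unfolding energy_def by (rule member_le_sum) auto

lemma finite_energy_dominated:
  assumes "finite_energy G" "\<And>j. U j \<in> borel_measurable M" "\<And>j. AE x in M. \<bar>U j x\<bar> \<le> \<bar>G j x\<bar>"
  shows "finite_energy U"
  unfolding finite_energy_def
proof (intro allI conjI assms(2))
  fix j
  show "integrable M (\<lambda>x. \<bar>U j x\<bar> powr P j x)"
  proof (rule Bochner_Integration.integrable_bound[OF finite_energy_integrable[OF assms(1), of j]])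
    show "AE x in M. norm (\<bar>U j x\<bar> powr P j x) \<le> norm (\<bar>G j x\<bar> powr P j x)"
      using assms(3)[of j] AE_space
    proof eventually_elim
      case (elim x)
      then show ?case using P_gt_1[of x j] by (auto intro!: powr_mono2)
    qed
  qed (use assms(2) in measurable)
qed

lemma finite_energy_add_energy:
  assumes U: "finite_energy U" and V: "finite_energy V"
  shows "finite_energy (\<lambda>j x. U j x + V j x) \<and>
    energy (\<lambda>j x. U j x + V j x) \<le> 2 powr hi * (energy U + energy V)"
proof -
  note [measurable] = finite_energyD[OF U] finite_energyD[OF V]
  have pw: "\<bar>U j x + V j x\<bar> powr P j x \<le> 2 powr hi * (\<bar>U j x\<bar> powr P j x + \<bar>V j x\<bar> powr P j x)"
    if "x \<in> space M" for j x
  proof -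
    note p = P_bounds[OF that, of j] lo_gt_1
    have "\<bar>U j x + V j x\<bar> powr P j x \<le> (\<bar>U j x\<bar> + \<bar>V j x\<bar>) powr P j x"
      using p by (intro powr_mono2) auto
    also have "\<dots> \<le> 2 powr P j x * (\<bar>U j x\<bar> powr P j x + \<bar>V j x\<bar> powr P j x)"
      using p by (intro powr_add_le) auto
    also have "\<dots> \<le> 2 powr hi * (\<bar>U j x\<bar> powr P j x + \<bar>V j x\<bar> powr P j x)"
      using p by (intro mult_right_mono powr_mono) auto
    finally show ?thesis .
  qed
  have i: "integrable M (\<lambda>x. 2 powr hi * (\<bar>U j x\<bar> powr P j x + \<bar>V j x\<bar> powr P j x))" for j
    using finite_energy_integrable[OF U] finite_energy_integrable[OF V] by simp
  have i2: "integrable M (\<lambda>x. \<bar>U j x + V j x\<bar> powr P j x)" for j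
    by (rule Bochner_Integration.integrable_bound[OF i[of j]]) (auto intro!: AE_I2 order_trans[OF pw])
  have "(\<integral>x. \<bar>U j x + V j x\<bar> powr P j x \<partial>M)
      \<le> (\<integral>x. 2 powr hi * (\<bar>U j x\<bar> powr P j x + \<bar>V j x\<bar> powr P j x) \<partial>M)" for j
    by (rule integral_mono[OF i2 i pw])
  also have "(\<integral>x. 2 powr hi * (\<bar>U j x\<bar> powr P j x + \<bar>V j x\<bar> powr P j x) \<partial>M) =
      2 powr hi * ((\<integral>x. \<bar>U j x\<bar> powr P j x \<partial>M) + (\<integral>x. \<bar>V j x\<bar> powr P j x \<partial>M))" for j
    using finite_energy_integrable[OF U] finite_energy_integrable[OF V] by simp
  finally have "energy (\<lambda>j x. U j x + V j x) \<le> (\<Sum>j\<in>UNIV.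
     2 powr hi * ((\<integral>x. \<bar>U j x\<bar> powr P j x \<partial>M) + (\<integral>x. \<bar>V j x\<bar> powr P j x \<partial>M)))"
    unfolding energy_def by (intro sum_mono)
  also have "\<dots> = 2 powr hi * (energy U + energy V)"
    by (simp add: energy_def sum_distrib_left[symmetric] sum.distrib)
  finally show ?thesis using i2 by (simp add: finite_energy_def)
qed

lemmas finite_energy_add = finite_energy_add_energy[THEN conjunct1]
lemmas energy_add_le = finite_energy_add_energy[THEN conjunct2]

lemma finite_energy_scale_energy:
  assumes U: "finite_energy U"
  shows "finite_energy (\<lambda>j x. c * U j x) \<and> energy (\<lambda>j x. c * U j x) \<le> max 1 \<bar>c\<bar> powr hi * energy U"
proof -
  note [measurable] = finite_energyD[OF U]
  have pw: "\<bar>c * U j x\<bar> powr P j x \<le> max 1 \<bar>c\<bar> powr hi * \<bar>U j x\<bar> powr P j x" if "x \<in> space M" for j x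
  proof -
    note p = P_bounds[OF that, of j] lo_gt_1
    have "\<bar>c * U j x\<bar> powr P j x \<le> (max 1 \<bar>c\<bar> * \<bar>U j x\<bar>) powr P j x"
      using p by (intro powr_mono2) (auto simp: abs_mult intro!: mult_right_mono)
    also have "\<dots> = max 1 \<bar>c\<bar> powr P j x * \<bar>U j x\<bar> powr P j x" by (simp add: powr_mult)
    also have "\<dots> \<le> max 1 \<bar>c\<bar> powr hi * \<bar>U j x\<bar> powr P j x"
      using p by (intro mult_right_mono powr_mono) auto
    finally show ?thesis .
  qed
  have i: "integrable M (\<lambda>x. max 1 \<bar>c\<bar> powr hi * \<bar>U j x\<bar> powr P j x)" for j
    using finite_energy_integrable[OF U] by simp
  have i2: "integrable M (\<lambda>x. \<bar>c * U j x\<bar> powr P j x)" for j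
    by (rule Bochner_Integration.integrable_bound[OF i[of j]]) (auto intro!: AE_I2 order_trans[OF pw])
  have "(\<integral>x. \<bar>c * U j x\<bar> powr P j x \<partial>M) \<le> (\<integral>x. max 1 \<bar>c\<bar> powr hi * \<bar>U j x\<bar> powr P j x \<partial>M)" for j
    by (rule integral_mono[OF i2 i pw])
  then have "energy (\<lambda>j x. c * U j x) \<le> (\<Sum>j\<in>UNIV. max 1 \<bar>c\<bar> powr hi * (\<integral>x. \<bar>U j x\<bar> powr P j x \<partial>M))"
    unfolding energy_def by (intro sum_mono) simp
  also have "\<dots> = max 1 \<bar>c\<bar> powr hi * energy U"
    by (simp add: energy_def sum_distrib_left)
  finally show ?thesis using i2 by (simp add: finite_energy_def)
qed

lemmas finite_energy_scale = finite_energy_scale_energy[THEN conjunct1]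
lemmas energy_scale_le = finite_energy_scale_energy[THEN conjunct2]

lemma finite_energy_component_integrable:
  assumes V: "finite_energy V" shows "integrable M (V j)"
proof (rule Bochner_Integration.integrable_bound)
  show "integrable M (\<lambda>x. 1 + \<bar>V j x\<bar> powr P j x)"
    using finite_energy_integrable[OF V, of j] by simp
  show "V j \<in> borel_measurable M" by (rule finite_energyD[OF V])
  show "AE x in M. norm (V j x) \<le> norm (1 + \<bar>V j x\<bar> powr P j x)"
  proof (rule AE_I2)
    fix x assume "x \<in> space M"
    then have "\<bar>V j x\<bar> powr 1 \<le> \<bar>V j x\<bar> powr P j x" if "1 \<le> \<bar>V j x\<bar>"
      using P_gt_1[of x j] that by (intro powr_mono) auto
    then show "norm (V j x) \<le> norm (1 + \<bar>V j x\<bar> powr P j x)"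
      by (cases "1 \<le> \<bar>V j x\<bar>") (auto intro!: add_increasing2)
  qed
qed

lemma finite_energy_diff:
  assumes "finite_energy U" "finite_energy V"
  shows "finite_energy (\<lambda>j x. U j x - V j x)"
  using finite_energy_add[OF assms(1) finite_energy_scale[OF assms(2), of "-1"]] by simp

lemma energy_diff_commute: "energy (\<lambda>j x. U j x - V j x) = energy (\<lambda>j x. V j x - U j x)"
  by (simp add: energy_def abs_minus_commute)

lemma energy_diff_le:
  assumes "finite_energy U" "finite_energy V"
  shows "energy (\<lambda>j x. U j x - V j x) \<le> 2 powr hi * (energy U + energy V)"
proof -
  have "energy (\<lambda>j x. - 1 * V j x) = energy V" by (simp add: energy_def)
  with energy_add_le[OF assms(1) finite_energy_scale[OF assms(2), of "-1"]] show ?thesis by simp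
qed

lemma energy_triangle:
  assumes "finite_energy U" "finite_energy V" "finite_energy W"
  shows "energy (\<lambda>j x. U j x - W j x)
    \<le> 2 powr hi * (energy (\<lambda>j x. U j x - V j x) + energy (\<lambda>j x. V j x - W j x))"
  using energy_add_le[OF finite_energy_diff[OF assms(1,2)] finite_energy_diff[OF assms(2,3)]] by simp

lemma finite_energy_bounded:
  assumes "\<And>j. U j \<in> borel_measurable M" "\<And>j x. x \<in> space M \<Longrightarrow> \<bar>U j x\<bar> \<le> B"
  shows "finite_energy U"
  unfolding finite_energy_def
proof (intro allI conjI assms(1))
  fix j
  note [measurable] = assms(1)
  show "integrable M (\<lambda>x. \<bar>U j x\<bar> powr P j x)"
  proof (rule integrable_const_bound[where B = "max 1 B powr hi"])
    show "AE x in M. norm (\<bar>U j x\<bar> powr P j x) \<le> max 1 B powr hi"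
    proof (rule AE_I2)
      fix x assume x: "x \<in> space M"
      note p = P_bounds[OF x, of j] lo_gt_1
      have "\<bar>U j x\<bar> powr P j x \<le> max 1 B powr P j x"
        using p assms(2)[OF x, of j] by (intro powr_mono2) auto
      also have "\<dots> \<le> max 1 B powr hi" using p by (intro powr_mono) auto
      finally show "norm (\<bar>U j x\<bar> powr P j x) \<le> max 1 B powr hi" by simp
    qed
  qed measurable
qed

text \<open>Dominated convergence for energies: the energy density of the difference is at most that of \<open>2 G\<close>.\<close>

lemma energy_tendsto_0_dominated:
  assumes U: "\<And>n j. U n j \<in> borel_measurable M" and V: "\<And>j. V j \<in> borel_measurable M" and G: "finite_energy G"
    and c: "\<And>j. AE x in M. (\<lambda>n. U n j x) \<longlonglongrightarrow> V j x"
    and d: "\<And>j n. AE x in M. \<bar>U n j x\<bar> \<le> G j x"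
  shows "(\<lambda>n. energy (\<lambda>j x. U n j x - V j x)) \<longlonglongrightarrow> 0"
proof -
  note [measurable] = U V
  have "(\<lambda>n. \<integral>x. \<bar>U n j x - V j x\<bar> powr P j x \<partial>M) \<longlonglongrightarrow> (\<integral>x. 0 \<partial>M)" for j
  proof (rule integral_dominated_convergence[where w = "\<lambda>x. \<bar>2 * G j x\<bar> powr P j x"])
    show "integrable M (\<lambda>x. \<bar>2 * G j x\<bar> powr P j x)"
      using finite_energy_integrable[OF finite_energy_scale[OF G]] .
    show "AE x in M. (\<lambda>n. \<bar>U n j x - V j x\<bar> powr P j x) \<longlonglongrightarrow> 0"
      using c[of j] AE_space
    proof eventually_elim
      case (elim x)
      have "(\<lambda>n. U n j x - V j x) \<longlonglongrightarrow> V j x - V j x" by (intro tendsto_intros elim)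
      from powr_abs_tendsto[OF this] show ?case using P_gt_1[OF elim(2), of j] by fastforce
    qed
    fix n
    have "AE x in M. \<forall>n. \<bar>U n j x\<bar> \<le> G j x" using d by (simp add: AE_all_countable)
    then show "AE x in M. norm (\<bar>U n j x - V j x\<bar> powr P j x) \<le> \<bar>2 * G j x\<bar> powr P j x"
      using c[of j] AE_space
    proof eventually_elim
      case (elim x)
      have "\<bar>V j x\<bar> \<le> G j x"
        using tendsto_rabs[OF elim(2)] by (rule LIMSEQ_le_const2) (use elim in auto)
      then have "\<bar>U n j x - V j x\<bar> \<le> \<bar>2 * G j x\<bar>" using elim(1)[rule_format, of n] by linarith
      then show ?case using P_gt_1[OF elim(3), of j] by (auto intro!: powr_mono2)
    qed
  qed auto
  note * = this
  have "(\<lambda>n. \<Sum>j\<in>UNIV. \<integral>x. \<bar>U n j x - V j x\<bar> powr P j x \<partial>M) \<longlonglongrightarrow> (\<Sum>j\<in>(UNIV::'j set). \<integral>x. 0 \<partial>M)"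
    by (rule tendsto_sum) (rule *)
  then show ?thesis by (simp add: energy_def)
qed

text \<open>The mechanism behind the Riesz--Fischer theorem. The weight \<open>2\<^sup>n\<close> costs at most \<open>2\<^bsup>n hi\<^esup>\<close> in energy, so
the densities of \<open>2\<^sup>n D\<^sub>n\<close> still have a finite sum; the pointwise root of that sum dominates every
\<open>2\<^sup>n |D\<^sub>n|\<close>.\<close>

lemma AE_summable_geometric_bound:
  assumes D: "\<And>n. finite_energy (D n)" and e: "\<And>n. energy (D n) \<le> 2 powr (- (hi + 1) * real n)"
  obtains H where "\<And>j. H j \<in> borel_measurable M" "\<And>j x. 0 \<le> H j x" "finite_energy H"
    "\<And>j. AE x in M. \<forall>n. \<bar>D n j x\<bar> \<le> H j x / 2 ^ n"
proof -
  note [measurable] = finite_energyD[OF D]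
  define h where "h n j x = \<bar>2 ^ n * D n j x\<bar> powr P j x" for n j x
  have hm [measurable]: "h n j \<in> borel_measurable M" for n j unfolding h_def by measurable
  have hi: "integrable M (h n j)" for n j
    unfolding h_def by (rule finite_energy_integrable[OF finite_energy_scale[OF D]])
  have hb: "(\<integral>x. h n j x \<partial>M) \<le> (1/2) ^ n" for n j
  proof -
    have "(\<integral>x. h n j x \<partial>M) \<le> energy (\<lambda>j x. 2 ^ n * D n j x)"
      unfolding h_def by (rule energy_component)
    also have "\<dots> \<le> max 1 \<bar>2 ^ n\<bar> powr hi * energy (D n)" by (rule energy_scale_le[OF D])
    also have "\<dots> \<le> (2 powr real n) powr hi * 2 powr (- (hi + 1) * real n)"
      by (intro mult_mono e energy_nonneg) (auto simp: powr_realpow)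
    also have "\<dots> = 2 powr (- real n)"
      by (simp add: powr_powr powr_add[symmetric] algebra_simps)
    also have "\<dots> = (1/2) ^ n" by (simp add: powr_minus powr_realpow power_divide inverse_eq_divide)
    finally show ?thesis .
  qed
  have "(\<integral>\<^sup>+x. (\<Sum>n. ennreal (h n j x)) \<partial>M) < \<infinity>" for j
  proof -
    have "(\<integral>\<^sup>+x. (\<Sum>n. ennreal (h n j x)) \<partial>M) = (\<Sum>n. \<integral>\<^sup>+x. ennreal (h n j x) \<partial>M)"
      by (rule nn_integral_suminf) simp
    also have "\<dots> = (\<Sum>n. ennreal (\<integral>x. h n j x \<partial>M))"
      by (intro suminf_cong nn_integral_eq_integral hi) (simp add: h_def)
    also have "\<dots> \<le> (\<Sum>n. ennreal ((1/2) ^ n))"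
      by (intro suminf_le summableI ennreal_leI hb)
    also have "\<dots> = ennreal (\<Sum>n. (1/2) ^ n)" by (rule suminf_ennreal2) (auto intro: summable_geometric)
    also have "\<dots> < \<infinity>" by simp
    finally show ?thesis .
  qed
  note fin = this
  define H0 where "H0 j x = enn2real (\<Sum>n. ennreal (h n j x))" for j x
  have H0m [measurable]: "H0 j \<in> borel_measurable M" for j unfolding H0_def by measurable
  have H0i: "integrable M (H0 j)" for j
  proof (rule integrableI_bounded)
    have "(\<integral>\<^sup>+x. ennreal (norm (H0 j x)) \<partial>M) \<le> (\<integral>\<^sup>+x. (\<Sum>n. ennreal (h n j x)) \<partial>M)"
      by (rule nn_integral_mono) (simp add: H0_def ennreal_enn2real_if)
    then show "(\<integral>\<^sup>+x. ennreal (norm (H0 j x)) \<partial>M) < \<infinity>" using fin[of j] by (rule order_le_less_trans)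
  qed measurable
  have H0b: "AE x in M. \<forall>n. h n j x \<le> H0 j x" for j
  proof -
    have "AE x in M. (\<Sum>n. ennreal (h n j x)) \<noteq> \<infinity>"
      by (rule nn_integral_PInf_AE) (use fin in \<open>auto simp: less_top\<close>)
    then show ?thesis
    proof eventually_elim
      case (elim x)
      show ?case
      proof
        fix n
        have "ennreal (h n j x) \<le> (\<Sum>n. ennreal (h n j x))"
          using sum_le_suminf[of "\<lambda>n. ennreal (h n j x)" "{n}"] by (simp add: summableI)
        then have "enn2real (ennreal (h n j x)) \<le> H0 j x"
          unfolding H0_def using elim by (intro enn2real_mono) (auto simp: less_top)
        then show "h n j x \<le> H0 j x" by (simp add: h_def)
      qed
    qed
  qed
  have H00: "0 \<le> H0 j x" for j x by (simp add: H0_def)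
  define H where "H j x = H0 j x powr (1 / P j x)" for j x
  show thesis
  proof (rule that[of H])
    show Hm: "H j \<in> borel_measurable M" for j unfolding H_def by measurable
    show "0 \<le> H j x" for j x by (simp add: H_def)
    have "\<bar>H j x\<bar> powr P j x = H0 j x" if "x \<in> space M" for j x
      using P_gt_1[OF that, of j] H00[of j x] by (simp add: H_def powr_powr)
    then have "integrable M (\<lambda>x. \<bar>H j x\<bar> powr P j x)" for j
      using H0i[of j] by (subst Bochner_Integration.integrable_cong[OF refl]) auto
    then show "finite_energy H" using Hm by (simp add: finite_energy_def)
    show "AE x in M. \<forall>n. \<bar>D n j x\<bar> \<le> H j x / 2 ^ n" for j
      using H0b[of j] AE_space
    proof eventually_elim
      case (elim x)
      show ?case
      proof
        fix n
        have "\<bar>2 ^ n * D n j x\<bar> = (\<bar>2 ^ n * D n j x\<bar> powr P j x) powr (1 / P j x)"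
          using P_gt_1[OF elim(2), of j] by (simp add: powr_powr)
        also have "\<dots> \<le> H j x" unfolding H_def
          using elim(1)[rule_format, of n] P_gt_1[OF elim(2), of j] by (intro powr_mono2) (auto simp: h_def)
        finally show "\<bar>D n j x\<bar> \<le> H j x / 2 ^ n" by (simp add: abs_mult field_simps)
      qed
    qed
  qed
qed

text \<open>Completeness, together with the domination that later limits need. For a subsequence whose increments
decay fast enough the previous lemma bounds the telescoping series by a function of finite energy.\<close>

proposition energy_Cauchy_limit:
  fixes U :: "nat \<Rightarrow> 'j \<Rightarrow> 'a \<Rightarrow> real"
  assumes U: "\<And>n. finite_energy (U n)"
    and Cauchy: "\<And>e. 0 < e \<Longrightarrow> \<exists>N. \<forall>m\<ge>N. \<forall>n\<ge>N. energy (\<lambda>j x. U m j x - U n j x) < e"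
  obtains k V G where "strict_mono k" "finite_energy V" "finite_energy G"
    "\<And>j. AE x in M. (\<lambda>n. U (k n) j x) \<longlonglongrightarrow> V j x"
    "\<And>j. AE x in M. \<forall>n. \<bar>U (k n) j x\<bar> \<le> G j x"
    "(\<lambda>n. energy (\<lambda>j x. U (k n) j x - V j x)) \<longlonglongrightarrow> 0"
proof -
  note [measurable] = finite_energyD[OF U]
  have "\<forall>n. \<exists>N. \<forall>m\<ge>N. \<forall>m'\<ge>N. energy (\<lambda>j x. U m j x - U m' j x) < 2 powr (- (hi + 1) * real n)"
    using Cauchy by simp
  then obtain N :: "nat \<Rightarrow> nat" where N: "\<And>n m m'. m \<ge> N n \<Longrightarrow> m' \<ge> N n \<Longrightarrow>
      energy (\<lambda>j x. U m j x - U m' j x) < 2 powr (- (hi + 1) * real n)" by metis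
  \<comment> \<open>partial sums make the subsequence strictly increasing and at the same time at least \<open>N n\<close>\<close>
  define k where "k n = (\<Sum>i\<le>n. N i + 1)" for n
  have k: "strict_mono k" unfolding strict_mono_Suc_iff by (simp add: k_def)
  have kN: "N n \<le> k n" for n
  proof -
    have "N n + 1 \<le> k n" unfolding k_def by (rule member_le_sum) auto
    then show ?thesis by simp
  qed
  define D where "D n j x = U (k (Suc n)) j x - U (k n) j x" for n j x
  have D: "finite_energy (D n)" for n unfolding D_def by (intro finite_energy_diff U)
  have De: "energy (D n) \<le> 2 powr (- (hi + 1) * real n)" for n
    unfolding D_def using kN[of n] strict_monoD[OF k, of n "Suc n"]
    by (intro less_imp_le[OF N[of n]]) auto
  obtain H where H: "\<And>j. H j \<in> borel_measurable M" "\<And>j x. 0 \<le> H j x" "finite_energy H"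
    "\<And>j. AE x in M. \<forall>n. \<bar>D n j x\<bar> \<le> H j x / 2 ^ n"
    using AE_summable_geometric_bound[of D] D De by blast
  define G where "G j x = \<bar>U (k 0) j x\<bar> + 2 * H j x" for j x
  define V where "V j x = lim (\<lambda>n. U (k n) j x)" for j x
  have Vm [measurable]: "V j \<in> borel_measurable M" for j unfolding V_def by measurable
  have tel: "U (k n) j x = U (k 0) j x + (\<Sum>i<n. D i j x)" for n j x
    by (induction n) (auto simp: D_def)
  have conv: "(\<lambda>n. U (k n) j x) \<longlonglongrightarrow> V j x" if "\<forall>n. \<bar>D n j x\<bar> \<le> H j x / 2 ^ n" for j x
  proof -
    have "summable (\<lambda>n. H j x * (1/2) ^ n)" by (intro summable_mult summable_geometric) auto
    then have "summable (\<lambda>n. D n j x)"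
      by (rule summable_comparison_test'[of _ 0]) (use that in \<open>auto simp: power_divide\<close>)
    then have "(\<lambda>n. U (k 0) j x + (\<Sum>i<n. D i j x)) \<longlonglongrightarrow> U (k 0) j x + (\<Sum>i. D i j x)"
      by (intro tendsto_intros summable_LIMSEQ)
    then have "convergent (\<lambda>n. U (k n) j x)" unfolding tel[symmetric] by (auto simp: convergent_def)
    then show ?thesis unfolding V_def by (simp add: convergent_LIMSEQ_iff)
  qed
  have dom: "\<bar>U (k n) j x\<bar> \<le> G j x" if "\<forall>n. \<bar>D n j x\<bar> \<le> H j x / 2 ^ n" for j x n
  proof -
    have "\<bar>\<Sum>i<n. D i j x\<bar> \<le> (\<Sum>i<n. \<bar>D i j x\<bar>)" by (rule sum_abs)
    also have "\<dots> \<le> (\<Sum>i<n. H j x * (1/2) ^ i)" using that by (intro sum_mono) (auto simp: power_divide)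
    also have "\<dots> = H j x * (\<Sum>i<n. (1/2) ^ i)" by (simp add: sum_distrib_left)
    also have "\<dots> \<le> H j x * 2"
    proof (intro mult_left_mono H)
      have "(\<Sum>i<n. (1/2::real) ^ i) = 2 - 2 * (1/2) ^ n" by (induction n) auto
      then show "(\<Sum>i<n. (1/2::real) ^ i) \<le> 2" by simp
    qed
    finally show ?thesis unfolding tel[of n] G_def by linarith
  qed
  have absU: "finite_energy (\<lambda>j x. \<bar>U (k 0) j x\<bar>)"
    by (rule finite_energy_dominated[OF U[of "k 0"]]) auto
  have Gf: "finite_energy G" unfolding G_def
    by (intro finite_energy_add finite_energy_scale H absU)
  have c: "AE x in M. (\<lambda>n. U (k n) j x) \<longlonglongrightarrow> V j x" for j
    using H(4)[of j] by eventually_elim (rule conv)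
  have d: "AE x in M. \<forall>n. \<bar>U (k n) j x\<bar> \<le> G j x" for j
    using H(4)[of j] by eventually_elim (use dom in blast)
  have Vf: "finite_energy V"
  proof (rule finite_energy_dominated[OF Gf Vm])
    show "AE x in M. \<bar>V j x\<bar> \<le> \<bar>G j x\<bar>" for j
      using c[of j] d[of j]
    proof eventually_elim
      case (elim x)
      have "\<bar>V j x\<bar> \<le> G j x"
        using tendsto_rabs[OF elim(1)] by (rule LIMSEQ_le_const2) (use elim in auto)
      then show ?case by simp
    qed
  qed
  show thesis
  proof (rule that[OF k Vf Gf c d])
    show "(\<lambda>n. energy (\<lambda>j x. U (k n) j x - V j x)) \<longlonglongrightarrow> 0"
    proof (rule energy_tendsto_0_dominated[OF _ _ Gf c])
      show "AE x in M. \<bar>U (k n) j x\<bar> \<le> G j x" for j n using d[of j] by eventually_elim auto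
    qed measurable
  qed
qed

end

section \<open>The abstract problem with a convection term\<close>

text \<open>What the Galerkin argument uses of the boundary value problem. Component \<open>j0\<close> plays the role of \<open>u\<close>, the
other components that of \<open>Du\<close>; \<open>g\<close> is the right-hand side as a function of all components, and the \<open>\<phi>\<^sub>i\<close>
are the Galerkin basis. \<open>g_growth\<close> places \<open>g\<close> in the dual of \<open>L\<^bsup>q(x)\<^esup>\<close>, and \<open>g_coercive\<close> lets half of the
energy absorb \<open>g u\<close>.\<close>

locale convection_problem = exponents M P lo hi
  for M :: "'a measure" and P :: "'j::finite \<Rightarrow> 'a \<Rightarrow> real" and lo hi :: real +
  fixes j0 :: 'j and q :: "'a \<Rightarrow> real" and qh :: real and g :: "'a \<Rightarrow> ('j \<Rightarrow> real) \<Rightarrow> real"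
    and h :: "'a \<Rightarrow> real" and A :: real and \<phi> :: "nat \<Rightarrow> 'j \<Rightarrow> 'a \<Rightarrow> real" and B :: "nat \<Rightarrow> real"
  assumes q_bounds: "x \<in> space M \<Longrightarrow> 1 < q x \<and> q x \<le> qh" and qh_pos: "0 < qh" and qh_less: "qh < lo"
    and g_measurable: "(\<And>j. U j \<in> borel_measurable M) \<Longrightarrow> (\<lambda>x. g x (\<lambda>j. U j x)) \<in> borel_measurable M"
    and g_continuous: "x \<in> space M \<Longrightarrow> (\<And>j. (\<lambda>n. y n j) \<longlonglongrightarrow> z j) \<Longrightarrow> (\<lambda>n. g x (y n)) \<longlonglongrightarrow> g x z"
    and h_integrable: "integrable M h" and h_nonneg: "0 \<le> h x" and A_pos: "0 < A"
    and g_growth: "AE x in M. \<forall>y. \<bar>g x y\<bar> powr (q x / (q x - 1)) \<le> A * (h x + (\<Sum>j\<in>UNIV. \<bar>y j\<bar> powr P j x))"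
    and g_coercive: "AE x in M. \<forall>y. \<bar>g x y * y j0\<bar> \<le> h x + (\<Sum>j\<in>UNIV. \<bar>y j\<bar> powr P j x) / 2"
    and \<phi>_measurable [measurable]: "\<phi> i j \<in> borel_measurable M"
    and \<phi>_bounded: "x \<in> space M \<Longrightarrow> \<bar>\<phi> i j x\<bar> \<le> B i"
begin

definition comb :: "nat \<Rightarrow> (nat \<Rightarrow> real) \<Rightarrow> 'j \<Rightarrow> 'a \<Rightarrow> real" where
  "comb m c j x = (\<Sum>i<m. c i * \<phi> i j x)"

text \<open>The two sides of the weak formulation: \<open>\<langle>A U, V\<rangle>\<close> and the integral of the right-hand side against \<open>V\<close>.\<close>

definition principal :: "('j \<Rightarrow> 'a \<Rightarrow> real) \<Rightarrow> ('j \<Rightarrow> 'a \<Rightarrow> real) \<Rightarrow> real" where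
  "principal U V = (\<Sum>j\<in>UNIV. \<integral>x. signed_pow (P j x) (U j x) * V j x \<partial>M)"

definition convection :: "('j \<Rightarrow> 'a \<Rightarrow> real) \<Rightarrow> ('j \<Rightarrow> 'a \<Rightarrow> real) \<Rightarrow> real" where
  "convection U V = (\<integral>x. g x (\<lambda>j. U j x) * V j0 x \<partial>M)"

lemma g_measurable' [measurable (raw)]:
  "(\<And>j. U j \<in> borel_measurable M) \<Longrightarrow> (\<lambda>x. g x (\<lambda>j. U j x)) \<in> borel_measurable M"
  by (rule g_measurable)

lemma signed_pow_mult_bound: "x \<in> space M \<Longrightarrow> \<bar>signed_pow (P j x) a * v\<bar> \<le> \<bar>a\<bar> powr P j x + \<bar>v\<bar> powr P j x"
  using young_weak[of "P j x" "\<bar>a\<bar> powr (P j x - 1)" "\<bar>v\<bar>"] P_gt_1[of x j]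
  by (simp add: abs_mult signed_pow_abs powr_powr)

lemma signed_pow_measurable [measurable]:
  assumes [measurable]: "U \<in> borel_measurable M"
  shows "(\<lambda>x. signed_pow (P j x) (U x)) \<in> borel_measurable M"
proof -
  have [measurable]: "(\<lambda>x. P j x) \<in> borel_measurable M" by (rule P_measurable)
  show ?thesis unfolding signed_pow_def by measurable
qed

text \<open>Young's inequality with a small weight \<open>d\<close> on \<open>g\<close>, followed by interpolation of \<open>|v|\<^bsup>q(x)\<^esup>\<close> between
\<open>|v|\<close> and \<open>|v|\<^bsup>P(x)\<^esup>\<close>. Only the linear term carries a large constant. Both the integrability of \<open>g v\<close> and the
smallness of the pairing for \<open>L\<^sup>1\<close>-small \<open>v\<close> of bounded energy follow from this one estimate.\<close>

lemma g_mult_absorb: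
  assumes "0 < \<theta>"
  obtains C where "1 \<le> C" "AE x in M. \<forall>y v. \<bar>g x y * v\<bar>
      \<le> \<theta> * (h x + (\<Sum>j\<in>UNIV. \<bar>y j\<bar> powr P j x)) + C * \<bar>v\<bar> + \<theta> * \<bar>v\<bar> powr P j0 x"
proof -
  define d where "d = min 1 (\<theta> / A)"
  have d: "0 < d" "d \<le> 1" "d * A \<le> \<theta>" using assms A_pos by (auto simp: d_def min_def field_simps)
  obtain C where C: "1 \<le> C"
    "\<And>a b t. 1 \<le> a \<Longrightarrow> a \<le> qh \<Longrightarrow> lo \<le> b \<Longrightarrow> 0 \<le> t \<Longrightarrow> t powr a \<le> C * t + \<theta> * d powr qh * t powr b"
    using powr_interpolate[of qh lo "\<theta> * d powr qh"] qh_less assms d by auto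
  define C' where "C' = C * d powr (- qh)"
  have "AE x in M. \<forall>y v. \<bar>g x y * v\<bar>
      \<le> \<theta> * (h x + (\<Sum>j\<in>UNIV. \<bar>y j\<bar> powr P j x)) + C' * \<bar>v\<bar> + \<theta> * \<bar>v\<bar> powr P j0 x"
    using g_growth AE_space
  proof eventually_elim
    case (elim x)
    note q = q_bounds[OF elim(2)]
    define s where "s = q x / (q x - 1)"
    have s: "1 \<le> s" using q by (simp add: s_def)
    show ?case
    proof (intro allI)
      fix y v
      have "\<bar>g x y * v\<bar> = (d * \<bar>g x y\<bar>) * (\<bar>v\<bar> / d)" using d by (simp add: abs_mult)
      also have "\<dots> \<le> (d * \<bar>g x y\<bar>) powr s + (\<bar>v\<bar> / d) powr q x"
        unfolding s_def by (rule young_weak) (use q d in auto)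
      also have "(d * \<bar>g x y\<bar>) powr s \<le> \<theta> * (h x + (\<Sum>j\<in>UNIV. \<bar>y j\<bar> powr P j x))"
      proof -
        have "(d * \<bar>g x y\<bar>) powr s = d powr s * \<bar>g x y\<bar> powr s" using d by (simp add: powr_mult)
        also have "\<dots> \<le> d powr 1 * (A * (h x + (\<Sum>j\<in>UNIV. \<bar>y j\<bar> powr P j x)))"
          using elim(1) s d by (intro mult_mono powr_mono') (auto simp: s_def)
        also have "\<dots> = (d * A) * (h x + (\<Sum>j\<in>UNIV. \<bar>y j\<bar> powr P j x))" using d by simp
        also have "\<dots> \<le> \<theta> * (h x + (\<Sum>j\<in>UNIV. \<bar>y j\<bar> powr P j x))"
          using d h_nonneg[of x] by (intro mult_right_mono add_nonneg_nonneg sum_nonneg) auto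
        finally show ?thesis .
      qed
      also have "(\<bar>v\<bar> / d) powr q x \<le> d powr (- qh) * \<bar>v\<bar> powr q x"
      proof -
        have "(\<bar>v\<bar> / d) powr q x = d powr (- q x) * \<bar>v\<bar> powr q x"
          using d by (simp add: powr_divide powr_minus_divide)
        also have "\<dots> \<le> d powr (- qh) * \<bar>v\<bar> powr q x"
          using d q by (intro mult_right_mono powr_mono') auto
        finally show ?thesis .
      qed
      also have "d powr (- qh) * \<bar>v\<bar> powr q x \<le> d powr (- qh) * (C * \<bar>v\<bar> + \<theta> * d powr qh * \<bar>v\<bar> powr P j0 x)"
        using q P_bounds[OF elim(2), of j0] by (intro mult_left_mono C) auto
      also have "d powr (- qh) * (C * \<bar>v\<bar> + \<theta> * d powr qh * \<bar>v\<bar> powr P j0 x)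
          = C' * \<bar>v\<bar> + \<theta> * \<bar>v\<bar> powr P j0 x"
        using d by (simp add: C'_def powr_minus field_simps)
      finally show "\<bar>g x y * v\<bar>
         \<le> \<theta> * (h x + (\<Sum>j\<in>UNIV. \<bar>y j\<bar> powr P j x)) + C' * \<bar>v\<bar> + \<theta> * \<bar>v\<bar> powr P j0 x"
        by (simp add: add.assoc)
    qed
  qed
  moreover have "1 \<le> C'"
  proof -
    have "1 = d powr 0" using d by simp
    also have "\<dots> \<le> d powr (- qh)"
      using d qh_pos by (intro powr_mono') auto
    finally show ?thesis using C(1) unfolding C'_def
      by (metis mult_mono' mult_1 zero_le_one)
  qed
  ultimately show thesis using that by blast
qed

lemma integrable_principal:
  assumes "finite_energy U" "finite_energy V"
  shows "integrable M (\<lambda>x. signed_pow (P j x) (U j x) * V j x)"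
proof (rule Bochner_Integration.integrable_bound)
  note [measurable] = finite_energyD[OF assms(1)] finite_energyD[OF assms(2)]
  show "integrable M (\<lambda>x. \<bar>U j x\<bar> powr P j x + \<bar>V j x\<bar> powr P j x)"
    using assms finite_energy_integrable by simp
  show "(\<lambda>x. signed_pow (P j x) (U j x) * V j x) \<in> borel_measurable M" by measurable
qed (auto intro!: AE_I2 order_trans[OF signed_pow_mult_bound])

lemma integrable_energy_density: "finite_energy U \<Longrightarrow> integrable M (\<lambda>x. \<Sum>j\<in>UNIV. \<bar>U j x\<bar> powr P j x)"
  using finite_energy_integrable by simp

lemma energy_eq_integral: "finite_energy U \<Longrightarrow> energy U = (\<integral>x. (\<Sum>j\<in>UNIV. \<bar>U j x\<bar> powr P j x) \<partial>M)"
  unfolding energy_def using finite_energy_integrable by (subst Bochner_Integration.integral_sum) auto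

lemma integrable_convection:
  assumes "finite_energy U" "finite_energy V"
  shows "integrable M (\<lambda>x. g x (\<lambda>j. U j x) * V j0 x)"
proof -
  note [measurable] = finite_energyD[OF assms(1)] finite_energyD[OF assms(2)]
  obtain C where C: "AE x in M. \<forall>y v. \<bar>g x y * v\<bar>
      \<le> 1 * (h x + (\<Sum>j\<in>UNIV. \<bar>y j\<bar> powr P j x)) + C * \<bar>v\<bar> + 1 * \<bar>v\<bar> powr P j0 x"
    by (rule g_mult_absorb[of 1]) auto
  show ?thesis
  proof (rule Bochner_Integration.integrable_bound)
    show "integrable M (\<lambda>x. 1 * (h x + (\<Sum>j\<in>UNIV. \<bar>U j x\<bar> powr P j x)) + C * \<bar>V j0 x\<bar> + 1 * \<bar>V j0 x\<bar> powr P j0 x)"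
      using integrable_energy_density[OF assms(1)] finite_energy_component_integrable[OF assms(2)] h_integrable
        finite_energy_integrable[OF assms(2)] by simp
    show "AE x in M. norm (g x (\<lambda>j. U j x) * V j0 x) \<le> norm (1 * (h x + (\<Sum>j\<in>UNIV. \<bar>U j x\<bar> powr P j x)) + C * \<bar>V j0 x\<bar> + 1 * \<bar>V j0 x\<bar> powr P j0 x)"
      using C by eventually_elim (auto intro: order_trans[OF _ abs_ge_self])
  qed measurable
qed

lemma convection_absorb:
  assumes "0 < \<theta>"
  obtains C where "1 \<le> C" "\<And>U V. finite_energy U \<Longrightarrow> finite_energy V \<Longrightarrow>
     \<bar>convection U V\<bar> \<le> \<theta> * ((\<integral>x. h x \<partial>M) + energy U) + C * (\<integral>x. \<bar>V j0 x\<bar> \<partial>M) + \<theta> * energy V"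
proof -
  obtain C where C1: "1 \<le> C" and C: "AE x in M. \<forall>y v. \<bar>g x y * v\<bar>
      \<le> \<theta> * (h x + (\<Sum>j\<in>UNIV. \<bar>y j\<bar> powr P j x)) + C * \<bar>v\<bar> + \<theta> * \<bar>v\<bar> powr P j0 x"
    by (rule g_mult_absorb[OF assms])
  show thesis
  proof (rule that[OF C1])
    fix U V assume U: "finite_energy U" and V: "finite_energy V"
    note i = integrable_energy_density[OF U] finite_energy_component_integrable[OF V, of j0] h_integrable
      finite_energy_integrable[OF V, of j0]
    have "\<bar>convection U V\<bar> \<le> (\<integral>x. \<bar>g x (\<lambda>j. U j x) * V j0 x\<bar> \<partial>M)"
      unfolding convection_def by (rule integral_abs_bound)
    also have "\<dots> \<le> (\<integral>x. \<theta> * (h x + (\<Sum>j\<in>UNIV. \<bar>U j x\<bar> powr P j x)) + C * \<bar>V j0 x\<bar> + \<theta> * \<bar>V j0 x\<bar> powr P j0 x \<partial>M)"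
    proof (rule integral_mono_AE)
      show "AE x in M. \<bar>g x (\<lambda>j. U j x) * V j0 x\<bar> \<le> \<theta> * (h x + (\<Sum>j\<in>UNIV. \<bar>U j x\<bar> powr P j x)) + C * \<bar>V j0 x\<bar> + \<theta> * \<bar>V j0 x\<bar> powr P j0 x"
        using C by eventually_elim auto
    qed (use i integrable_convection[OF U V] in auto)
    also have "\<dots> = \<theta> * ((\<integral>x. h x \<partial>M) + energy U) + C * (\<integral>x. \<bar>V j0 x\<bar> \<partial>M) + \<theta> * (\<integral>x. \<bar>V j0 x\<bar> powr P j0 x \<partial>M)"
      using i by (simp add: energy_eq_integral[OF U])
    also have "\<dots> \<le> \<theta> * ((\<integral>x. h x \<partial>M) + energy U) + C * (\<integral>x. \<bar>V j0 x\<bar> \<partial>M) + \<theta> * energy V"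
      using energy_component[of V j0] assms by simp
    finally show "\<bar>convection U V\<bar> \<le> \<dots>" .
  qed
qed

lemma principal_self: "principal U U = energy U"
  by (simp add: principal_def energy_def signed_pow_mult_self)

lemma principal_scale: "principal U (\<lambda>j x. c * V j x) = c * principal U V"
  by (simp add: principal_def sum_distrib_left mult.left_commute)

lemma convection_scale: "convection U (\<lambda>j x. c * V j x) = c * convection U V"
  by (simp add: convection_def mult.left_commute)

lemma principal_convection_tendsto:
  assumes U: "\<And>n j. U n j \<in> borel_measurable M" "\<And>j. U' j \<in> borel_measurable M"
    and V: "\<And>n j. V n j \<in> borel_measurable M" "\<And>j. V' j \<in> borel_measurable M"
    and G: "finite_energy G"
    and Ul: "\<And>j. AE x in M. (\<lambda>n. U n j x) \<longlonglongrightarrow> U' j x" and Vl: "\<And>j. AE x in M. (\<lambda>n. V n j x) \<longlonglongrightarrow> V' j x"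
    and Ud: "\<And>j. AE x in M. \<forall>n. \<bar>U n j x\<bar> \<le> G j x" and Vd: "\<And>j. AE x in M. \<forall>n. \<bar>V n j x\<bar> \<le> G j x"
  shows "(\<lambda>n. principal (U n) (V n)) \<longlonglongrightarrow> principal U' V'"
    and "(\<lambda>n. convection (U n) (V n)) \<longlonglongrightarrow> convection U' V'"
proof -
  note [measurable] = U V
  have Gj: "integrable M (\<lambda>x. \<bar>G j x\<bar> powr P j x)" for j by (rule finite_energy_integrable[OF G])
  have "(\<lambda>n. \<integral>x. signed_pow (P j x) (U n j x) * V n j x \<partial>M) \<longlonglongrightarrow> (\<integral>x. signed_pow (P j x) (U' j x) * V' j x \<partial>M)" for j
  proof (rule integral_dominated_convergence[where w = "\<lambda>x. \<bar>G j x\<bar> powr P j x + \<bar>G j x\<bar> powr P j x"])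
    show "AE x in M. (\<lambda>n. signed_pow (P j x) (U n j x) * V n j x) \<longlonglongrightarrow> signed_pow (P j x) (U' j x) * V' j x"
      using Ul[of j] Vl[of j] AE_space
      by eventually_elim (intro tendsto_mult signed_pow_tendsto P_gt_1)
    fix n
    show "AE x in M. norm (signed_pow (P j x) (U n j x) * V n j x) \<le> \<bar>G j x\<bar> powr P j x + \<bar>G j x\<bar> powr P j x"
      using Ud[of j] Vd[of j] AE_space
    proof eventually_elim
      case (elim x)
      have "\<bar>U n j x\<bar> powr P j x \<le> \<bar>G j x\<bar> powr P j x" "\<bar>V n j x\<bar> powr P j x \<le> \<bar>G j x\<bar> powr P j x"
        using elim(1,2)[rule_format, of n] P_gt_1[OF elim(3), of j] by (auto intro!: powr_mono2)
      then show ?case using signed_pow_mult_bound[OF elim(3), of j "U n j x" "V n j x"] by simp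
    qed
  qed (use Gj in auto)
  note * = this
  show "(\<lambda>n. principal (U n) (V n)) \<longlonglongrightarrow> principal U' V'"
    unfolding principal_def by (rule tendsto_sum) (rule *)
  obtain C where C1: "1 \<le> C" and C: "AE x in M. \<forall>y v. \<bar>g x y * v\<bar>
      \<le> 1 * (h x + (\<Sum>j\<in>UNIV. \<bar>y j\<bar> powr P j x)) + C * \<bar>v\<bar> + 1 * \<bar>v\<bar> powr P j0 x"
    by (rule g_mult_absorb[of 1]) auto
  have Uall: "AE x in M. \<forall>j. (\<lambda>n. U n j x) \<longlonglongrightarrow> U' j x" and Udall: "AE x in M. \<forall>j n. \<bar>U n j x\<bar> \<le> G j x"
    using Ul Ud by (auto intro!: eventually_all_finite simp: AE_all_countable)
  show "(\<lambda>n. convection (U n) (V n)) \<longlonglongrightarrow> convection U' V'"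
    unfolding convection_def
  proof (rule integral_dominated_convergence[where
        w = "\<lambda>x. (h x + (\<Sum>j\<in>UNIV. \<bar>G j x\<bar> powr P j x)) + C * \<bar>G j0 x\<bar> + \<bar>G j0 x\<bar> powr P j0 x"])
    show "integrable M (\<lambda>x. (h x + (\<Sum>j\<in>UNIV. \<bar>G j x\<bar> powr P j x)) + C * \<bar>G j0 x\<bar> + \<bar>G j0 x\<bar> powr P j0 x)"
      using Gj h_integrable finite_energy_component_integrable[OF G] by simp
    show "AE x in M. (\<lambda>n. g x (\<lambda>j. U n j x) * V n j0 x) \<longlonglongrightarrow> g x (\<lambda>j. U' j x) * V' j0 x"
      using Uall Vl[of j0] AE_space
      by eventually_elim (intro tendsto_mult g_continuous; blast)
    fix n
    show "AE x in M. norm (g x (\<lambda>j. U n j x) * V n j0 x)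
        \<le> (h x + (\<Sum>j\<in>UNIV. \<bar>G j x\<bar> powr P j x)) + C * \<bar>G j0 x\<bar> + \<bar>G j0 x\<bar> powr P j0 x"
      using Udall Vd[of j0] C AE_space
    proof eventually_elim
      case (elim x)
      have "\<bar>U n j x\<bar> powr P j x \<le> \<bar>G j x\<bar> powr P j x" for j
        using elim(1)[rule_format, of n j] P_gt_1[OF elim(4), of j] by (auto intro!: powr_mono2)
      then have 1: "(\<Sum>j\<in>UNIV. \<bar>U n j x\<bar> powr P j x) \<le> (\<Sum>j\<in>UNIV. \<bar>G j x\<bar> powr P j x)" by (intro sum_mono)
      have 2: "\<bar>V n j0 x\<bar> \<le> \<bar>G j0 x\<bar>" using elim(2)[rule_format, of n] by simp
      then have 3: "\<bar>V n j0 x\<bar> powr P j0 x \<le> \<bar>G j0 x\<bar> powr P j0 x"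
        using P_gt_1[OF elim(4), of j0] by (auto intro!: powr_mono2)
      have 4: "C * \<bar>V n j0 x\<bar> \<le> C * \<bar>G j0 x\<bar>" using 2 C1 by (intro mult_left_mono) auto
      show ?case using elim(3)[rule_format, of "\<lambda>j. U n j x" "V n j0 x"] 1 3 4 by simp
    qed
  qed measurable
qed

end

context convection_problem
begin

text \<open>The cubes of coefficients grow with the number of basis functions, so that the trial sets increase, are
convex and exhaust the span of the basis. Their side \<open>m + 1\<close> is positive also for \<open>m = 0\<close>.\<close>

definition trial_set :: "nat \<Rightarrow> ('j \<Rightarrow> 'a \<Rightarrow> real) set" where
  "trial_set m = comb m ` cube m (real (Suc m))"

text \<open>The closure of the span of the basis in energy: the abstract counterpart of \<open>W\<^sub>0\<^bsup>1,p(x)\<^esup>(\<Omega>)\<close>.\<close>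

definition trial_closure :: "('j \<Rightarrow> 'a \<Rightarrow> real) set" where
  "trial_closure = {V. finite_energy V \<and> (\<forall>e>0. \<exists>m c. energy (\<lambda>j x. V j x - comb m c j x) < e)}"

lemma comb_measurable [measurable]: "comb m c j \<in> borel_measurable M"
  unfolding comb_def[abs_def] by measurable

lemma comb_bound:
  assumes "c \<in> cube m R" "x \<in> space M"
  shows "\<bar>comb m c j x\<bar> \<le> (\<Sum>i<m. R * B i)"
proof -
  have "\<bar>comb m c j x\<bar> \<le> (\<Sum>i<m. \<bar>c i * \<phi> i j x\<bar>)" unfolding comb_def by (rule sum_abs)
  also have "\<dots> \<le> (\<Sum>i<m. R * B i)"
  proof (rule sum_mono)
    fix i assume "i \<in> {..<m}"
    then have "\<bar>c i\<bar> \<le> R" using assms(1) by (auto simp: cube_def)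
    moreover have "\<bar>\<phi> i j x\<bar> \<le> B i" by (rule \<phi>_bounded[OF assms(2)])
    ultimately show "\<bar>c i * \<phi> i j x\<bar> \<le> R * B i" unfolding abs_mult by (intro mult_mono) auto
  qed
  finally show ?thesis .
qed

lemma comb_restrict: "comb m c = comb m (\<lambda>i. if i < m then c i else 0)"
  by (auto simp: comb_def fun_eq_iff)

lemma finite_energy_comb: "finite_energy (comb m c)"
proof -
  have "(\<lambda>i. if i < m then c i else 0) \<in> cube m (\<Sum>i<m. \<bar>c i\<bar>)"
    by (auto simp: cube_def intro: member_le_sum)
  from comb_bound[OF this] show ?thesis
    by (subst comb_restrict, intro finite_energy_bounded[where B = "\<Sum>i<m. (\<Sum>i<m. \<bar>c i\<bar>) * B i"]) auto
qed

lemma comb_extend: "m \<le> n \<Longrightarrow> (\<And>i. m \<le> i \<Longrightarrow> c i = 0) \<Longrightarrow> comb n c = comb m c"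
  unfolding comb_def fun_eq_iff
  by (intro allI sum.mono_neutral_right) auto

lemma trial_set_eventually: "\<exists>n0. \<forall>n\<ge>n0. comb m c \<in> trial_set n"
proof -
  define c' where "c' = (\<lambda>i. if i < m then c i else 0)"
  obtain N where N: "(\<Sum>i<m. \<bar>c i\<bar>) \<le> real N" by (meson real_arch_simple)
  have "comb m c \<in> trial_set n" if n: "n \<ge> max m N" for n
  proof -
    have "\<bar>c' i\<bar> \<le> real (Suc n)" for i
    proof (cases "i < m")
      case True
      then have "\<bar>c i\<bar> \<le> (\<Sum>i<m. \<bar>c i\<bar>)" by (intro member_le_sum) auto
      then show ?thesis using N n by (simp add: c'_def)
    qed (simp add: c'_def)
    then have "c' \<in> cube n (real (Suc n))" using n by (auto simp: cube_def c'_def)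
    moreover have "comb n c' = comb m c"
      using n by (subst comb_extend[of m]) (auto simp: c'_def comb_restrict[symmetric])
    ultimately show ?thesis unfolding trial_set_def by (metis imageI)
  qed
  then show ?thesis by blast
qed

lemma trial_set_mono:
  assumes "m \<le> n" shows "trial_set m \<subseteq> trial_set n"
proof
  fix W assume "W \<in> trial_set m"
  then obtain c where c: "c \<in> cube m (real (Suc m))" "W = comb m c" by (auto simp: trial_set_def)
  then have "W = comb n c" using assms by (subst comb_extend[of m n]) (auto simp: cube_def)
  moreover have "c \<in> cube n (real (Suc n))"
  proof -
    have "\<bar>c i\<bar> \<le> real (Suc n)" for i
      using c(1) assms by (cases "i < m") (force simp: cube_def)+
    then show ?thesis using c(1) assms by (auto simp: cube_def)
  qed
  ultimately show "W \<in> trial_set n" by (auto simp: trial_set_def)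
qed

lemma trial_set_midpoint:
  assumes "U \<in> trial_set m" "V \<in> trial_set m"
  shows "(\<lambda>j x. (U j x + V j x) / 2) \<in> trial_set m"
proof -
  obtain c d where c: "c \<in> cube m (real (Suc m))" "U = comb m c" and d: "d \<in> cube m (real (Suc m))" "V = comb m d"
    using assms by (auto simp: trial_set_def)
  have "(\<lambda>i. (c i + d i) / 2) \<in> cube m (real (Suc m))"
    using c(1) d(1) by (auto simp: cube_def)
       (smt (verit) field_sum_of_halves abs_triangle_ineq)
  moreover have "(\<lambda>j x. (U j x + V j x) / 2) = comb m (\<lambda>i. (c i + d i) / 2)"
    by (auto simp: c d comb_def fun_eq_iff sum.distrib[symmetric] sum_divide_distrib algebra_simps)
  ultimately show ?thesis by (auto simp: trial_set_def)
qed

lemma trial_set_finite_energy: "U \<in> trial_set m \<Longrightarrow> finite_energy U"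
  by (auto simp: trial_set_def finite_energy_comb)

lemma zero_in_trial_set: "(\<lambda>j x. 0) \<in> trial_set m"
proof -
  have "(\<lambda>_. 0) \<in> cube m (real (Suc m))" by (auto simp: cube_def)
  moreover have "comb m (\<lambda>_. 0) = (\<lambda>j x. 0)" by (auto simp: comb_def fun_eq_iff)
  ultimately show ?thesis unfolding trial_set_def by (metis imageI)
qed

lemma principal_convection_comb_diff:
  assumes "finite_energy U"
  shows "principal U (\<lambda>j x. comb m d j x - comb m c j x) = (\<Sum>i<m. principal U (\<phi> i) * (d i - c i))"
    and "convection U (\<lambda>j x. comb m d j x - comb m c j x) = (\<Sum>i<m. convection U (\<phi> i) * (d i - c i))"
proof -
  have fe: "finite_energy (\<phi> i)" for i by (rule finite_energy_bounded) (auto intro: \<phi>_bounded)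
  note i1 = integrable_principal[OF assms fe] and i2 = integrable_convection[OF assms fe]
  have "principal U (\<lambda>j x. comb m d j x - comb m c j x) =
      (\<Sum>j\<in>UNIV. \<integral>x. (\<Sum>i<m. (d i - c i) * (signed_pow (P j x) (U j x) * \<phi> i j x)) \<partial>M)"
    unfolding principal_def comb_def
    by (intro sum.cong refl Bochner_Integration.integral_cong)
       (simp add: sum_subtractf[symmetric] sum_distrib_left algebra_simps)
  also have "\<dots> = (\<Sum>j\<in>UNIV. \<Sum>i<m. (d i - c i) * (\<integral>x. signed_pow (P j x) (U j x) * \<phi> i j x \<partial>M))"
    by (intro sum.cong refl, subst Bochner_Integration.integral_sum) (auto intro: i1)
  also have "\<dots> = (\<Sum>i<m. principal U (\<phi> i) * (d i - c i))"
    by (subst sum.swap) (simp add: principal_def sum_distrib_left mult.commute)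
  finally show "principal U (\<lambda>j x. comb m d j x - comb m c j x) = (\<Sum>i<m. principal U (\<phi> i) * (d i - c i))" .
  have "convection U (\<lambda>j x. comb m d j x - comb m c j x) =
      (\<integral>x. (\<Sum>i<m. (d i - c i) * (g x (\<lambda>j. U j x) * \<phi> i j0 x)) \<partial>M)"
    unfolding convection_def comb_def
    by (intro Bochner_Integration.integral_cong refl)
       (simp add: sum_subtractf[symmetric] sum_distrib_left algebra_simps)
  also have "\<dots> = (\<Sum>i<m. (d i - c i) * (\<integral>x. g x (\<lambda>j. U j x) * \<phi> i j0 x \<partial>M))"
    by (subst Bochner_Integration.integral_sum) (auto intro: i2)
  finally show "convection U (\<lambda>j x. comb m d j x - comb m c j x) = (\<Sum>i<m. convection U (\<phi> i) * (d i - c i))"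
    by (simp add: convection_def mult.commute)
qed

text \<open>The coefficients move in a cube, and testing with the basis functions defines a continuous vector field
on it; its variational inequality is the one of the trial set.\<close>

lemma trial_set_solution:
  obtains U where "U \<in> trial_set m"
    "\<And>W. W \<in> trial_set m \<Longrightarrow>
       convection U (\<lambda>j x. W j x - U j x) \<le> principal U (\<lambda>j x. W j x - U j x)"
proof -
  define R where "R = real (Suc m)"
  have R: "0 < R" by (simp add: R_def)
  define F where "F c i = principal (comb m c) (\<phi> i) - convection (comb m c) (\<phi> i)" for c i
  obtain c where c: "c \<in> cube m R" "\<And>d. d \<in> cube m R \<Longrightarrow> (\<Sum>i<m. F c i * (d i - c i)) \<ge> 0"
  proof (rule cube_variational_inequality[OF R, of m F])
    fix X x i assume i: "i < m" and X: "\<And>k. X k \<in> cube m R" and x: "x \<in> cube m R"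
      and lim: "\<And>j. (\<lambda>k. X k j) \<longlonglongrightarrow> x j"
    define b where "b = \<bar>\<Sum>i<m. R * B i\<bar> + \<bar>B i\<bar>"
    have G: "finite_energy (\<lambda>j x. b)" by (rule finite_energy_bounded[of _ b]) (auto simp: b_def)
    have cl: "(\<lambda>k. comb m (X k) j y) \<longlonglongrightarrow> comb m x j y" for j y
      unfolding comb_def by (intro tendsto_intros lim)
    have cd: "\<bar>comb m (X k) j y\<bar> \<le> b" if "y \<in> space M" for k j y
      using comb_bound[OF X that] unfolding b_def by (meson abs_ge_self abs_ge_zero add_increasing2 order_trans)
    have pd: "\<bar>\<phi> i j y\<bar> \<le> b" if "y \<in> space M" for j y
      using \<phi>_bounded[OF that, of i j] unfolding b_def by linarith
    have "(\<lambda>k. principal (comb m (X k)) (\<phi> i)) \<longlonglongrightarrow> principal (comb m x) (\<phi> i)"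
      by (rule principal_convection_tendsto(1)[OF _ _ _ _ G]) (auto intro!: AE_I2 cl cd pd)
    moreover have "(\<lambda>k. convection (comb m (X k)) (\<phi> i)) \<longlonglongrightarrow> convection (comb m x) (\<phi> i)"
      by (rule principal_convection_tendsto(2)[OF _ _ _ _ G]) (auto intro!: AE_I2 cl cd pd)
    ultimately show "(\<lambda>k. F (X k) i) \<longlonglongrightarrow> F x i" unfolding F_def by (rule tendsto_diff)
  qed auto
  show thesis
  proof (rule that[of "comb m c"])
    show "comb m c \<in> trial_set m" using c(1) by (auto simp: trial_set_def R_def)
    fix W assume "W \<in> trial_set m"
    then obtain d where d: "d \<in> cube m R" "W = comb m d" by (auto simp: trial_set_def R_def)
    have "0 \<le> (\<Sum>i<m. F c i * (d i - c i))" by (rule c(2)[OF d(1)])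
    also have "\<dots> = principal (comb m c) (\<lambda>j x. W j x - comb m c j x) - convection (comb m c) (\<lambda>j x. W j x - comb m c j x)"
      by (simp add: d(2) principal_convection_comb_diff[OF finite_energy_comb] F_def left_diff_distrib sum_subtractf)
    finally show "convection (comb m c) (\<lambda>j x. W j x - comb m c j x) \<le> principal (comb m c) (\<lambda>j x. W j x - comb m c j x)"
      by simp
  qed
qed

text \<open>The convex functional whose derivative is \<open>principal\<close>.\<close>

definition potential :: "('j \<Rightarrow> 'a \<Rightarrow> real) \<Rightarrow> real" where
  "potential U = (\<Sum>j\<in>UNIV. \<integral>x. \<bar>U j x\<bar> powr P j x / P j x \<partial>M)"

lemma integrable_potential:
  assumes "finite_energy U"
  shows "integrable M (\<lambda>x. \<bar>U j x\<bar> powr P j x / P j x)"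
proof (rule Bochner_Integration.integrable_bound[OF finite_energy_integrable[OF assms]])
  note [measurable] = finite_energyD[OF assms]
  show "(\<lambda>x. \<bar>U j x\<bar> powr P j x / P j x) \<in> borel_measurable M" by measurable
  show "AE x in M. norm (\<bar>U j x\<bar> powr P j x / P j x) \<le> norm (\<bar>U j x\<bar> powr P j x)"
  proof (rule AE_I2)
    fix x assume "x \<in> space M"
    from P_gt_1[OF this, of j] show "norm (\<bar>U j x\<bar> powr P j x / P j x) \<le> norm (\<bar>U j x\<bar> powr P j x)"
      by (simp add: divide_le_eq mult_left_le_one_le mult_le_cancel_left1)
  qed
qed

lemma potential_bounds:
  assumes "finite_energy U" shows "0 \<le> potential U" "potential U \<le> energy U"
proof -
  show "0 \<le> potential U" unfolding potential_def
  proof (intro sum_nonneg integral_nonneg_AE AE_I2)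
    fix x j assume "x \<in> space M"
    from P_gt_1[OF this, of j] show "0 \<le> \<bar>U j x\<bar> powr P j x / P j x" by simp
  qed
  show "potential U \<le> energy U" unfolding potential_def energy_def
  proof (intro sum_mono integral_mono integrable_potential finite_energy_integrable assms)
    fix x j assume "x \<in> space M"
    from P_gt_1[OF this, of j] show "\<bar>U j x\<bar> powr P j x / P j x \<le> \<bar>U j x\<bar> powr P j x"
      by (simp add: divide_le_eq mult_left_le_one_le mult_le_cancel_left1)
  qed
qed

lemma potential_tangent:
  assumes U: "finite_energy U" and W: "finite_energy W"
  shows "potential U + principal U (\<lambda>j x. W j x - U j x) \<le> potential W"
proof -
  have i: "integrable M (\<lambda>x. signed_pow (P j x) (U j x) * (W j x - U j x))" for j
    using integrable_principal[OF U finite_energy_diff[OF W U]] .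
  have "potential U + principal U (\<lambda>j x. W j x - U j x) =
     (\<Sum>j\<in>UNIV. \<integral>x. \<bar>U j x\<bar> powr P j x / P j x + signed_pow (P j x) (U j x) * (W j x - U j x) \<partial>M)"
    unfolding potential_def principal_def
    by (simp add: Bochner_Integration.integral_add[OF integrable_potential[OF U] i] sum.distrib)
  also have "\<dots> \<le> potential W"
    unfolding potential_def
    by (intro sum_mono integral_mono Bochner_Integration.integrable_add integrable_potential U W i signed_pow_tangent P_gt_1)
  finally show ?thesis .
qed

text \<open>Uniform convexity of \<open>potential\<close>: integrate the pointwise inequality. The weights \<open>1/P\<close> change the
convexity gap by a factor of at most \<open>hi\<close>.\<close>

lemma energy_diff_le_potential_gap:
  assumes "0 < e"
  obtains C where "0 < C" "\<And>U V. finite_energy U \<Longrightarrow> finite_energy V \<Longrightarrow>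
    energy (\<lambda>j x. U j x - V j x) \<le> e * (energy U + energy V) +
      C * ((potential U + potential V) / 2 - potential (\<lambda>j x. (U j x + V j x) / 2))"
proof -
  obtain C where C: "0 < C" "\<And>s a b. lo \<le> s \<Longrightarrow> s \<le> hi \<Longrightarrow>
      \<bar>a - b\<bar> powr s \<le> e * (\<bar>a\<bar> powr s + \<bar>b\<bar> powr s) + C * convexity_gap s a b"
    using uniform_convexity[OF lo_gt_1 assms] by blast
  define C' where "C' = C * max 1 hi"
  show thesis
  proof (rule that[of C'])
    show "0 < C'" using C by (simp add: C'_def)
    fix U V assume U: "finite_energy U" and V: "finite_energy V"
    have "finite_energy (\<lambda>j x. (1/2) * (U j x + V j x))"
      by (intro finite_energy_scale finite_energy_add U V)
    then have W: "finite_energy (\<lambda>j x. (U j x + V j x) / 2)" by simp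
    define D where "D j x = (\<bar>U j x\<bar> powr P j x / P j x + \<bar>V j x\<bar> powr P j x / P j x) / 2 -
        \<bar>(U j x + V j x) / 2\<bar> powr P j x / P j x" for j x
    have Di: "integrable M (D j)" for j
      unfolding D_def using integrable_potential[OF U, of j] integrable_potential[OF V, of j] integrable_potential[OF W, of j] by simp
    have "\<bar>U j x - V j x\<bar> powr P j x \<le> e * (\<bar>U j x\<bar> powr P j x + \<bar>V j x\<bar> powr P j x) + C' * D j x"
      if "x \<in> space M" for j x
    proof -
      note p = P_bounds[OF that, of j] P_gt_1[OF that, of j]
      have Dg: "convexity_gap (P j x) (U j x) (V j x) = P j x * D j x"
        using p by (simp add: convexity_gap_def D_def field_simps)
      have "0 \<le> D j x" using convexity_gap_nonneg[OF p(2), of "U j x" "V j x"] p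
        unfolding Dg by (simp add: zero_le_mult_iff)
      then have "P j x * D j x \<le> max 1 hi * D j x" using p by (intro mult_right_mono) auto
      then have "C * convexity_gap (P j x) (U j x) (V j x) \<le> C' * D j x"
        unfolding Dg C'_def using C(1) by (simp add: mult.assoc)
      then show ?thesis using C(2)[of "P j x" "U j x" "V j x"] p by simp
    qed
    note pw = this
    have "energy (\<lambda>j x. U j x - V j x) \<le>
       (\<Sum>j\<in>UNIV. \<integral>x. e * (\<bar>U j x\<bar> powr P j x + \<bar>V j x\<bar> powr P j x) + C' * D j x \<partial>M)"
      unfolding energy_def
    proof (intro sum_mono integral_mono)
      show "integrable M (\<lambda>x. \<bar>U j x - V j x\<bar> powr P j x)" for j
        using finite_energy_integrable[OF finite_energy_diff[OF U V]] .
      show "integrable M (\<lambda>x. e * (\<bar>U j x\<bar> powr P j x + \<bar>V j x\<bar> powr P j x) + C' * D j x)" for j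
        using Di[of j] finite_energy_integrable[OF U] finite_energy_integrable[OF V] by simp
    qed (use pw in auto)
    also have "\<dots> = (\<Sum>j\<in>UNIV. e * ((\<integral>x. \<bar>U j x\<bar> powr P j x \<partial>M) + (\<integral>x. \<bar>V j x\<bar> powr P j x \<partial>M)) + C' * (\<integral>x. D j x \<partial>M))"
      using Di finite_energy_integrable[OF U] finite_energy_integrable[OF V] by simp
    also have "\<dots> = e * (energy U + energy V) + C' * (\<Sum>j\<in>UNIV. \<integral>x. D j x \<partial>M)"
      by (simp add: energy_def sum.distrib sum_distrib_left[symmetric])
    also have "(\<Sum>j\<in>UNIV. \<integral>x. D j x \<partial>M) = (potential U + potential V) / 2 - potential (\<lambda>j x. (U j x + V j x) / 2)"
      unfolding D_def potential_def
      using integrable_potential[OF U] integrable_potential[OF V] integrable_potential[OF W]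
      by (simp add: sum_subtractf sum.distrib sum_divide_distrib[symmetric])
    finally show "energy (\<lambda>j x. U j x - V j x) \<le> e * (energy U + energy V) +
      C' * ((potential U + potential V) / 2 - potential (\<lambda>j x. (U j x + V j x) / 2))" .
  qed
qed

lemma energy_apriori:
  assumes U: "finite_energy U" and "energy U \<le> convection U U"
  shows "energy U \<le> 2 * (\<integral>x. h x \<partial>M)"
proof -
  have "convection U U \<le> (\<integral>x. h x + (\<Sum>j\<in>UNIV. \<bar>U j x\<bar> powr P j x) / 2 \<partial>M)"
    unfolding convection_def
  proof (rule integral_mono_AE[OF integrable_convection[OF U U]])
    show "AE x in M. g x (\<lambda>j. U j x) * U j0 x \<le> h x + (\<Sum>j\<in>UNIV. \<bar>U j x\<bar> powr P j x) / 2"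
      using g_coercive
    proof eventually_elim
      case (elim x)
      show ?case using elim[rule_format, of "\<lambda>j. U j x"] by linarith
    qed
  qed (use h_integrable integrable_energy_density[OF U] in auto)
  also have "\<dots> = (\<integral>x. h x \<partial>M) + energy U / 2"
    using h_integrable integrable_energy_density[OF U] by (simp add: energy_eq_integral[OF U])
  finally show ?thesis using assms(2) by simp
qed

text \<open>The heart of the argument. For \<open>n \<le> m\<close> the midpoint of \<open>w\<^sub>n\<close> and \<open>w\<^sub>m\<close> is admissible in the problem solved by
\<open>w\<^sub>m\<close>. By convexity its potential is at least that of \<open>w\<^sub>m\<close> plus half of the pairing of \<open>g(w\<^sub>m)\<close> with
\<open>w\<^sub>n - w\<^sub>m\<close>, and this pairing is small by \<open>L\<^sup>1\<close> closeness. As the potentials of \<open>w\<^sub>n\<close> and \<open>w\<^sub>m\<close> are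
close as well, the convexity gap is small, and uniform convexity bounds the energy of \<open>w\<^sub>m - w\<^sub>n\<close>.\<close>

lemma trial_solutions_Cauchy:
  assumes w: "\<And>n. w n \<in> trial_set (\<kappa> n)" and \<kappa>: "mono \<kappa>"
    and vi: "\<And>n W. W \<in> trial_set (\<kappa> n) \<Longrightarrow>
       convection (w n) (\<lambda>j x. W j x - w n j x) \<le> principal (w n) (\<lambda>j x. W j x - w n j x)"
    and E: "\<And>n. energy (w n) \<le> E"
    and J: "convergent (\<lambda>n. potential (w n))"
    and L1: "\<And>e. 0 < e \<Longrightarrow> \<exists>N. \<forall>m\<ge>N. \<forall>n\<ge>N. (\<integral>x. \<bar>w m j0 x - w n j0 x\<bar> \<partial>M) < e"
    and e: "0 < e"
  shows "\<exists>N. \<forall>m\<ge>N. \<forall>n\<ge>N. energy (\<lambda>j x. w m j x - w n j x) < e"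
proof -
  have fw: "finite_energy (w n)" for n using w trial_set_finite_energy by blast
  have E0: "0 \<le> E" using E[of 0] energy_nonneg[of "w 0"] by simp
  \<comment> \<open>the energies on the right of the uniform convexity estimate then contribute less than \<open>e/2\<close>\<close>
  define e1 where "e1 = e / (4 * (E + 1))"
  have e1: "0 < e1" using e E0 by (simp add: e1_def)
  obtain C where C: "0 < C" "\<And>U V. finite_energy U \<Longrightarrow> finite_energy V \<Longrightarrow>
    energy (\<lambda>j x. U j x - V j x) \<le> e1 * (energy U + energy V) +
      C * ((potential U + potential V) / 2 - potential (\<lambda>j x. (U j x + V j x) / 2))"
    using energy_diff_le_potential_gap[OF e1] by blast
  define \<eta> where "\<eta> = e / (4 * C)"
  have \<eta>: "0 < \<eta>" using e C by (simp add: \<eta>_def)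
  define H where "H = (\<integral>x. h x \<partial>M)"
  have H0: "0 \<le> H" unfolding H_def by (simp add: h_nonneg)
  \<comment> \<open>a bound for the energy terms in \<open>convection_absorb\<close>, made positive for the division below\<close>
  define E2 where "E2 = H + E + 2 powr hi * (2 * E) + 1"
  have E2: "0 < E2" using H0 E0 by (simp add: E2_def add_nonneg_pos)
  obtain D where D: "1 \<le> D" "\<And>U V. finite_energy U \<Longrightarrow> finite_energy V \<Longrightarrow>
     \<bar>convection U V\<bar> \<le> (\<eta> / (4 * E2)) * (H + energy U) + D * (\<integral>x. \<bar>V j0 x\<bar> \<partial>M) + (\<eta> / (4 * E2)) * energy V"
    using convection_absorb[of "\<eta> / (4 * E2)"] \<eta> E2 unfolding H_def by auto
  obtain N1 where N1: "\<And>m n. m \<ge> N1 \<Longrightarrow> n \<ge> N1 \<Longrightarrow> (\<integral>x. \<bar>w m j0 x - w n j0 x\<bar> \<partial>M) < \<eta> / (4 * D)"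
    using L1[of "\<eta> / (4 * D)"] \<eta> D(1) by auto
  have "Cauchy (\<lambda>n. potential (w n))" using J by (simp add: Cauchy_convergent_iff)
  then obtain N2 where N2: "\<And>m n. m \<ge> N2 \<Longrightarrow> n \<ge> N2 \<Longrightarrow> \<bar>potential (w m) - potential (w n)\<bar> < \<eta> / 2"
    using \<eta> unfolding Cauchy_iff by (metis half_gt_zero real_norm_def)
  have conv_small: "\<bar>convection (w m) (\<lambda>j x. w n j x - w m j x)\<bar> \<le> \<eta> / 2" if "m \<ge> N1" "n \<ge> N1" for m n
  proof -
    define \<theta> where "\<theta> = \<eta> / (4 * E2)"
    have \<theta>0: "0 \<le> \<theta>" using \<eta> E2 by (simp add: \<theta>_def)
    have "energy (\<lambda>j x. w n j x - w m j x) \<le> 2 powr hi * (energy (w n) + energy (w m))"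
      by (rule energy_diff_le[OF fw fw])
    also have "\<dots> \<le> 2 powr hi * (2 * E)" using E[of n] E[of m] by (intro mult_left_mono) auto
    finally have "\<theta> * (H + energy (w m)) + \<theta> * energy (\<lambda>j x. w n j x - w m j x)
       \<le> \<theta> * (H + E) + \<theta> * (2 powr hi * (2 * E))"
      using E[of m] \<theta>0 by (intro add_mono mult_left_mono) auto
    also have "\<dots> \<le> \<theta> * E2" unfolding E2_def using \<theta>0 by (simp add: distrib_left)
    also have "\<theta> * E2 = \<eta> / 4" using E2 by (simp add: \<theta>_def)
    finally have "\<theta> * (H + energy (w m)) + \<theta> * energy (\<lambda>j x. w n j x - w m j x) \<le> \<eta> / 4" .
    moreover have "D * (\<integral>x. \<bar>w n j0 x - w m j0 x\<bar> \<partial>M) \<le> D * (\<eta> / (4 * D))"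
      using N1[OF that(2,1)] D(1) by (intro mult_left_mono) auto
    moreover have "D * (\<eta> / (4 * D)) = \<eta> / 4" using D(1) by simp
    ultimately show ?thesis
      using D(2)[OF fw[of m] finite_energy_diff[OF fw[of n] fw[of m]]] unfolding \<theta>_def[symmetric] by linarith
  qed
  have main: "energy (\<lambda>j x. w m j x - w n j x) < e" if n: "n \<ge> max N1 N2" and mn: "n \<le> m" for m n
  proof -
    define W where "W = (\<lambda>j x. (w m j x + w n j x) / 2)"
    have "w n \<in> trial_set (\<kappa> m)" using w[of n] trial_set_mono monoD[OF \<kappa> mn] by blast
    then have Wt: "W \<in> trial_set (\<kappa> m)" unfolding W_def by (rule trial_set_midpoint[OF w])
    have Weq: "(\<lambda>j x. W j x - w m j x) = (\<lambda>j x. (1/2) * (w n j x - w m j x))"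
      by (auto simp: W_def fun_eq_iff field_simps)
    have "potential (w m) + convection (w m) (\<lambda>j x. W j x - w m j x) \<le> potential W"
      using vi[OF Wt] potential_tangent[OF fw trial_set_finite_energy[OF Wt], of m] by linarith
    then have *: "potential (w m) + (1/2) * convection (w m) (\<lambda>j x. w n j x - w m j x) \<le> potential W"
      unfolding Weq convection_scale .
    have gap: "(potential (w m) + potential (w n)) / 2 - potential W \<le> \<eta> / 2"
    proof -
      have "\<bar>convection (w m) (\<lambda>j x. w n j x - w m j x)\<bar> \<le> \<eta> / 2"
        "\<bar>potential (w m) - potential (w n)\<bar> < \<eta> / 2"
        using conv_small[of m n] N2[of m n] n mn by auto
      moreover have "(a + b) / 2 - d \<le> \<eta> / 2"
        if "a + (1/2) * c \<le> d" "\<bar>c\<bar> \<le> \<eta> / 2" "\<bar>a - b\<bar> < \<eta> / 2" for a b c d :: real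
        using that unfolding add_divide_distrib by linarith
      ultimately show ?thesis using * by blast
    qed
    have "energy (\<lambda>j x. w m j x - w n j x) \<le> e1 * (energy (w m) + energy (w n)) + C * (\<eta> / 2)"
      using C(2)[OF fw fw, of m n] gap C(1) unfolding W_def by (smt (verit) mult_left_mono)
    also have "\<dots> \<le> e1 * (2 * E) + C * (\<eta> / 2)" using E[of m] E[of n] e1 by simp
    also have "e1 * (2 * E) < e / 2" using E0 e by (simp add: e1_def field_simps)
    also have "C * (\<eta> / 2) = e / 8" using C(1) by (simp add: \<eta>_def)
    finally show ?thesis using e by simp
  qed
  have "energy (\<lambda>j x. w m j x - w n j x) < e" if "m \<ge> max N1 N2" "n \<ge> max N1 N2" for m n
    using main[of n m] main[of m n] that energy_diff_commute[of "w m" "w n"] by (cases "n \<le> m") auto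
  then show ?thesis by blast
qed

end

context exponents
begin

lemma energy_eq_0_AE:
  assumes "finite_energy U" "energy U = 0"
  shows "AE x in M. U j x = 0"
proof -
  have "(\<integral>x. \<bar>U j x\<bar> powr P j x \<partial>M) = 0"
    using energy_component[of U j] assms(2) by (intro antisym) (auto intro: integral_nonneg_AE)
  then have "AE x in M. \<bar>U j x\<bar> powr P j x = 0"
    by (subst (asm) integral_nonneg_eq_0_iff_AE) (auto intro: finite_energy_integrable[OF assms(1)])
  then show ?thesis by eventually_elim simp
qed

text \<open>The limit that \<open>energy_Cauchy_limit\<close> produces has distance \<open>0\<close> in energy from the given one.\<close>

lemma energy_convergent_subsequence:
  fixes W :: "nat \<Rightarrow> 'j \<Rightarrow> 'a \<Rightarrow> real"
  assumes W: "\<And>n. finite_energy (W n)" and V: "finite_energy V"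
    and lim: "(\<lambda>n. energy (\<lambda>j x. W n j x - V j x)) \<longlonglongrightarrow> 0"
  obtains k G where "strict_mono (k :: nat \<Rightarrow> nat)" "finite_energy G"
    "\<And>j. AE x in M. (\<lambda>n. W (k n) j x) \<longlonglongrightarrow> V j x"
    "\<And>j. AE x in M. \<forall>n. \<bar>W (k n) j x\<bar> \<le> G j x"
proof -
  have C: "\<exists>N. \<forall>m\<ge>N. \<forall>n\<ge>N. energy (\<lambda>j x. W m j x - W n j x) < e" if e: "0 < e" for e
  proof -
    have "\<forall>\<^sub>F n in sequentially. energy (\<lambda>j x. W n j x - V j x) < e / (2 * 2 powr hi)"
      using lim by (rule order_tendstoD) (use e in simp)
    then obtain N where N: "\<And>n. n \<ge> N \<Longrightarrow> energy (\<lambda>j x. W n j x - V j x) < e / (2 * 2 powr hi)"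
      by (auto simp: eventually_sequentially)
    have "energy (\<lambda>j x. W m j x - W n j x) < e" if "m \<ge> N" "n \<ge> N" for m n
    proof -
      have "energy (\<lambda>j x. W m j x - W n j x) \<le>
          2 powr hi * (energy (\<lambda>j x. W m j x - V j x) + energy (\<lambda>j x. V j x - W n j x))"
        by (rule energy_triangle[OF W V W])
      also have "\<dots> < 2 powr hi * (e / (2 * 2 powr hi) + e / (2 * 2 powr hi))"
        using N[OF that(1)] N[OF that(2)] energy_diff_commute[of V "W n"]
        by (intro mult_strict_left_mono add_strict_mono) auto
      also have "\<dots> = e" by simp
      finally show ?thesis .
    qed
    then show ?thesis by blast
  qed
  obtain k V' G where k: "strict_mono k" and V': "finite_energy V'" and G: "finite_energy G"
    "\<And>j. AE x in M. (\<lambda>n. W (k n) j x) \<longlonglongrightarrow> V' j x"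
    "\<And>j. AE x in M. \<forall>n. \<bar>W (k n) j x\<bar> \<le> G j x"
    and l': "(\<lambda>n. energy (\<lambda>j x. W (k n) j x - V' j x)) \<longlonglongrightarrow> 0"
    by (rule energy_Cauchy_limit[of W, OF W C]) (assumption, rule that, assumption, assumption, assumption, blast, blast, assumption)
  \<comment> \<open>by the triangle inequality, which for energies holds up to a constant factor\<close>
  have "energy (\<lambda>j x. V' j x - V j x) \<le> 0"
  proof (rule LIMSEQ_le_const)
    have "(\<lambda>n. energy (\<lambda>j x. W (k n) j x - V j x)) \<longlonglongrightarrow> 0"
      using LIMSEQ_subseq_LIMSEQ[OF lim k] by (simp add: o_def)
    with l' show "(\<lambda>n. 2 powr hi * (energy (\<lambda>j x. W (k n) j x - V' j x) + energy (\<lambda>j x. W (k n) j x - V j x))) \<longlonglongrightarrow> 0"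
      by (auto intro!: tendsto_eq_intros)
    show "\<exists>N. \<forall>n\<ge>N. energy (\<lambda>j x. V' j x - V j x) \<le> 2 powr hi * (energy (\<lambda>j x. W (k n) j x - V' j x) + energy (\<lambda>j x. W (k n) j x - V j x))"
    proof (intro exI allI impI)
      fix n show "energy (\<lambda>j x. V' j x - V j x) \<le> 2 powr hi * (energy (\<lambda>j x. W (k n) j x - V' j x) + energy (\<lambda>j x. W (k n) j x - V j x))"
        using energy_triangle[OF V' W V, of "k n"] energy_diff_commute[of V' "W (k n)"] by simp
    qed
  qed
  then have "energy (\<lambda>j x. V' j x - V j x) = 0" using energy_nonneg by (metis antisym)
  then have eq: "AE x in M. V' j x - V j x = 0" for j
    using energy_eq_0_AE[OF finite_energy_diff[OF V' V]] by blast
  show thesis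
  proof (rule that[OF k G(1) _ G(3)])
    show "AE x in M. (\<lambda>n. W (k n) j x) \<longlonglongrightarrow> V j x" for j
      using G(2)[of j] eq[of j] by eventually_elim simp
  qed
qed

end

context convection_problem
begin

lemma trial_closureI:
  assumes "finite_energy V" "\<And>n. \<exists>m c. W n = comb m c" "(\<lambda>n. energy (\<lambda>j x. W n j x - V j x)) \<longlonglongrightarrow> 0"
  shows "V \<in> trial_closure"
proof -
  have "\<exists>m c. energy (\<lambda>j x. V j x - comb m c j x) < e" if "0 < e" for e
  proof -
    have "\<forall>\<^sub>F n in sequentially. energy (\<lambda>j x. W n j x - V j x) < e"
      using assms(3) that by (rule order_tendstoD)
    then obtain n where "energy (\<lambda>j x. W n j x - V j x) < e"
      by (auto simp: eventually_sequentially)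
    moreover obtain m c where "W n = comb m c" using assms(2)[of n] by blast
    ultimately show ?thesis using energy_diff_commute[of "W n" V] by auto
  qed
  then show ?thesis using assms(1) by (simp add: trial_closure_def)
qed

lemma trial_closureE:
  assumes "V \<in> trial_closure"
  obtains W where "\<And>n. \<exists>m c. W n = comb m c" "(\<lambda>n::nat. energy (\<lambda>j x. W n j x - V j x)) \<longlonglongrightarrow> 0"
proof -
  have "\<forall>n. \<exists>m c. energy (\<lambda>j x. V j x - comb m c j x) < 1 / real (Suc n)"
    using assms by (auto simp: trial_closure_def simp del: of_nat_Suc)
  then obtain m c where mc: "\<And>n. energy (\<lambda>j x. V j x - comb (m n) (c n) j x) < 1 / real (Suc n)"
    by metis
  define W where "W n = comb (m n) (c n)" for n
  have W: "\<And>n. \<exists>m c. W n = comb m c" "\<And>n. energy (\<lambda>j x. V j x - W n j x) < 1 / real (Suc n)"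
    using mc by (auto simp: W_def simp del: of_nat_Suc)
  have "(\<lambda>n. energy (\<lambda>j x. W n j x - V j x)) \<longlonglongrightarrow> 0"
  proof (rule Lim_null_comparison[OF _ LIMSEQ_Suc[OF lim_const_over_n[of 1]]])
    show "\<forall>\<^sub>F n in sequentially. norm (energy (\<lambda>j x. W n j x - V j x)) \<le> 1 / real (Suc n)"
    proof (intro always_eventually allI)
      fix n show "norm (energy (\<lambda>j x. W n j x - V j x)) \<le> 1 / real (Suc n)"
        using W(2)[of n] energy_diff_commute[of V "W n"] energy_nonneg[of "\<lambda>j x. W n j x - V j x"]
        by (simp del: of_nat_Suc)
    qed
  qed
  then show thesis using that W(1) by blast
qed

lemma comb_add: "(\<lambda>j x. comb m c j x + comb n d j x) =
    comb (max m n) (\<lambda>i. (if i < m then c i else 0) + (if i < n then d i else 0))"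
proof -
  have "comb m c = comb (max m n) (\<lambda>i. if i < m then c i else 0)"
    by (subst comb_restrict, subst comb_extend[of m "max m n"]) auto
  moreover have "comb n d = comb (max m n) (\<lambda>i. if i < n then d i else 0)"
    by (subst comb_restrict, subst comb_extend[of n "max m n"]) auto
  ultimately show ?thesis
    by (auto simp: comb_def fun_eq_iff sum.distrib[symmetric] algebra_simps)
qed

lemma comb_scale: "(\<lambda>j x. a * comb m c j x) = comb m (\<lambda>i. a * c i)"
  by (auto simp: comb_def fun_eq_iff sum_distrib_left mult.assoc)

lemma trial_closure_add:
  assumes "U \<in> trial_closure" "V \<in> trial_closure"
  shows "(\<lambda>j x. U j x + V j x) \<in> trial_closure"
proof -
  obtain W where W: "\<And>n. \<exists>m c. W n = comb m c" "(\<lambda>n::nat. energy (\<lambda>j x. W n j x - U j x)) \<longlonglongrightarrow> 0"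
    using trial_closureE[OF assms(1)] by blast
  obtain X where X: "\<And>n. \<exists>m c. X n = comb m c" "(\<lambda>n::nat. energy (\<lambda>j x. X n j x - V j x)) \<longlonglongrightarrow> 0"
    using trial_closureE[OF assms(2)] by blast
  have f: "finite_energy U" "finite_energy V" "finite_energy (W n)" "finite_energy (X n)" for n
    using assms W(1)[of n] X(1)[of n] finite_energy_comb by (auto simp: trial_closure_def)
  show ?thesis
  proof (rule trial_closureI[of _ "\<lambda>n j x. W n j x + X n j x"])
    show "\<exists>m c. (\<lambda>j x. W n j x + X n j x) = comb m c" for n
    proof -
      obtain m c m' c' where "W n = comb m c" "X n = comb m' c'" using W(1)[of n] X(1)[of n] by blast
      then show ?thesis using comb_add[of m c m' c'] by auto
    qed
    have le: "energy (\<lambda>j x. (W n j x + X n j x) - (U j x + V j x))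
        \<le> 2 powr hi * (energy (\<lambda>j x. W n j x - U j x) + energy (\<lambda>j x. X n j x - V j x))" for n
      using energy_add_le[OF finite_energy_diff[OF f(3)[of n] f(1)] finite_energy_diff[OF f(4)[of n] f(2)]]
      by (simp add: algebra_simps)
    have "(\<lambda>n. 2 powr hi * (energy (\<lambda>j x. W n j x - U j x) + energy (\<lambda>j x. X n j x - V j x))) \<longlonglongrightarrow> 0"
      using W(2) X(2) by (auto intro!: tendsto_eq_intros)
    then show "(\<lambda>n. energy (\<lambda>j x. (W n j x + X n j x) - (U j x + V j x))) \<longlonglongrightarrow> 0"
      by (rule Lim_null_comparison[rotated])
         (intro always_eventually allI, simp only: real_norm_def abs_of_nonneg[OF energy_nonneg] le)
  qed (intro finite_energy_add f)
qed

lemma trial_closure_uminus: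
  assumes "U \<in> trial_closure"
  shows "(\<lambda>j x. - U j x) \<in> trial_closure"
proof -
  obtain W where W: "\<And>n. \<exists>m c. W n = comb m c" "(\<lambda>n::nat. energy (\<lambda>j x. W n j x - U j x)) \<longlonglongrightarrow> 0"
    using trial_closureE[OF assms(1)] by blast
  have f: "finite_energy U" using assms by (auto simp: trial_closure_def)
  show ?thesis
  proof (rule trial_closureI[of _ "\<lambda>n j x. - W n j x"])
    show "\<exists>m c. (\<lambda>j x. - W n j x) = comb m c" for n
    proof -
      obtain m c where "W n = comb m c" using W(1)[of n] by blast
      then have "(\<lambda>j x. - W n j x) = comb m (\<lambda>i. - 1 * c i)" using comb_scale[of "-1" m c] by simp
      then show ?thesis by blast
    qed
    have "energy (\<lambda>j x. - W n j x - - U j x) = energy (\<lambda>j x. W n j x - U j x)" for n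
      using energy_diff_commute[of U "W n"] by simp
    then show "(\<lambda>n. energy (\<lambda>j x. - W n j x - - U j x)) \<longlonglongrightarrow> 0" using W(2) by simp
    show "finite_energy (\<lambda>j x. - U j x)" using finite_energy_scale[OF f, of "-1"] by simp
  qed
qed

text \<open>Both the solutions \<open>w\<^sub>n\<close> and the competitors \<open>X\<^sub>n\<close> may vary: the solutions converge while the competitor stays
fixed when the Galerkin index grows, and the competitors converge in the density argument.\<close>

lemma vi_passes_to_limit:
  fixes w X :: "nat \<Rightarrow> 'j \<Rightarrow> 'a \<Rightarrow> real"
  assumes w: "\<And>n. finite_energy (w n)" "finite_energy U" and X: "\<And>n. finite_energy (X n)" "finite_energy V"
    and wG: "finite_energy G" "\<And>j. AE x in M. (\<lambda>n. w n j x) \<longlonglongrightarrow> U j x" "\<And>j. AE x in M. \<forall>n. \<bar>w n j x\<bar> \<le> G j x"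
    and XG: "finite_energy H" "\<And>j. AE x in M. (\<lambda>n. X n j x) \<longlonglongrightarrow> V j x" "\<And>j. AE x in M. \<forall>n. \<bar>X n j x\<bar> \<le> H j x"
    and vi: "\<forall>\<^sub>F n in sequentially. convection (w n) (\<lambda>j x. X n j x - w n j x) \<le> principal (w n) (\<lambda>j x. X n j x - w n j x)"
  shows "convection U (\<lambda>j x. V j x - U j x) \<le> principal U (\<lambda>j x. V j x - U j x)"
proof -
  note [measurable] = finite_energyD[OF w(1)] finite_energyD[OF w(2)] finite_energyD[OF X(1)] finite_energyD[OF X(2)]
  have GH: "finite_energy (\<lambda>j x. G j x + H j x)" by (intro finite_energy_add wG XG)
  have l: "AE x in M. (\<lambda>n. X n j x - w n j x) \<longlonglongrightarrow> V j x - U j x" for j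
    using wG(2)[of j] XG(2)[of j] by eventually_elim (intro tendsto_intros)
  have d1: "AE x in M. \<forall>n. \<bar>w n j x\<bar> \<le> G j x + H j x" for j
    using wG(3)[of j] XG(3)[of j] by eventually_elim (meson abs_ge_zero add_increasing2 order_trans)
  have d2: "AE x in M. \<forall>n. \<bar>X n j x - w n j x\<bar> \<le> G j x + H j x" for j
    using wG(3)[of j] XG(3)[of j]
  proof eventually_elim
    case (elim x)
    show ?case
    proof
      fix n show "\<bar>X n j x - w n j x\<bar> \<le> G j x + H j x"
        using elim(1)[rule_format, of n] elim(2)[rule_format, of n] by linarith
    qed
  qed
  have "(\<lambda>n. principal (w n) (\<lambda>j x. X n j x - w n j x)) \<longlonglongrightarrow> principal U (\<lambda>j x. V j x - U j x)"
    by (rule principal_convection_tendsto(1)[OF _ _ _ _ GH wG(2) l d1 d2]) measurable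
  moreover have "(\<lambda>n. convection (w n) (\<lambda>j x. X n j x - w n j x)) \<longlonglongrightarrow> convection U (\<lambda>j x. V j x - U j x)"
    by (rule principal_convection_tendsto(2)[OF _ _ _ _ GH wG(2) l d1 d2]) measurable
  ultimately show ?thesis using vi by (intro tendsto_le[of sequentially]) auto
qed

lemma finite_energy_abs: "finite_energy U \<Longrightarrow> finite_energy (\<lambda>j x. \<bar>U j x\<bar>)"
  by (rule finite_energy_dominated[of U]) auto

text \<open>The inequality holds in the limit first against combinations of the basis, which belong to all sufficiently
late trial sets, and then against the whole closure. The closure is a linear space, so the competitors \<open>U + V\<close>
and \<open>U - V\<close> give both inequalities between the two forms.\<close>

theorem convection_problem_solvable:
  assumes compact: "\<And>w E. (\<And>n::nat. \<exists>m c. w n = comb m c) \<Longrightarrow> (\<And>n. energy (w n) \<le> E) \<Longrightarrow>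
     \<exists>k. strict_mono (k :: nat \<Rightarrow> nat) \<and> (\<forall>e>0. \<exists>N. \<forall>m\<ge>N. \<forall>n\<ge>N. (\<integral>x. \<bar>w (k m) j0 x - w (k n) j0 x\<bar> \<partial>M) < e)"
  obtains U where "U \<in> trial_closure" "\<And>V. V \<in> trial_closure \<Longrightarrow> principal U V = convection U V"
proof -
  define solves where "solves m U \<longleftrightarrow> U \<in> trial_set m \<and> (\<forall>W \<in> trial_set m.
       convection U (\<lambda>j x. W j x - U j x) \<le> principal U (\<lambda>j x. W j x - U j x))" for m U
  have "\<exists>U. solves m U" for m
    by (rule trial_set_solution[of m]) (auto simp: solves_def)
  then obtain u where us: "\<And>m. solves m (u m)" by metis
  have u: "u m \<in> trial_set m" for m using us[of m] by (simp add: solves_def)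
  have uvi: "convection (u m) (\<lambda>j x. W j x - u m j x) \<le> principal (u m) (\<lambda>j x. W j x - u m j x)"
    if "W \<in> trial_set m" for m W
    using us[of m] that by (simp add: solves_def)
  have fu: "finite_energy (u m)" for m using u trial_set_finite_energy by blast
  have uc: "\<exists>n c. u m = comb n c" for m using u[of m] by (auto simp: trial_set_def)
  define E where "E = 2 * (\<integral>x. h x \<partial>M)"
  have uE: "energy (u m) \<le> E" for m
  proof -
    have "convection (u m) (\<lambda>j x. - 1 * u m j x) \<le> principal (u m) (\<lambda>j x. - 1 * u m j x)"
      using uvi[OF zero_in_trial_set, of m] by simp
    then have "energy (u m) \<le> convection (u m) (u m)"
      unfolding convection_scale principal_scale principal_self by simp
    then show ?thesis unfolding E_def by (rule energy_apriori[OF fu])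
  qed
  obtain k1 where k1: "strict_mono (k1 :: nat \<Rightarrow> nat)"
    "\<And>e. 0 < e \<Longrightarrow> \<exists>N. \<forall>m\<ge>N. \<forall>n\<ge>N. (\<integral>x. \<bar>u (k1 m) j0 x - u (k1 n) j0 x\<bar> \<partial>M) < e"
    using compact[of u E, OF uc uE] by blast
  have "bounded (range (\<lambda>n. potential (u (k1 n))))"
  proof (intro boundedI)
    fix y assume "y \<in> range (\<lambda>n. potential (u (k1 n)))"
    then obtain n where "y = potential (u (k1 n))" by blast
    then show "norm y \<le> E" using potential_bounds[OF fu, of "k1 n"] uE[of "k1 n"] by simp
  qed
  then obtain k2 where k2: "strict_mono (k2 :: nat \<Rightarrow> nat)" "convergent ((\<lambda>n. potential (u (k1 n))) \<circ> k2)"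
    using bounded_imp_convergent_subsequence[of "\<lambda>n. potential (u (k1 n))"] by (auto simp: convergent_def)
  define \<kappa> where "\<kappa> = k1 \<circ> k2"
  have \<kappa>: "strict_mono \<kappa>" unfolding \<kappa>_def using k1(1) k2(1) by (rule strict_mono_o)
  define w where "w n = u (\<kappa> n)" for n
  have fw: "finite_energy (w n)" for n unfolding w_def by (rule fu)
  have C: "\<exists>N. \<forall>m\<ge>N. \<forall>n\<ge>N. energy (\<lambda>j x. w m j x - w n j x) < e" if e: "0 < e" for e
  proof (rule trial_solutions_Cauchy[where \<kappa> = \<kappa> and E = E])
    show "mono \<kappa>" using \<kappa> by (rule strict_mono_mono)
    show "convergent (\<lambda>n. potential (w n))" using k2(2) by (simp add: w_def \<kappa>_def o_def)
    fix e :: real assume "0 < e"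
    then obtain N where N: "\<And>m n. m \<ge> N \<Longrightarrow> n \<ge> N \<Longrightarrow> (\<integral>x. \<bar>u (k1 m) j0 x - u (k1 n) j0 x\<bar> \<partial>M) < e"
      using k1(2) by blast
    have "k2 n \<ge> N" if "n \<ge> N" for n using that seq_suble[OF k2(1), of n] by simp
    then show "\<exists>N. \<forall>m\<ge>N. \<forall>n\<ge>N. (\<integral>x. \<bar>w m j0 x - w n j0 x\<bar> \<partial>M) < e"
      using N by (auto simp: w_def \<kappa>_def intro!: exI[of _ N])
  qed (simp_all add: w_def u uvi uE e)
  obtain k U G where k: "strict_mono k" and U: "finite_energy U" and G: "finite_energy G"
    "\<And>j. AE x in M. (\<lambda>n. w (k n) j x) \<longlonglongrightarrow> U j x"
    "\<And>j. AE x in M. \<forall>n. \<bar>w (k n) j x\<bar> \<le> G j x"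
    and lim: "(\<lambda>n. energy (\<lambda>j x. w (k n) j x - U j x)) \<longlonglongrightarrow> 0"
    by (rule energy_Cauchy_limit[of w, OF fw C]) (assumption, rule that, assumption, assumption, assumption, blast, blast, assumption)
  have Ucl: "U \<in> trial_closure"
    by (rule trial_closureI[OF U _ lim]) (use uc in \<open>auto simp: w_def\<close>)
  have vi_comb: "convection U (\<lambda>j x. comb m c j x - U j x) \<le> principal U (\<lambda>j x. comb m c j x - U j x)" for m c
  proof (rule vi_passes_to_limit[where w = "\<lambda>n. w (k n)" and X = "\<lambda>n. comb m c" and V = "comb m c"
        and H = "\<lambda>j x. \<bar>comb m c j x\<bar>", OF _ U _ finite_energy_comb G finite_energy_abs[OF finite_energy_comb]])
    obtain n0 where n0: "\<And>n. n \<ge> n0 \<Longrightarrow> comb m c \<in> trial_set n" using trial_set_eventually by blast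
    have "\<kappa> (k n) \<ge> n" for n using seq_suble[OF \<kappa>, of "k n"] seq_suble[OF k, of n] by simp
    then have "comb m c \<in> trial_set (\<kappa> (k n))" if "n \<ge> n0" for n using that n0 by (meson order_trans)
    then show "\<forall>\<^sub>F n in sequentially. convection (w (k n)) (\<lambda>j x. comb m c j x - w (k n) j x)
        \<le> principal (w (k n)) (\<lambda>j x. comb m c j x - w (k n) j x)"
      using uvi by (auto simp: eventually_sequentially w_def intro!: exI[of _ n0])
  qed (simp_all add: fw finite_energy_comb)
  have vi: "convection U (\<lambda>j x. V j x - U j x) \<le> principal U (\<lambda>j x. V j x - U j x)" if V: "V \<in> trial_closure" for V
  proof -
    have fV: "finite_energy V" using V by (simp add: trial_closure_def)
    obtain W where W: "\<And>n. \<exists>m c. W n = comb m c" "(\<lambda>n::nat. energy (\<lambda>j x. W n j x - V j x)) \<longlonglongrightarrow> 0"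
      using trial_closureE[OF V] by blast
    have fW: "finite_energy (W n)" for n using W(1)[of n] finite_energy_comb by auto
    obtain l H where H: "strict_mono (l :: nat \<Rightarrow> nat)" "finite_energy H"
      "\<And>j. AE x in M. (\<lambda>n. W (l n) j x) \<longlonglongrightarrow> V j x"
      "\<And>j. AE x in M. \<forall>n. \<bar>W (l n) j x\<bar> \<le> H j x"
      using energy_convergent_subsequence[OF fW fV W(2)] by blast
    show ?thesis
    proof (rule vi_passes_to_limit[where w = "\<lambda>n. U" and X = "\<lambda>n. W (l n)" and V = V
          and G = "\<lambda>j x. \<bar>U j x\<bar>", OF _ U _ fV finite_energy_abs[OF U] _ _ H(2-4)])
      have "convection U (\<lambda>j x. W (l n) j x - U j x) \<le> principal U (\<lambda>j x. W (l n) j x - U j x)" for n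
        proof -
        obtain m c where "W (l n) = comb m c" using W(1)[of "l n"] by blast
        then show ?thesis using vi_comb[of m c] by simp
      qed
      then show "\<forall>\<^sub>F n in sequentially. convection U (\<lambda>j x. W (l n) j x - U j x) \<le> principal U (\<lambda>j x. W (l n) j x - U j x)"
        by simp
    qed (simp_all add: U fW)
  qed
  show thesis
  proof (rule that[OF Ucl])
    fix V assume V: "V \<in> trial_closure"
    have "convection U V \<le> principal U V"
      using vi[OF trial_closure_add[OF Ucl V]] by simp
    moreover have "convection U (\<lambda>j x. - 1 * V j x) \<le> principal U (\<lambda>j x. - 1 * V j x)"
      using vi[OF trial_closure_add[OF Ucl trial_closure_uminus[OF V]]] by simp
    then have "principal U V \<le> convection U V"
      unfolding convection_scale principal_scale by simp
    ultimately show "principal U V = convection U V" by simp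
  qed
qed

end

section \<open>Smooth functions\<close>

lemma pderiv_at_eqI: "(\<phi> has_derivative D) (at x) \<Longrightarrow> pderiv_at i \<phi> x = D (axis i 1)"
  by (simp add: pderiv_at_def frechet_derivative_at[symmetric])

text \<open>A function that satisfies \<open>Ck (Suc k)\<close> need only be differentiable and have partial derivatives in the
class below, so monotonicity is an induction that starts from the continuity of differentiable functions.\<close>

lemma Ck_Suc_imp: "Ck (Suc k) \<phi> \<Longrightarrow> Ck k \<phi>"
proof (induction k arbitrary: \<phi>)
  case 0
  then show ?case
    by (auto simp: continuous_on_eq_continuous_at intro!: differentiable_imp_continuous_within)
next
  case (Suc k)
  then show ?case by (metis Ck.simps(2))
qed

lemma Ck_const: "Ck k (\<lambda>x. c)"
proof (induction k arbitrary: c)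
  case (Suc k)
  have "pderiv_at i (\<lambda>x. c) = (\<lambda>x. 0)" for i :: 'a
    by (rule ext, subst pderiv_at_eqI[OF has_derivative_const]) simp
  then show ?case using Suc by simp
qed simp

lemma Ck_add: "Ck k \<phi> \<Longrightarrow> Ck k \<psi> \<Longrightarrow> Ck k (\<lambda>x. \<phi> x + \<psi> x)"
proof (induction k arbitrary: \<phi> \<psi>)
  case (Suc k)
  have "pderiv_at i (\<lambda>x. \<phi> x + \<psi> x) = (\<lambda>x. pderiv_at i \<phi> x + pderiv_at i \<psi> x)" for i
  proof
    fix x
    have "(\<phi> has_derivative frechet_derivative \<phi> (at x)) (at x)" "(\<psi> has_derivative frechet_derivative \<psi> (at x)) (at x)"
      using Suc.prems by (auto simp: frechet_derivative_works[symmetric])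
    from pderiv_at_eqI[OF has_derivative_add[OF this], of i]
    show "pderiv_at i (\<lambda>x. \<phi> x + \<psi> x) x = pderiv_at i \<phi> x + pderiv_at i \<psi> x" by (simp add: pderiv_at_def)
  qed
  then show ?case using Suc by auto
qed (auto intro: continuous_intros)

lemma pderiv_at_mult:
  assumes "\<phi> differentiable at x" "\<psi> differentiable at x"
  shows "pderiv_at i (\<lambda>x. \<phi> x * \<psi> x) x = \<phi> x * pderiv_at i \<psi> x + pderiv_at i \<phi> x * \<psi> x"
proof -
  have "(\<phi> has_derivative frechet_derivative \<phi> (at x)) (at x)" "(\<psi> has_derivative frechet_derivative \<psi> (at x)) (at x)"
    using assms by (auto simp: frechet_derivative_works[symmetric])
  from pderiv_at_eqI[OF has_derivative_mult[OF this], of i]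
  show ?thesis by (simp add: pderiv_at_def)
qed

lemma Ck_mult: "Ck k \<phi> \<Longrightarrow> Ck k \<psi> \<Longrightarrow> Ck k (\<lambda>x. \<phi> x * \<psi> x)"
proof (induction k arbitrary: \<phi> \<psi>)
  case (Suc k)
  have d: "\<phi> differentiable at x" "\<psi> differentiable at x" for x using Suc.prems by auto
  have "pderiv_at i (\<lambda>x. \<phi> x * \<psi> x) = (\<lambda>x. \<phi> x * pderiv_at i \<psi> x + pderiv_at i \<phi> x * \<psi> x)" for i
    by (rule ext, rule pderiv_at_mult[OF d])
  moreover have "Ck k \<phi>" "Ck k \<psi>" using Suc.prems Ck_Suc_imp by blast+
  ultimately show ?case using Suc d by (auto intro!: Ck_add)
qed (auto intro: continuous_intros)

lemma Ck_prod: "finite I \<Longrightarrow> (\<And>i. i \<in> I \<Longrightarrow> Ck k (f i)) \<Longrightarrow> Ck k (\<lambda>x. \<Prod>i\<in>I. f i x)"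
  by (induction I rule: finite_induct) (auto intro: Ck_const Ck_mult)

lemma smooth_add: "smooth \<phi> \<Longrightarrow> smooth \<psi> \<Longrightarrow> smooth (\<lambda>x. \<phi> x + \<psi> x)"
  by (simp add: smooth_def Ck_add)
lemma smooth_mult: "smooth \<phi> \<Longrightarrow> smooth \<psi> \<Longrightarrow> smooth (\<lambda>x. \<phi> x * \<psi> x)"
  by (simp add: smooth_def Ck_mult)
lemma smooth_const: "smooth (\<lambda>x. c)"
  by (simp add: smooth_def Ck_const)
lemma smooth_differentiable: "smooth \<phi> \<Longrightarrow> \<phi> differentiable at x"
  unfolding smooth_def by (metis Ck.simps(2))
lemma smooth_pderiv_at: "smooth \<phi> \<Longrightarrow> smooth (pderiv_at i \<phi>)"
  unfolding smooth_def by (metis Ck.simps(2))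
lemma smooth_continuous: "smooth \<phi> \<Longrightarrow> continuous_on UNIV \<phi>"
  unfolding smooth_def by (metis Ck.simps(1))

lemma smooth_has_derivative: "smooth \<phi> \<Longrightarrow> (\<phi> has_derivative (\<lambda>h. \<Sum>i\<in>UNIV. h $ i * pderiv_at i \<phi> x)) (at x)"
proof -
  assume "smooth \<phi>"
  then have d: "(\<phi> has_derivative frechet_derivative \<phi> (at x)) (at x)"
    using smooth_differentiable frechet_derivative_works by blast
  have "frechet_derivative \<phi> (at x) h = (\<Sum>i\<in>UNIV. h $ i * pderiv_at i \<phi> x)" for h
  proof -
    have l: "linear (frechet_derivative \<phi> (at x))" using d has_derivative_linear by blast
    have "h = (\<Sum>i\<in>UNIV. h $ i *\<^sub>R axis i 1)" by (metis basis_expansion scalar_mult_eq_scaleR)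
    then have "frechet_derivative \<phi> (at x) h = frechet_derivative \<phi> (at x) (\<Sum>i\<in>UNIV. h $ i *\<^sub>R axis i 1)" by simp
    also have "\<dots> = (\<Sum>i\<in>UNIV. h $ i * pderiv_at i \<phi> x)"
      by (simp add: linear_sum[OF l] linear_cmul[OF l] pderiv_at_def)
    finally show ?thesis .
  qed
  then show ?thesis using d by (metis (no_types, lifting) ext)
qed

lemma pderiv_at_lincomb:
  assumes "\<And>i. i < m \<Longrightarrow> smooth (\<phi> i)"
  shows "pderiv_at j (\<lambda>x. \<Sum>i<(m::nat). c i * \<phi> i x) x = (\<Sum>i<m. c i * pderiv_at j (\<phi> i) x)"
proof -
  have "((\<lambda>x. \<Sum>i<m. c i * \<phi> i x) has_derivative (\<lambda>h. \<Sum>i<m. c i * (\<Sum>k\<in>UNIV. h $ k * pderiv_at k (\<phi> i) x))) (at x)"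
    using assms by (intro has_derivative_sum has_derivative_mult_right smooth_has_derivative) auto
  from pderiv_at_eqI[OF this, of j] show ?thesis
    by (simp add: axis_def if_distrib[of "\<lambda>z. z * _"] cong: if_cong)
qed

section \<open>Bump functions\<close>

text \<open>The functions \<open>Q(1/t) exp(-1/t)\<close>, extended by \<open>0\<close> to \<open>t \<le> 0\<close>. Polynomial factors \<open>Q\<close> are included because
the family is then closed under differentiation, which makes smoothness a single induction.\<close>

definition flat :: "real poly \<Rightarrow> real \<Rightarrow> real" where
  "flat Q t = (if t \<le> 0 then 0 else poly Q (1 / t) * exp (- (1 / t)))"

lemma poly_times_exp_tendsto_0: "((\<lambda>s::real. poly Q s * exp (- s)) \<longlongrightarrow> 0) at_top"
proof (induction Q)
  case (pCons a Q)
  have "((\<lambda>s. a * exp (- s) + poly (Q * [:0, 1:]) s * exp (- s)) \<longlongrightarrow> 0) at_top"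
  proof -
    have "((\<lambda>s. \<Sum>i\<le>degree (Q * [:0, 1:]). coeff (Q * [:0, 1:]) i * (s ^ i / exp s)) \<longlongrightarrow> (\<Sum>i\<le>degree (Q * [:0, 1:]). coeff (Q * [:0, 1:]) i * 0)) at_top"
      by (intro tendsto_intros tendsto_power_div_exp_0)
    then have "((\<lambda>s. poly (Q * [:0, 1:]) s * exp (- s)) \<longlongrightarrow> 0) at_top"
      by (simp add: poly_altdef sum_distrib_right exp_minus divide_inverse mult.assoc)
    moreover have "((\<lambda>s::real. a * (s ^ 0 / exp s)) \<longlongrightarrow> a * 0) at_top"
      by (intro tendsto_intros tendsto_power_div_exp_0)
    then have "((\<lambda>s. a * exp (- s)) \<longlongrightarrow> 0) at_top" by (simp add: exp_minus divide_inverse)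
    ultimately show ?thesis using tendsto_add by fastforce
  qed
  then show ?case by (simp add: algebra_simps)
qed simp

text \<open>Away from \<open>0\<close> this is calculus. At \<open>0\<close> the difference quotient from the right is \<open>s Q(s) exp(-s)\<close> with
\<open>s = 1/t\<close>, which tends to \<open>0\<close>.\<close>

lemma flat_has_derivative: "(flat Q has_real_derivative flat ([:0, 0, 1:] * (Q - pderiv Q)) t) (at t)"
proof -
  consider "t < 0" | "t = 0" | "0 < t" by linarith
  then show ?thesis
  proof cases
    case 1
    have "((\<lambda>t. 0) has_real_derivative 0) (at t)" by simp
    then have "(flat Q has_real_derivative 0) (at t)"
      by (rule DERIV_cong_ev[OF refl _ refl, THEN iffD1, rotated])
         (use 1 in \<open>auto simp: flat_def eventually_at_filter intro!: eventually_mono[OF eventually_nhds_in_open[of "{..<0}"]]\<close>)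
    then show ?thesis using 1 by (simp add: flat_def)
  next
    case 3
    have "((\<lambda>t. poly Q (1 / t) * exp (- (1 / t))) has_real_derivative
        poly ([:0, 0, 1:] * (Q - pderiv Q)) (1 / t) * exp (- (1 / t))) (at t)"
      using 3 by (auto intro!: derivative_eq_intros DERIV_chain'[OF _ poly_DERIV] simp: field_simps power2_eq_square)
    then have "(flat Q has_real_derivative poly ([:0, 0, 1:] * (Q - pderiv Q)) (1 / t) * exp (- (1 / t))) (at t)"
      by (rule DERIV_cong_ev[OF refl _ refl, THEN iffD1, rotated])
         (use 3 in \<open>auto simp: flat_def intro!: eventually_mono[OF eventually_nhds_in_open[of "{0<..}"]]\<close>)
    then show ?thesis using 3 by (simp add: flat_def)
  next
    case 2
    have "((\<lambda>h. poly ([:0, 1:] * Q) (inverse h) * exp (- inverse h)) \<longlongrightarrow> 0) (at_right 0)"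
      using filterlim_compose[OF poly_times_exp_tendsto_0 filterlim_inverse_at_top_right] .
    then have r: "((\<lambda>h. (flat Q (0 + h) - flat Q 0) / h) \<longlongrightarrow> 0) (at_right 0)"
    proof (rule Lim_transform_eventually)
      show "\<forall>\<^sub>F h in at_right 0. poly ([:0, 1:] * Q) (inverse h) * exp (- inverse h) = (flat Q (0 + h) - flat Q 0) / h"
        using eventually_at_right_less[of "0::real"]
        by eventually_elim (auto simp: flat_def field_simps)
    qed
    have l: "((\<lambda>h. (flat Q (0 + h) - flat Q 0) / h) \<longlongrightarrow> 0) (at_left 0)"
      by (rule Lim_transform_eventually[OF tendsto_const])
         (auto simp: eventually_at_filter flat_def)
    have "((\<lambda>h. (flat Q (0 + h) - flat Q 0) / h) \<longlongrightarrow> 0) (at 0)"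
      using l r by (simp add: filterlim_at_split)
    then show ?thesis using 2 by (simp add: DERIV_def flat_def)
  qed
qed

lemma Ck_flat: "Ck k (\<lambda>x::real^'n::finite. c * flat Q (a * x $ i + b))"
proof (induction k arbitrary: c Q)
  case 0
  have "continuous_on UNIV (flat Q)"
    by (intro continuous_at_imp_continuous_on ballI DERIV_isCont[OF flat_has_derivative])
  then have "continuous_on UNIV (\<lambda>x::real^'n. flat Q (a * x $ i + b))"
    by (rule continuous_on_compose2[where t = UNIV]) (auto intro!: continuous_intros)
  then show ?case by (simp add: continuous_on_mult_left)
next
  case (Suc k)
  define Q' where "Q' = [:0, 0, 1:] * (Q - pderiv Q)"
  have d: "((\<lambda>x::real^'n. c * flat Q (a * x $ i + b)) has_derivative
      (\<lambda>h. c * (flat Q' (a * x $ i + b) * (a * h $ i)))) (at x)" for x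
  proof -
    have "((\<lambda>x::real^'n. a * x $ i + b) has_derivative (\<lambda>h. a * h $ i)) (at x)"
      by (auto intro!: derivative_eq_intros bounded_linear_imp_has_derivative)
    from has_derivative_compose[OF this, of "flat Q" "(*) (flat Q' (a * x $ i + b))"]
    show ?thesis
      using flat_has_derivative[of Q] by (intro has_derivative_mult_right) (simp add: has_field_derivative_def Q'_def)
  qed
  have "pderiv_at j (\<lambda>x::real^'n. c * flat Q (a * x $ i + b)) = (\<lambda>x. (if j = i then c * a else 0) * flat Q' (a * x $ i + b))" for j
    by (rule ext, subst pderiv_at_eqI[OF d]) (auto simp: axis_def)
  moreover have "(\<lambda>x::real^'n. c * flat Q (a * x $ i + b)) differentiable at x" for x
    unfolding differentiable_def using d by blast
  ultimately show ?case using Suc by simp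
qed

text \<open>Products of one-dimensional factors that vanish outside the box. As \<open>k\<close> grows the factors are compressed
towards the faces, so that the bumps increase to the indicator function of the open box.\<close>

definition bump :: "nat \<Rightarrow> real^'n::finite \<Rightarrow> real^'n \<Rightarrow> real^'n \<Rightarrow> real" where
  "bump k a b x = (\<Prod>i\<in>UNIV. flat 1 (real k * x $ i + - (real k * a $ i)) * flat 1 (- real k * x $ i + real k * b $ i))"

lemma smooth_bump:
  fixes a b :: "real^'n::finite"
  shows "smooth (bump k a b)"
proof -
  have "Ck m (\<lambda>x::real^'n. flat Q (c * x $ i + d))" for m Q c d and i :: 'n
    using Ck_flat[of m 1 Q c i d] by simp
  then show ?thesis unfolding smooth_def bump_def[abs_def] by (intro allI Ck_prod Ck_mult) (rule finite)
qed

lemma flat_1_bounds: "0 \<le> flat 1 t" "flat 1 t \<le> 1"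
  by (auto simp: flat_def)

lemma bump_bounds: "0 \<le> bump k a b x" "bump k a b x \<le> 1"
  unfolding bump_def using flat_1_bounds by (auto intro!: prod_nonneg prod_le_1 mult_le_one)

lemma bump_outside: "x \<notin> box a b \<Longrightarrow> bump k a b x = 0"
proof -
  assume "x \<notin> box a b"
  then obtain i where "\<not> (a $ i < x $ i \<and> x $ i < b $ i)" by (auto simp: mem_box_cart)
  then have "real k * x $ i + - (real k * a $ i) \<le> 0 \<or> - real k * x $ i + real k * b $ i \<le> 0"
    by (auto simp: not_less mult_left_mono)
  then have "flat 1 (real k * x $ i + - (real k * a $ i)) * flat 1 (- real k * x $ i + real k * b $ i) = 0"
    by (auto simp: flat_def)
  then show ?thesis unfolding bump_def by (intro prod_zero) auto
qed

lemma bump_tendsto: "(\<lambda>k. bump k a b x) \<longlonglongrightarrow> indicator (box a b) x"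
proof (cases "x \<in> box a b")
  case True
  have f: "(\<lambda>k. flat 1 (real k * t)) \<longlonglongrightarrow> 1" if "0 < t" for t
  proof -
    have "(\<lambda>k. exp (- ((1/t) / real k))) \<longlonglongrightarrow> exp (- 0)"
      by (intro tendsto_intros lim_const_over_n)
    moreover have "\<forall>\<^sub>F k in sequentially. exp (- ((1/t) / real k)) = flat 1 (real k * t)"
      using eventually_gt_at_top[of 0]
    proof eventually_elim
      case (elim k)
      then have "0 < real k * t" using that by simp
      then show ?case by (simp add: flat_def mult.commute)
    qed
    ultimately have "(\<lambda>k. flat 1 (real k * t)) \<longlonglongrightarrow> exp (- 0)" by (rule Lim_transform_eventually)
    then show ?thesis by simp
  qed
  have "(\<lambda>k. \<Prod>i\<in>UNIV. flat 1 (real k * (x $ i - a $ i)) * flat 1 (real k * (b $ i - x $ i))) \<longlonglongrightarrow> (\<Prod>i\<in>(UNIV::'a set). 1 * 1)"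
    using True by (intro tendsto_prod tendsto_mult f) (auto simp: mem_box_cart)
  then show ?thesis using True by (simp add: bump_def algebra_simps)
qed (simp add: bump_outside)

lemma bump_test_function:
  assumes "cbox a b \<subseteq> \<Omega>" shows "bump k a b \<in> test_functions \<Omega>"
proof -
  have "{x. bump k a b x \<noteq> 0} \<subseteq> cbox a b" using bump_outside box_subset_cbox by blast
  then have *: "closure {x. bump k a b x \<noteq> 0} \<subseteq> cbox a b" by (intro closure_minimal closed_cbox)
  then have "compact (closure {x. bump k a b x \<noteq> 0})"
    by (metis bounded_cbox bounded_subset closed_closure compact_eq_bounded_closed)
  then show ?thesis using * assms smooth_bump by (auto simp: test_functions_def)
qed

section \<open>The fundamental lemma of the calculus of variations\<close>

lemma locally_integrable_cbox:
  assumes "locally_integrable \<Omega> g" "cbox a b \<subseteq> \<Omega>"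
  shows "set_integrable lebesgue (cbox a b) g"
  using assms by (auto simp: locally_integrable_def)

text \<open>Test with the bumps of the box and let them tend to the indicator function.\<close>

lemma integral_box_eq_0:
  fixes g :: "real^'n::finite \<Rightarrow> real"
  assumes \<Omega>: "open \<Omega>" and g: "locally_integrable \<Omega> g"
    and z: "\<And>\<phi>. \<phi> \<in> test_functions \<Omega> \<Longrightarrow> (\<integral>x. g x * \<phi> x \<partial>lebesgue_on \<Omega>) = 0"
    and ab: "cbox a b \<subseteq> \<Omega>"
  shows "(\<integral>x. indicator (box a b) x * g x \<partial>lebesgue) = 0"
proof -
  have gi: "integrable lebesgue (\<lambda>x. indicator (cbox a b) x * g x)"
    using locally_integrable_cbox[OF g ab] by (simp add: set_integrable_def)
  have \<Omega>s: "\<Omega> \<in> sets lebesgue" using \<Omega> by simp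
  have bm: "bump k a b \<in> borel_measurable lebesgue" for k
    by (intro measurable_completion) (simp add: borel_measurable_continuous_onI smooth_continuous smooth_bump)
  have eq: "(\<integral>x. bump k a b x * (indicator (cbox a b) x * g x) \<partial>lebesgue) = 0" for k
  proof -
    have "(\<integral>x. g x * bump k a b x \<partial>lebesgue_on \<Omega>) = (\<integral>x. indicator \<Omega> x *\<^sub>R (g x * bump k a b x) \<partial>lebesgue)"
      using \<Omega>s by (subst integral_restrict_space) auto
    also have "\<dots> = (\<integral>x. bump k a b x * (indicator (cbox a b) x * g x) \<partial>lebesgue)"
    proof (rule Bochner_Integration.integral_cong[OF refl])
      fix x
      show "indicator \<Omega> x *\<^sub>R (g x * bump k a b x) = bump k a b x * (indicator (cbox a b) x * g x)"
        using ab bump_outside[of x a b k] box_subset_cbox[of a b] by (cases "x \<in> box a b") (auto simp: indicator_def)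
    qed
    finally show ?thesis using z[OF bump_test_function[OF ab]] by simp
  qed
  have "(\<lambda>k. \<integral>x. bump k a b x * (indicator (cbox a b) x * g x) \<partial>lebesgue)
      \<longlonglongrightarrow> (\<integral>x. indicator (box a b) x * (indicator (cbox a b) x * g x) \<partial>lebesgue)"
  proof (rule integral_dominated_convergence[where w = "\<lambda>x. \<bar>indicator (cbox a b) x * g x\<bar>"])
    show "AE x in lebesgue. (\<lambda>k. bump k a b x * (indicator (cbox a b) x * g x)) \<longlonglongrightarrow> indicator (box a b) x * (indicator (cbox a b) x * g x)"
      by (intro AE_I2 tendsto_intros bump_tendsto)
    show "AE x in lebesgue. norm (bump k a b x * (indicator (cbox a b) x * g x)) \<le> \<bar>indicator (cbox a b) x * g x\<bar>" for k
      using bump_bounds[of k a b] by (intro AE_I2) (auto simp: abs_mult intro!: mult_left_le_one_le)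
    show "(\<lambda>x. bump k a b x * (indicator (cbox a b) x * g x)) \<in> borel_measurable lebesgue" for k
      by (rule borel_measurable_times[OF bm borel_measurable_integrable[OF gi]])
    show "(\<lambda>x. indicator (box a b) x * (indicator (cbox a b) x * g x)) \<in> borel_measurable lebesgue"
      by (rule borel_measurable_times[OF _ borel_measurable_integrable[OF gi]])
         (intro borel_measurable_indicator, auto)
  qed (use gi in auto)
  moreover have "indicator (box a b) x * (indicator (cbox a b) x * g x) = indicator (box a b) x * g x" for x
    using box_subset_cbox[of a b] by (auto simp: indicator_def)
  ultimately show ?thesis unfolding eq by (simp add: LIMSEQ_const_iff)
qed

text \<open>All integrals of \<open>g\<close> over boxes inside \<open>box c d\<close> vanish, since intersections of boxes are boxes. By Lebesgue's
differentiation theorem for cubes \<open>g\<close> is almost everywhere the limit of such averages.\<close>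

lemma AE_eq_0_on_box:
  fixes g :: "real^'n::finite \<Rightarrow> real"
  assumes \<Omega>: "open \<Omega>" and g: "locally_integrable \<Omega> g"
    and z: "\<And>\<phi>. \<phi> \<in> test_functions \<Omega> \<Longrightarrow> (\<integral>x. g x * \<phi> x \<partial>lebesgue_on \<Omega>) = 0"
    and cd: "cbox c d \<subseteq> \<Omega>"
  shows "AE x in lebesgue. x \<in> box c d \<longrightarrow> g x = 0"
proof -
  define f where "f x = indicator (box c d) x * g x" for x
  have "integrable lebesgue (\<lambda>x. indicator (cbox c d) x *\<^sub>R g x)"
    using locally_integrable_cbox[OF g cd] by (simp add: set_integrable_def)
  then have "integrable lebesgue (\<lambda>x. indicator (box c d) x *\<^sub>R (indicator (cbox c d) x *\<^sub>R g x))"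
    by (intro integrable_mult_indicator[where f = "\<lambda>x. indicator (cbox c d) x *\<^sub>R g x"]) auto
  moreover have "indicator (box c d) x *\<^sub>R (indicator (cbox c d) x *\<^sub>R g x) = f x" for x
    using box_subset_cbox[of c d] by (auto simp: indicator_def f_def)
  ultimately have fi: "integrable lebesgue f" by simp
  have si: "set_integrable lebesgue (cbox a b) f" for a b
    unfolding set_integrable_def using fi by (intro integrable_mult_indicator) auto
  have i0: "integral (cbox a b) f = 0" for a b
  proof -
    obtain a' b' where ab': "box a b \<inter> box c d = box a' b'"
      using box_Int_box[of a b c d] by blast
    have "integral (cbox a b) f = (\<integral>x. indicator (cbox a b) x *\<^sub>R f x \<partial>lebesgue)"
      using set_lebesgue_integral_eq_integral(2)[OF si] by (simp add: set_lebesgue_integral_def)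
    also have "\<dots> = (\<integral>x. indicator (box a b) x *\<^sub>R f x \<partial>lebesgue)"
    proof (rule integral_cong_AE)
      have "AE x in lebesgue. x \<notin> cbox a b - box a b"
        using negligible_frontier_interval[of a b] by (intro AE_not_in) (simp add: negligible_iff_null_sets)
      then show "AE x in lebesgue. indicator (cbox a b) x *\<^sub>R f x = indicator (box a b) x *\<^sub>R f x"
        by eventually_elim (use box_subset_cbox[of a b] in \<open>auto simp: indicator_def\<close>)
    qed (use fi in \<open>auto intro!: borel_measurable_times borel_measurable_indicator\<close>)
    also have "\<dots> = (\<integral>x. indicator (box a' b') x * g x \<partial>lebesgue)"
      unfolding ab'[symmetric] f_def by (intro Bochner_Integration.integral_cong) (auto simp: indicator_def)
    also have "\<dots> = 0"
    proof (cases "box a' b' = {}")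
      case False
      have "box a' b' \<subseteq> cbox c d" using ab' box_subset_cbox by blast
      then have "cbox a' b' \<subseteq> cbox c d" using closure_box[OF False] closure_minimal[of "box a' b'" "cbox c d"] by auto
      then show ?thesis using cd by (intro integral_box_eq_0[OF \<Omega> g z]) auto
    qed simp
    finally show ?thesis .
  qed
  have "\<And>a b. f integrable_on cbox a b" using si set_lebesgue_integral_eq_integral(1) by blast
  then obtain N where N: "negligible N" "\<And>x e. \<lbrakk>x \<notin> N; 0 < e\<rbrakk> \<Longrightarrow>
     \<exists>d>0. \<forall>h. 0 < h \<and> h < d \<longrightarrow> norm(integral (cbox x (x + h *\<^sub>R One)) f /\<^sub>R h ^ DIM(real^'n) - f x) < e"
    using integrable_ccontinuous_explicit[of f] by blast
  have "f x = 0" if "x \<notin> N" for x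
  proof (rule ccontr)
    assume "f x \<noteq> 0"
    then have "0 < norm (f x)" by simp
    from N(2)[OF \<open>x \<notin> N\<close> this] obtain d where d: "d > 0" "\<forall>h. 0 < h \<and> h < d \<longrightarrow>
        norm(integral (cbox x (x + h *\<^sub>R One)) f /\<^sub>R h ^ DIM(real^'n) - f x) < norm (f x)" by blast
    then show False using d(2)[rule_format, of "d/2"] by (simp add: i0)
  qed
  moreover have "AE x in lebesgue. x \<notin> N" using N(1) by (intro AE_not_in) (simp add: negligible_iff_null_sets)
  ultimately have "AE x in lebesgue. f x = 0" by auto
  then show ?thesis by eventually_elim (auto simp: f_def indicator_def)
qed

proposition fundamental_lemma:
  fixes g :: "real^'n::finite \<Rightarrow> real"
  assumes \<Omega>: "open \<Omega>" and g: "locally_integrable \<Omega> g"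
    and z: "\<And>\<phi>. \<phi> \<in> test_functions \<Omega> \<Longrightarrow> (\<integral>x. g x * \<phi> x \<partial>lebesgue_on \<Omega>) = 0"
  shows "AE x in lebesgue_on \<Omega>. g x = 0"
proof -
  obtain D where D: "countable D" "D \<subseteq> Pow \<Omega>" "\<And>X. X \<in> D \<Longrightarrow> \<exists>a b. X = cbox a b" "\<Union>D = \<Omega>"
    using open_countable_Union_open_cbox[OF \<Omega>] by blast
  have "AE x in lebesgue. x \<in> X \<longrightarrow> g x = 0" if X: "X \<in> D" for X
  proof -
    obtain a b where ab: "X = cbox a b" using D(3)[OF X] by blast
    then have "cbox a b \<subseteq> \<Omega>" using D(2) X by blast
    from AE_eq_0_on_box[OF \<Omega> g z this]
    have "AE x in lebesgue. x \<in> box a b \<longrightarrow> g x = 0" .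
    moreover have "AE x in lebesgue. x \<notin> cbox a b - box a b"
      using negligible_frontier_interval[of a b] by (intro AE_not_in) (simp add: negligible_iff_null_sets)
    ultimately show ?thesis unfolding ab by eventually_elim auto
  qed
  then have "AE x in lebesgue. \<forall>X\<in>D. x \<in> X \<longrightarrow> g x = 0"
    by (subst AE_ball_countable[OF D(1)]) blast
  then have "AE x in lebesgue. x \<in> \<Omega> \<longrightarrow> g x = 0"
    by eventually_elim (use D(4) in blast)
  then show ?thesis using \<Omega> by (subst AE_restrict_space_iff) auto
qed

section \<open>Test functions and their translations\<close>

lemma test_function_smooth: "\<phi> \<in> test_functions \<Omega> \<Longrightarrow> smooth \<phi>"
  by (simp add: test_functions_def)

lemma test_function_0: "\<phi> \<in> test_functions \<Omega> \<Longrightarrow> x \<notin> \<Omega> \<Longrightarrow> \<phi> x = 0"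
  using closure_subset[of "{x. \<phi> x \<noteq> 0}"] by (auto simp: test_functions_def)

lemma pderiv_at_outside_support:
  assumes "x \<notin> closure {x. \<phi> x \<noteq> 0}" shows "pderiv_at i \<phi> x = 0"
proof -
  have "((\<lambda>x. 0) has_derivative (\<lambda>h. 0)) (at x)" by simp
  then have "(\<phi> has_derivative (\<lambda>h. 0)) (at x)"
  proof (rule has_derivative_transform_within_open)
    show "open (- closure {x. \<phi> x \<noteq> 0})" by (intro open_Compl closed_closure)
    show "0 = \<phi> y" if "y \<in> - closure {x. \<phi> x \<noteq> 0}" for y
      using that closure_subset[of "{x. \<phi> x \<noteq> 0}"] by auto
  qed (use assms in simp)
  then show ?thesis by (simp add: pderiv_at_eqI)
qed

lemma test_functionI:
  assumes "smooth \<psi>" "{x. \<psi> x \<noteq> 0} \<subseteq> closure {x. \<phi> x \<noteq> 0}" "\<phi> \<in> test_functions \<Omega>"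
  shows "\<psi> \<in> test_functions \<Omega>"
proof -
  have "closure {x. \<psi> x \<noteq> 0} \<subseteq> closure {x. \<phi> x \<noteq> 0}" using assms(2) by (intro closure_minimal closed_closure)
  moreover have "compact (closure {x. \<phi> x \<noteq> 0})" "closure {x. \<phi> x \<noteq> 0} \<subseteq> \<Omega>"
    using assms(3) by (auto simp: test_functions_def)
  ultimately show ?thesis using assms(1)
    unfolding test_functions_def compact_eq_bounded_closed
    by (auto intro: bounded_subset)
qed

lemma test_function_pderiv_at: "\<phi> \<in> test_functions \<Omega> \<Longrightarrow> pderiv_at i \<phi> \<in> test_functions \<Omega>"
  by (rule test_functionI[of _ \<phi>])
     (use pderiv_at_outside_support[of _ \<phi> i] in \<open>auto intro: smooth_pderiv_at test_function_smooth\<close>)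

lemma test_function_mult:
  assumes "\<phi> \<in> test_functions \<Omega>" "smooth \<psi>" shows "(\<lambda>x. \<phi> x * \<psi> x) \<in> test_functions \<Omega>"
  by (rule test_functionI[OF smooth_mult _ assms(1)])
     (use assms closure_subset[of "{x. \<phi> x \<noteq> 0}"] in \<open>auto intro: test_function_smooth\<close>)

lemma test_function_bounded_support:
  assumes "\<phi> \<in> test_functions \<Omega>"
  obtains R where "0 < R" "\<And>x. R < norm x \<Longrightarrow> \<phi> x = 0"
proof -
  have "bounded (closure {x. \<phi> x \<noteq> 0})" using assms by (auto simp: test_functions_def compact_eq_bounded_closed)
  then have "bounded {x. \<phi> x \<noteq> 0}" using bounded_subset closure_subset by blast
  then obtain R where R: "0 < R" "\<And>x. \<phi> x \<noteq> 0 \<Longrightarrow> norm x \<le> R" by (auto simp: bounded_pos)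
  show thesis by (rule that[OF R(1)]) (use R(2) in force)
qed

lemma test_function_bounded:
  assumes "\<phi> \<in> test_functions \<Omega>"
  obtains B where "0 < B" "\<And>x. \<bar>\<phi> x\<bar> \<le> B"
proof -
  let ?K = "closure {x. \<phi> x \<noteq> 0}"
  have "compact (\<phi> ` ?K)"
  proof (rule compact_continuous_image)
    show "continuous_on ?K \<phi>"
      using continuous_on_subset[OF smooth_continuous[OF test_function_smooth[OF assms]]] by blast
    show "compact ?K" using assms by (simp add: test_functions_def)
  qed
  then obtain B where B: "0 < B" "\<And>x. x \<in> ?K \<Longrightarrow> \<bar>\<phi> x\<bar> \<le> B"
    using compact_imp_bounded[of "\<phi> ` ?K"] by (auto simp: bounded_pos)
  show thesis
  proof (rule that[OF B(1)])
    show "\<bar>\<phi> x\<bar> \<le> B" for x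
      using B closure_subset[of "{x. \<phi> x \<noteq> 0}"] by (cases "\<phi> x = 0") auto
  qed
qed

lemma test_function_Lipschitz:
  assumes "\<phi> \<in> test_functions \<Omega>"
  obtains L where "0 < L" "\<And>x y. \<bar>\<phi> x - \<phi> y\<bar> \<le> L * norm (x - y)"
proof -
  have "\<forall>i. \<exists>B>0. \<forall>x. \<bar>pderiv_at i \<phi> x\<bar> \<le> B"
  proof
    fix i
    obtain B where "0 < B" "\<And>x. \<bar>pderiv_at i \<phi> x\<bar> \<le> B"
      using test_function_bounded[OF test_function_pderiv_at[OF assms]] by blast
    then show "\<exists>B>0. \<forall>x. \<bar>pderiv_at i \<phi> x\<bar> \<le> B" by blast
  qed
  then obtain B where "\<forall>i. 0 < B i \<and> (\<forall>x. \<bar>pderiv_at i \<phi> x\<bar> \<le> B i)" by metis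
  then have B: "\<And>i. 0 < B i" "\<And>i x. \<bar>pderiv_at i \<phi> x\<bar> \<le> B i" by auto
  define L where "L = (\<Sum>i\<in>UNIV. B i)"
  show thesis
  proof (rule that[of L])
    show "0 < L" unfolding L_def using B(1) by (intro sum_pos) auto
    fix x y :: "real^'a"
    have "norm (\<phi> x - \<phi> y) \<le> L * norm (x - y)"
    proof (rule differentiable_bound[of UNIV])
      show "(\<phi> has_derivative (\<lambda>h. \<Sum>i\<in>UNIV. h $ i * pderiv_at i \<phi> x)) (at x)" for x
        by (rule smooth_has_derivative[OF test_function_smooth[OF assms]])
      show "onorm (\<lambda>h. \<Sum>i\<in>UNIV. h $ i * pderiv_at i \<phi> x) \<le> L" for x
      proof (rule onorm_le)
        fix h :: "real^'a"
        have "norm (\<Sum>i\<in>UNIV. h $ i * pderiv_at i \<phi> x) \<le> (\<Sum>i\<in>UNIV. norm h * B i)"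
          by (rule sum_norm_le) (auto simp: abs_mult intro!: mult_mono component_le_norm_cart B)
        then show "norm (\<Sum>i\<in>UNIV. h $ i * pderiv_at i \<phi> x) \<le> L * norm h"
          by (simp add: L_def sum_distrib_left mult.commute)
      qed
    qed auto
    then show "\<bar>\<phi> x - \<phi> y\<bar> \<le> L * norm (x - y)" by simp
  qed
qed

lemma test_function_borel: "\<phi> \<in> test_functions \<Omega> \<Longrightarrow> \<phi> \<in> borel_measurable borel"
  by (intro borel_measurable_continuous_onI smooth_continuous test_function_smooth)

lemma integrable_lborel_bounded_support:
  fixes f :: "real^'n::finite \<Rightarrow> real"
  assumes "f \<in> borel_measurable borel" "\<And>x. \<bar>f x\<bar> \<le> B" "\<And>x. R < norm x \<Longrightarrow> f x = 0"
  shows "integrable lborel f"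
proof -
  have "integrable lborel (\<lambda>x. indicator (cball 0 R) x *\<^sub>R B)"
    by (intro borel_integrable_compact) auto
  then show ?thesis
    by (rule Bochner_Integration.integrable_bound)
       (use assms in \<open>auto intro!: AE_I2 simp: indicator_def intro: order_trans[OF _ abs_ge_self]\<close>)
qed

lemma test_function_integrable: "\<phi> \<in> test_functions \<Omega> \<Longrightarrow> integrable lborel \<phi>"
proof -
  assume \<phi>: "\<phi> \<in> test_functions \<Omega>"
  obtain R where "\<And>x. R < norm x \<Longrightarrow> \<phi> x = 0" using test_function_bounded_support[OF \<phi>] by blast
  moreover obtain B where "\<And>x. \<bar>\<phi> x\<bar> \<le> B" using test_function_bounded[OF \<phi>] by blast
  ultimately show ?thesis by (intro integrable_lborel_bounded_support[OF test_function_borel[OF \<phi>]])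
qed

lemma lborel_integral_translate:
  fixes f :: "'a::euclidean_space \<Rightarrow> real"
  assumes [measurable]: "f \<in> borel_measurable borel"
  shows "(\<integral>x. f (x + c) \<partial>lborel) = (\<integral>x. f x \<partial>lborel)"
proof -
  have "(\<integral>x. f x \<partial>lborel) = (\<integral>x. f x \<partial>distr lborel borel ((+) c))" by (simp add: lborel_distr_plus)
  also have "\<dots> = (\<integral>x. f (c + x) \<partial>lborel)" by (subst integral_distr) auto
  finally show ?thesis by (simp add: add.commute)
qed

lemma integrable_shift:
  assumes \<phi>: "\<phi> \<in> test_functions \<Omega>"
  shows "integrable lborel (\<lambda>x. \<phi> (x + z))"
proof -
  note [measurable] = test_function_borel[OF \<phi>]
  have "integrable (distr lborel borel ((+) z)) \<phi>"
    using test_function_integrable[OF \<phi>] by (simp add: lborel_distr_plus)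
  then show ?thesis by (subst (asm) integrable_distr_eq) (auto simp: add.commute)
qed

text \<open>A test function is Lipschitz with bounded support, so its difference quotients in a direction \<open>z\<close> are bounded
by one integrable function.\<close>

lemma difference_quotient_dominated:
  fixes \<phi> :: "real^'n::finite \<Rightarrow> real"
  assumes \<phi>: "\<phi> \<in> test_functions \<Omega>"
  obtains w where "integrable lborel w"
    "\<And>x. (\<lambda>N. real (Suc N) * (\<phi> (x + z /\<^sub>R real (Suc N)) - \<phi> x)) \<longlonglongrightarrow> (\<Sum>i\<in>UNIV. z $ i * pderiv_at i \<phi> x)"
    "\<And>N x. \<bar>real (Suc N) * (\<phi> (x + z /\<^sub>R real (Suc N)) - \<phi> x)\<bar> \<le> w x"
proof -
  obtain R where R: "0 < R" "\<And>x. R < norm x \<Longrightarrow> \<phi> x = 0" using test_function_bounded_support[OF \<phi>] by blast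
  obtain L where L: "0 < L" "\<And>x y. \<bar>\<phi> x - \<phi> y\<bar> \<le> L * norm (x - y)" using test_function_Lipschitz[OF \<phi>] by blast
  define w where "w x = indicator (cball 0 (R + norm z)) x *\<^sub>R (L * norm z)" for x :: "real^'n"
  have "integrable lborel w" unfolding w_def by (intro borel_integrable_compact) auto
  moreover have "(\<lambda>N. real (Suc N) * (\<phi> (x + z /\<^sub>R real (Suc N)) - \<phi> x)) \<longlonglongrightarrow> (\<Sum>i\<in>UNIV. z $ i * pderiv_at i \<phi> x)" for x
  proof -
    have "((\<lambda>t. x + t *\<^sub>R z) has_derivative (\<lambda>t. t *\<^sub>R z)) (at 0)"
      by (auto intro!: derivative_eq_intros)
    moreover have "(\<phi> has_derivative (\<lambda>h. \<Sum>i\<in>UNIV. h $ i * pderiv_at i \<phi> x)) (at (x + 0 *\<^sub>R z))"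
      using smooth_has_derivative[OF test_function_smooth[OF \<phi>], of x] by simp
    ultimately have "((\<lambda>t. \<phi> (x + t *\<^sub>R z)) has_derivative (\<lambda>t. \<Sum>i\<in>UNIV. (t *\<^sub>R z) $ i * pderiv_at i \<phi> x)) (at 0)"
      by (rule has_derivative_compose)
    moreover have "(\<lambda>t. \<Sum>i\<in>UNIV. (t *\<^sub>R z) $ i * pderiv_at i \<phi> x) = (*) (\<Sum>i\<in>UNIV. z $ i * pderiv_at i \<phi> x)"
      by (auto simp: fun_eq_iff sum_distrib_left mult_ac)
    ultimately have "DERIV (\<lambda>t. \<phi> (x + t *\<^sub>R z)) 0 :> (\<Sum>i\<in>UNIV. z $ i * pderiv_at i \<phi> x)"
      by (simp add: has_field_derivative_def)
    then have "((\<lambda>h. (\<phi> (x + h *\<^sub>R z) - \<phi> x) / h) \<longlongrightarrow> (\<Sum>i\<in>UNIV. z $ i * pderiv_at i \<phi> x)) (at 0)"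
      by (simp add: DERIV_def)
    moreover have "filterlim (\<lambda>N. inverse (real (Suc N))) (at 0) sequentially"
      unfolding filterlim_at using LIMSEQ_inverse_real_of_nat by auto
    ultimately have "(\<lambda>N. (\<phi> (x + inverse (real (Suc N)) *\<^sub>R z) - \<phi> x) / inverse (real (Suc N))) \<longlonglongrightarrow> (\<Sum>i\<in>UNIV. z $ i * pderiv_at i \<phi> x)"
      by (rule filterlim_compose)
    then show ?thesis by (simp add: divide_inverse mult.commute)
  qed
  moreover have "\<bar>real (Suc N) * (\<phi> (x + z /\<^sub>R real (Suc N)) - \<phi> x)\<bar> \<le> w x" for N x
  proof (cases "norm x \<le> R + norm z")
    case True
    have "real (Suc N) * \<bar>\<phi> (x + z /\<^sub>R real (Suc N)) - \<phi> x\<bar> \<le> real (Suc N) * (L * norm (z /\<^sub>R real (Suc N)))"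
      using L(2)[of "x + z /\<^sub>R real (Suc N)" x] by (intro mult_left_mono) auto
    also have "\<dots> = L * norm z" by (simp add: field_simps)
    finally show ?thesis using True by (simp add: w_def abs_mult)
  next
    case False
    have "norm (z /\<^sub>R real (Suc N)) = norm z / real (Suc N)" by (simp add: divide_inverse mult.commute)
    also have "\<dots> \<le> norm z / 1" by (rule divide_left_mono) auto
    finally have "norm (z /\<^sub>R real (Suc N)) \<le> norm z" by simp
    then have "R < norm (x + z /\<^sub>R real (Suc N))"
      using False norm_triangle_ineq2[of x "- (z /\<^sub>R real (Suc N))"] by simp
    then have "\<phi> (x + z /\<^sub>R real (Suc N)) = 0" by (rule R(2))
    moreover have "\<phi> x = 0" using False by (intro R(2)) (smt (verit) norm_ge_zero)
    ultimately show ?thesis using L(1) by (simp add: w_def)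
  qed
  ultimately show thesis using that by blast
qed

text \<open>The difference quotients have integral \<open>0\<close> by translation invariance; pass to the limit.\<close>

lemma integral_pderiv_at_test_function:
  fixes \<phi> :: "real^'n::finite \<Rightarrow> real"
  assumes \<phi>: "\<phi> \<in> test_functions \<Omega>"
  shows "(\<integral>x. pderiv_at i \<phi> x \<partial>lborel) = 0"
proof -
  note [measurable] = test_function_borel[OF \<phi>] test_function_borel[OF test_function_pderiv_at[OF \<phi>]]
  obtain w where w: "integrable lborel w"
    "\<And>x. (\<lambda>N. real (Suc N) * (\<phi> (x + axis i 1 /\<^sub>R real (Suc N)) - \<phi> x)) \<longlonglongrightarrow> (\<Sum>j\<in>UNIV. axis i 1 $ j * pderiv_at j \<phi> x)"
    "\<And>N x. \<bar>real (Suc N) * (\<phi> (x + axis i 1 /\<^sub>R real (Suc N)) - \<phi> x)\<bar> \<le> w x"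
    using difference_quotient_dominated[OF \<phi>, of "axis i 1"] by blast
  have "(\<lambda>N. \<integral>x. real (Suc N) * (\<phi> (x + axis i 1 /\<^sub>R real (Suc N)) - \<phi> x) \<partial>lborel)
     \<longlonglongrightarrow> (\<integral>x. (\<Sum>j\<in>UNIV. axis i 1 $ j * pderiv_at j \<phi> x) \<partial>lborel)"
  proof (rule integral_dominated_convergence[OF _ _ w(1)])
    have "(\<lambda>x. \<Sum>j\<in>UNIV. axis i 1 $ j * pderiv_at j \<phi> x) = pderiv_at i \<phi>"
      by (auto simp: axis_def if_distrib[of "\<lambda>z. z * _"] cong: if_cong)
    then show "(\<lambda>x. \<Sum>j\<in>UNIV. axis i 1 $ j * pderiv_at j \<phi> x) \<in> borel_measurable lborel" by simp
  qed (use w in \<open>auto simp del: of_nat_Suc\<close>)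
  moreover have "(\<integral>x. real (Suc N) * (\<phi> (x + axis i 1 /\<^sub>R real (Suc N)) - \<phi> x) \<partial>lborel) = 0" for N
  proof -
    show ?thesis
      using integrable_shift[OF \<phi>, of "axis i 1 /\<^sub>R real (Suc N)"] test_function_integrable[OF \<phi>] lborel_integral_translate[of \<phi> "axis i 1 /\<^sub>R real (Suc N)"] by simp
  qed
  ultimately have "(\<integral>x. (\<Sum>j\<in>UNIV. axis i 1 $ j * pderiv_at j \<phi> x) \<partial>lborel) = 0" by (simp add: LIMSEQ_const_iff)
  then show ?thesis by (simp add: axis_def if_distrib[of "\<lambda>z. z * _"] cong: if_cong)
qed

definition shift_L1 :: "(real^'n::finite \<Rightarrow> real) \<Rightarrow> real^'n \<Rightarrow> real" where
  "shift_L1 \<phi> z = (\<integral>x. \<bar>\<phi> (x + z) - \<phi> x\<bar> \<partial>lborel)"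

lemma shift_L1_multiple:
  assumes \<phi>: "\<phi> \<in> test_functions \<Omega>"
  shows "shift_L1 \<phi> (real N *\<^sub>R z) \<le> real N * shift_L1 \<phi> z"
proof (induction N)
  case (Suc N)
  note [measurable] = test_function_borel[OF \<phi>]
  have "shift_L1 \<phi> (real (Suc N) *\<^sub>R z)
      \<le> (\<integral>x. \<bar>\<phi> ((x + real N *\<^sub>R z) + z) - \<phi> (x + real N *\<^sub>R z)\<bar> + \<bar>\<phi> (x + real N *\<^sub>R z) - \<phi> x\<bar> \<partial>lborel)"
    unfolding shift_L1_def
  proof (rule integral_mono)
    show "integrable lborel (\<lambda>x. \<bar>\<phi> (x + real (Suc N) *\<^sub>R z) - \<phi> x\<bar>)"
      by (intro integrable_abs Bochner_Integration.integrable_diff integrable_shift[OF \<phi>] test_function_integrable[OF \<phi>])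
    show "integrable lborel (\<lambda>x. \<bar>\<phi> ((x + real N *\<^sub>R z) + z) - \<phi> (x + real N *\<^sub>R z)\<bar> + \<bar>\<phi> (x + real N *\<^sub>R z) - \<phi> x\<bar>)"
      unfolding add.assoc
      by (intro integrable_abs Bochner_Integration.integrable_add Bochner_Integration.integrable_diff
          integrable_shift[OF \<phi>] test_function_integrable[OF \<phi>])
    show "\<bar>\<phi> (x + real (Suc N) *\<^sub>R z) - \<phi> x\<bar> \<le> \<bar>\<phi> ((x + real N *\<^sub>R z) + z) - \<phi> (x + real N *\<^sub>R z)\<bar> + \<bar>\<phi> (x + real N *\<^sub>R z) - \<phi> x\<bar>" for x
    proof -
      have "x + real (Suc N) *\<^sub>R z = (x + real N *\<^sub>R z) + z" by (simp add: scaleR_add_left add.commute add.left_commute)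
      then show ?thesis by (simp only:)
    qed
  qed
  also have "\<dots> = (\<integral>x. \<bar>\<phi> ((x + real N *\<^sub>R z) + z) - \<phi> (x + real N *\<^sub>R z)\<bar> \<partial>lborel) + shift_L1 \<phi> (real N *\<^sub>R z)"
    unfolding shift_L1_def
    unfolding add.assoc
    by (intro Bochner_Integration.integral_add integrable_abs Bochner_Integration.integrable_diff
          integrable_shift[OF \<phi>] test_function_integrable[OF \<phi>])
  also have "(\<integral>x. \<bar>\<phi> ((x + real N *\<^sub>R z) + z) - \<phi> (x + real N *\<^sub>R z)\<bar> \<partial>lborel) = shift_L1 \<phi> z"
    unfolding shift_L1_def
    using lborel_integral_translate[of "\<lambda>x. \<bar>\<phi> (x + z) - \<phi> x\<bar>" "real N *\<^sub>R z"] by simp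
  finally show ?case using Suc by (simp add: algebra_simps)
qed (simp add: shift_L1_def)

text \<open>The \<open>L\<^sup>1\<close> size of a shift is subadditive, so a shift by \<open>z\<close> costs at most \<open>N\<close> shifts by \<open>z/N\<close>. For large \<open>N\<close> the
latter is the \<open>L\<^sup>1\<close> norm of the derivative in direction \<open>z\<close>.\<close>

proposition shift_L1_le:
  fixes \<phi> :: "real^'n::finite \<Rightarrow> real"
  assumes \<phi>: "\<phi> \<in> test_functions \<Omega>"
  shows "shift_L1 \<phi> z \<le> (\<Sum>i\<in>UNIV. \<bar>z $ i\<bar> * (\<integral>x. \<bar>pderiv_at i \<phi> x\<bar> \<partial>lborel))"
proof -
  have pm [measurable]: "pderiv_at i \<phi> \<in> borel_measurable borel" for i
    by (rule test_function_borel[OF test_function_pderiv_at[OF \<phi>]])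
  note [measurable] = test_function_borel[OF \<phi>]
  note pi = test_function_integrable[OF test_function_pderiv_at[OF \<phi>]]
  obtain w where w: "integrable lborel w"
    "\<And>x. (\<lambda>N. real (Suc N) * (\<phi> (x + z /\<^sub>R real (Suc N)) - \<phi> x)) \<longlonglongrightarrow> (\<Sum>j\<in>UNIV. z $ j * pderiv_at j \<phi> x)"
    "\<And>N x. \<bar>real (Suc N) * (\<phi> (x + z /\<^sub>R real (Suc N)) - \<phi> x)\<bar> \<le> w x"
    using difference_quotient_dominated[OF \<phi>, of z] by blast
  have "(\<lambda>N. \<integral>x. \<bar>real (Suc N) * (\<phi> (x + z /\<^sub>R real (Suc N)) - \<phi> x)\<bar> \<partial>lborel)
     \<longlonglongrightarrow> (\<integral>x. \<bar>\<Sum>j\<in>UNIV. z $ j * pderiv_at j \<phi> x\<bar> \<partial>lborel)"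
  proof (rule integral_dominated_convergence[OF _ _ w(1)])
    show "AE x in lborel. (\<lambda>N. \<bar>real (Suc N) * (\<phi> (x + z /\<^sub>R real (Suc N)) - \<phi> x)\<bar>)
       \<longlonglongrightarrow> \<bar>\<Sum>j\<in>UNIV. z $ j * pderiv_at j \<phi> x\<bar>"
      by (intro AE_I2 tendsto_rabs w(2))
    show "AE x in lborel. norm \<bar>real (Suc N) * (\<phi> (x + z /\<^sub>R real (Suc N)) - \<phi> x)\<bar> \<le> w x" for N
      using w(3)[of N] by (intro AE_I2) simp
  qed measurable
  then have "shift_L1 \<phi> z \<le> (\<integral>x. \<bar>\<Sum>j\<in>UNIV. z $ j * pderiv_at j \<phi> x\<bar> \<partial>lborel)"
  proof (rule LIMSEQ_le_const, intro exI allI impI)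
    fix N
    have "shift_L1 \<phi> z = shift_L1 \<phi> (real (Suc N) *\<^sub>R (z /\<^sub>R real (Suc N)))" by simp
    also have "\<dots> \<le> real (Suc N) * shift_L1 \<phi> (z /\<^sub>R real (Suc N))" by (rule shift_L1_multiple[OF \<phi>])
    also have "\<dots> = (\<integral>x. \<bar>real (Suc N) * (\<phi> (x + z /\<^sub>R real (Suc N)) - \<phi> x)\<bar> \<partial>lborel)"
      by (simp add: shift_L1_def abs_mult del: of_nat_Suc)
    finally show "shift_L1 \<phi> z \<le> (\<integral>x. \<bar>real (Suc N) * (\<phi> (x + z /\<^sub>R real (Suc N)) - \<phi> x)\<bar> \<partial>lborel)" .
  qed
  also have "\<dots> \<le> (\<integral>x. (\<Sum>j\<in>UNIV. \<bar>z $ j\<bar> * \<bar>pderiv_at j \<phi> x\<bar>) \<partial>lborel)"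
  proof (rule integral_mono)
    show "\<bar>\<Sum>j\<in>UNIV. z $ j * pderiv_at j \<phi> x\<bar> \<le> (\<Sum>j\<in>UNIV. \<bar>z $ j\<bar> * \<bar>pderiv_at j \<phi> x\<bar>)" for x
      by (rule order_trans[OF sum_abs]) (simp add: abs_mult)
  qed (use pi in auto)
  also have "\<dots> = (\<Sum>i\<in>UNIV. \<bar>z $ i\<bar> * (\<integral>x. \<bar>pderiv_at i \<phi> x\<bar> \<partial>lborel))"
    using pi by (subst Bochner_Integration.integral_sum) auto
  finally show ?thesis .
qed

section \<open>Weak derivatives\<close>

lemma borel_measurable_lebesgue_on:
  assumes "f \<in> borel_measurable borel" shows "f \<in> borel_measurable (lebesgue_on \<Omega>)"
  using assms by (intro measurable_restrict_space1 measurable_completion) simp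

lemma integral_lebesgue_on_eq_lborel:
  fixes f :: "real^'n::finite \<Rightarrow> real"
  assumes \<Omega>: "open \<Omega>" and f: "f \<in> borel_measurable borel" and z: "\<And>x. x \<notin> \<Omega> \<Longrightarrow> f x = 0"
  shows "(\<integral>x. f x \<partial>lebesgue_on \<Omega>) = (\<integral>x. f x \<partial>lborel)"
    "integrable (lebesgue_on \<Omega>) f \<longleftrightarrow> integrable lborel f"
proof -
  have s: "\<Omega> \<inter> space lebesgue \<in> sets lebesgue" using \<Omega> by simp
  have e: "(\<lambda>x. indicator \<Omega> x *\<^sub>R f x) = f" using z by (auto simp: fun_eq_iff indicator_def)
  show "(\<integral>x. f x \<partial>lebesgue_on \<Omega>) = (\<integral>x. f x \<partial>lborel)"
    unfolding integral_restrict_space[OF s] e by (rule integral_completion) (use f in simp)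
  show "integrable (lebesgue_on \<Omega>) f \<longleftrightarrow> integrable lborel f"
    unfolding integrable_restrict_space[OF s] e by (rule integrable_completion) (use f in simp)
qed

lemma integrable_imp_locally_integrable:
  assumes \<Omega>: "open \<Omega>" and f: "integrable (lebesgue_on \<Omega>) f"
  shows "locally_integrable \<Omega> f"
  unfolding locally_integrable_def
proof (intro allI impI)
  fix K assume K: "compact K \<and> K \<subseteq> \<Omega>"
  have "set_integrable lebesgue \<Omega> f"
    using f \<Omega> unfolding set_integrable_def by (subst (asm) integrable_restrict_space) auto
  then show "f absolutely_integrable_on K"
    by (rule set_integrable_subset) (use K in \<open>auto intro: lmeasurable_compact fmeasurableD\<close>)
qed

lemma locally_integrable_diff:
  assumes "locally_integrable \<Omega> f" "locally_integrable \<Omega> g"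
  shows "locally_integrable \<Omega> (\<lambda>x. f x - g x)"
  using assms unfolding locally_integrable_def by (auto intro: set_integral_diff)

lemma locally_integrable_mult_test_function:
  fixes f :: "real^'n::finite \<Rightarrow> real"
  assumes \<Omega>: "open \<Omega>" and f: "locally_integrable \<Omega> f" and \<phi>: "\<phi> \<in> test_functions \<Omega>"
  shows "integrable (lebesgue_on \<Omega>) (\<lambda>x. f x * \<phi> x)"
proof -
  define K where "K = closure {x. \<phi> x \<noteq> 0}"
  have K: "compact K" "K \<subseteq> \<Omega>" using \<phi> by (auto simp: test_functions_def K_def)
  obtain B where B: "\<And>x. \<bar>\<phi> x\<bar> \<le> B" using test_function_bounded[OF \<phi>] by blast
  have fi: "integrable lebesgue (\<lambda>x. indicator K x *\<^sub>R f x)"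
    using f K by (simp add: locally_integrable_def set_integrable_def)
  have "\<phi> \<in> borel_measurable lebesgue"
    using test_function_borel[OF \<phi>] by (intro measurable_completion) simp
  then have "integrable lebesgue (\<lambda>x. \<phi> x * (indicator K x *\<^sub>R f x))"
  proof (intro Bochner_Integration.integrable_bound[OF integrable_mult_right[OF fi, of B]])
    show "AE x in lebesgue. norm (\<phi> x * (indicator K x *\<^sub>R f x)) \<le> norm (B * indicator K x *\<^sub>R f x)"
    proof (rule AE_I2)
      fix x
      have "\<bar>\<phi> x\<bar> * \<bar>indicator K x *\<^sub>R f x\<bar> \<le> \<bar>B\<bar> * \<bar>indicator K x *\<^sub>R f x\<bar>"
        using B[of x] by (intro mult_right_mono) auto
      then show "norm (\<phi> x * (indicator K x *\<^sub>R f x)) \<le> norm (B * indicator K x *\<^sub>R f x)" by (simp add: abs_mult)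
    qed
  qed (use fi in \<open>auto intro!: borel_measurable_times\<close>)
  moreover
  have "\<phi> x * (indicator K x *\<^sub>R f x) = indicator \<Omega> x *\<^sub>R (f x * \<phi> x)" for x
    using K closure_subset[of "{x. \<phi> x \<noteq> 0}"] by (cases "\<phi> x = 0") (auto simp: K_def indicator_def)
  then have "(\<lambda>x. \<phi> x * (indicator K x *\<^sub>R f x)) = (\<lambda>x. indicator \<Omega> x *\<^sub>R (f x * \<phi> x))" by blast
  ultimately have "integrable lebesgue (\<lambda>x. indicator \<Omega> x *\<^sub>R (f x * \<phi> x))" by simp
  then show ?thesis using \<Omega> by (subst integrable_restrict_space) auto
qed

lemma test_function_locally_integrable:
  assumes "open \<Omega>" "\<phi> \<in> test_functions \<Omega>" shows "locally_integrable \<Omega> \<phi>"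
  using assms integral_lebesgue_on_eq_lborel(2)[OF assms(1) test_function_borel[OF assms(2)] test_function_0[OF assms(2)]]
    test_function_integrable[OF assms(2)] by (intro integrable_imp_locally_integrable) auto

text \<open>Integration by parts is \<open>\<integral> D\<^sub>i (\<phi> \<psi>) = 0\<close> and the product rule.\<close>

lemma test_function_has_weak_pderiv:
  fixes \<phi> :: "real^'n::finite \<Rightarrow> real"
  assumes \<Omega>: "open \<Omega>" and \<phi>: "\<phi> \<in> test_functions \<Omega>"
  shows "has_weak_pderiv \<Omega> i \<phi> (pderiv_at i \<phi>)"
  unfolding has_weak_pderiv_def
proof (intro conjI ballI)
  show "locally_integrable \<Omega> \<phi>" "locally_integrable \<Omega> (pderiv_at i \<phi>)"
    by (intro test_function_locally_integrable \<Omega> \<phi> test_function_pderiv_at)+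
  fix \<psi> assume \<psi>: "\<psi> \<in> test_functions \<Omega>"
  have t1: "(\<lambda>x. \<phi> x * pderiv_at i \<psi> x) \<in> test_functions \<Omega>"
    by (intro test_function_mult \<phi> smooth_pderiv_at test_function_smooth[OF \<psi>])
  have t2: "(\<lambda>x. pderiv_at i \<phi> x * \<psi> x) \<in> test_functions \<Omega>"
    by (intro test_function_mult test_function_pderiv_at \<phi> test_function_smooth[OF \<psi>])
  have "0 = (\<integral>x. pderiv_at i (\<lambda>x. \<phi> x * \<psi> x) x \<partial>lborel)"
    by (rule integral_pderiv_at_test_function[OF test_function_mult[OF \<phi> test_function_smooth[OF \<psi>]], symmetric])
  also have "\<dots> = (\<integral>x. \<phi> x * pderiv_at i \<psi> x + pderiv_at i \<phi> x * \<psi> x \<partial>lborel)"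
    by (intro Bochner_Integration.integral_cong refl pderiv_at_mult smooth_differentiable test_function_smooth[OF \<phi>] test_function_smooth[OF \<psi>])
  also have "\<dots> = (\<integral>x. \<phi> x * pderiv_at i \<psi> x \<partial>lborel) + (\<integral>x. pderiv_at i \<phi> x * \<psi> x \<partial>lborel)"
    by (rule Bochner_Integration.integral_add[OF test_function_integrable[OF t1] test_function_integrable[OF t2]])
  finally have "(\<integral>x. \<phi> x * pderiv_at i \<psi> x \<partial>lborel) = - (\<integral>x. pderiv_at i \<phi> x * \<psi> x \<partial>lborel)" by linarith
  then show "(\<integral>x. \<phi> x * pderiv_at i \<psi> x \<partial>lebesgue_on \<Omega>) = - (\<integral>x. pderiv_at i \<phi> x * \<psi> x \<partial>lebesgue_on \<Omega>)"
    using integral_lebesgue_on_eq_lborel(1)[OF \<Omega> test_function_borel[OF t1] test_function_0[OF t1]]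
      integral_lebesgue_on_eq_lborel(1)[OF \<Omega> test_function_borel[OF t2] test_function_0[OF t2]] by simp
qed

lemma has_weak_pderiv_diff:
  assumes \<Omega>: "open \<Omega>" and "has_weak_pderiv \<Omega> i u g" "has_weak_pderiv \<Omega> i v h"
  shows "has_weak_pderiv \<Omega> i (\<lambda>x. u x - v x) (\<lambda>x. g x - h x)"
  unfolding has_weak_pderiv_def
proof (intro conjI ballI)
  note 1 = assms(2,3)[unfolded has_weak_pderiv_def]
  note l = locally_integrable_mult_test_function[OF \<Omega>]
  show "locally_integrable \<Omega> (\<lambda>x. u x - v x)" "locally_integrable \<Omega> (\<lambda>x. g x - h x)"
    using 1 by (auto intro: locally_integrable_diff)
  fix \<psi> assume \<psi>: "\<psi> \<in> test_functions \<Omega>"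
  have "(\<integral>x. (u x - v x) * pderiv_at i \<psi> x \<partial>lebesgue_on \<Omega>) = (\<integral>x. u x * pderiv_at i \<psi> x \<partial>lebesgue_on \<Omega>) - (\<integral>x. v x * pderiv_at i \<psi> x \<partial>lebesgue_on \<Omega>)"
    unfolding left_diff_distrib using 1 by (intro Bochner_Integration.integral_diff l test_function_pderiv_at \<psi>) auto
  also have "\<dots> = - ((\<integral>x. g x * \<psi> x \<partial>lebesgue_on \<Omega>) - (\<integral>x. h x * \<psi> x \<partial>lebesgue_on \<Omega>))" using 1 \<psi> by simp
  also have "(\<integral>x. g x * \<psi> x \<partial>lebesgue_on \<Omega>) - (\<integral>x. h x * \<psi> x \<partial>lebesgue_on \<Omega>) = (\<integral>x. (g x - h x) * \<psi> x \<partial>lebesgue_on \<Omega>)"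
    unfolding left_diff_distrib using 1 by (intro Bochner_Integration.integral_diff[symmetric] l \<psi>) auto
  finally show "(\<integral>x. (u x - v x) * pderiv_at i \<psi> x \<partial>lebesgue_on \<Omega>) = - (\<integral>x. (g x - h x) * \<psi> x \<partial>lebesgue_on \<Omega>)" .
qed

lemma has_weak_pderiv_unique:
  fixes u :: "real^'n::finite \<Rightarrow> real"
  assumes \<Omega>: "open \<Omega>" and "has_weak_pderiv \<Omega> i u g" "has_weak_pderiv \<Omega> i u h"
  shows "AE x in lebesgue_on \<Omega>. g x = h x"
proof -
  note d = has_weak_pderiv_diff[OF assms]
  have "AE x in lebesgue_on \<Omega>. g x - h x = 0"
    by (rule fundamental_lemma[OF \<Omega>]) (use d in \<open>auto simp: has_weak_pderiv_def\<close>)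
  then show ?thesis by eventually_elim simp
qed

text \<open>The chosen representative agrees almost everywhere with any other weak derivative, so it can be replaced by
whichever is at hand.\<close>

lemma weak_pderiv_AE:
  fixes u :: "real^'n::finite \<Rightarrow> real"
  assumes \<Omega>: "open \<Omega>" and "has_weak_pderiv \<Omega> i u g"
  shows "has_weak_pderiv \<Omega> i u (weak_pderiv \<Omega> i u)" "AE x in lebesgue_on \<Omega>. weak_pderiv \<Omega> i u x = g x"
proof -
  show *: "has_weak_pderiv \<Omega> i u (weak_pderiv \<Omega> i u)"
    unfolding weak_pderiv_def by (rule someI[of "has_weak_pderiv \<Omega> i u", OF assms(2)])
  show "AE x in lebesgue_on \<Omega>. weak_pderiv \<Omega> i u x = g x"
    by (rule has_weak_pderiv_unique[OF \<Omega> * assms(2)])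
qed

lemma lebesgue_on_measurable_AE:
  fixes f g :: "real^'n::finite \<Rightarrow> real"
  assumes \<Omega>: "open \<Omega>" and f: "f \<in> borel_measurable (lebesgue_on \<Omega>)" and ae: "AE x in lebesgue_on \<Omega>. f x = g x"
  shows "g \<in> borel_measurable (lebesgue_on \<Omega>)"
proof -
  have s: "\<Omega> \<in> sets lebesgue" using \<Omega> by simp
  have "AE x in lebesgue. x \<in> \<Omega> \<longrightarrow> f x = g x" using ae s by (subst (asm) AE_restrict_space_iff) auto
  then have "AE x in lebesgue. (if x \<in> \<Omega> then f x else 0) = (if x \<in> \<Omega> then g x else 0)" by eventually_elim auto
  from borel_measurable_AE[OF borel_measurable_if_I[OF f s] this] show ?thesis by (rule borel_measurable_if_D)
qed

text \<open>Integration by parts survives dominated convergence of the functions and of their derivatives, since the test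
function and its derivative are bounded.\<close>

lemma has_weak_pderiv_limit:
  fixes u :: "real^'n::finite \<Rightarrow> real"
  assumes \<Omega>: "open \<Omega>" and \<phi>: "\<And>n. \<phi> n \<in> test_functions \<Omega>"
    and um: "u \<in> borel_measurable (lebesgue_on \<Omega>)" and gm: "g \<in> borel_measurable (lebesgue_on \<Omega>)"
    and G: "integrable (lebesgue_on \<Omega>) G" and H: "integrable (lebesgue_on \<Omega>) H"
    and ul: "AE x in lebesgue_on \<Omega>. (\<lambda>n. \<phi> n x) \<longlonglongrightarrow> u x" and gl: "AE x in lebesgue_on \<Omega>. (\<lambda>n. pderiv_at i (\<phi> n) x) \<longlonglongrightarrow> g x"
    and ud: "AE x in lebesgue_on \<Omega>. \<forall>n. \<bar>\<phi> n x\<bar> \<le> G x" and gd: "AE x in lebesgue_on \<Omega>. \<forall>n. \<bar>pderiv_at i (\<phi> n) x\<bar> \<le> H x"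
  shows "has_weak_pderiv \<Omega> i u g"
proof -
  have lim: "(\<lambda>n. \<integral>x. a n x * \<psi> x \<partial>lebesgue_on \<Omega>) \<longlonglongrightarrow> (\<integral>x. v x * \<psi> x \<partial>lebesgue_on \<Omega>)"
    if a: "\<And>n. a n \<in> borel_measurable (lebesgue_on \<Omega>)" and v: "v \<in> borel_measurable (lebesgue_on \<Omega>)"
      and F: "integrable (lebesgue_on \<Omega>) F"
      and l: "AE x in lebesgue_on \<Omega>. (\<lambda>n. a n x) \<longlonglongrightarrow> v x" and d: "AE x in lebesgue_on \<Omega>. \<forall>n. \<bar>a n x\<bar> \<le> F x"
      and \<psi>: "\<psi> \<in> test_functions \<Omega>"
    for a :: "nat \<Rightarrow> real^'n \<Rightarrow> real" and v F \<psi>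
  proof -
    obtain B where B: "\<And>x. \<bar>\<psi> x\<bar> \<le> B" using test_function_bounded[OF \<psi>] by blast
    have \<psi>m: "\<psi> \<in> borel_measurable (lebesgue_on \<Omega>)"
      by (rule borel_measurable_lebesgue_on[OF test_function_borel[OF \<psi>]])
    show ?thesis
    proof (rule integral_dominated_convergence[where w = "\<lambda>x. F x * B"])
      show "AE x in lebesgue_on \<Omega>. (\<lambda>n. a n x * \<psi> x) \<longlonglongrightarrow> v x * \<psi> x"
        using l by eventually_elim (intro tendsto_intros)
      show "AE x in lebesgue_on \<Omega>. norm (a n x * \<psi> x) \<le> F x * B" for n
        using d
      proof eventually_elim
        case (elim x)
        then show ?case using B[of x] abs_ge_zero[of "a n x"]
          by (auto simp: abs_mult intro!: mult_mono intro: order_trans)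
      qed
    qed (use a v F \<psi>m in \<open>auto intro!: borel_measurable_times\<close>)
  qed
  have \<phi>m: "\<phi> n \<in> borel_measurable (lebesgue_on \<Omega>)" and \<phi>dm: "pderiv_at i (\<phi> n) \<in> borel_measurable (lebesgue_on \<Omega>)" for n
    by (rule borel_measurable_lebesgue_on[OF test_function_borel[OF \<phi>]],
        rule borel_measurable_lebesgue_on[OF test_function_borel[OF test_function_pderiv_at[OF \<phi>]]])
  have dom: "integrable (lebesgue_on \<Omega>) v"
    if "v \<in> borel_measurable (lebesgue_on \<Omega>)" "integrable (lebesgue_on \<Omega>) F"
     "AE x in lebesgue_on \<Omega>. (\<lambda>n. a n x) \<longlonglongrightarrow> v x" "AE x in lebesgue_on \<Omega>. \<forall>n. \<bar>a n x\<bar> \<le> F x"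
   for v F :: "real^'n \<Rightarrow> real" and a :: "nat \<Rightarrow> real^'n \<Rightarrow> real"
  proof (rule Bochner_Integration.integrable_bound[OF that(2,1)])
    show "AE x in lebesgue_on \<Omega>. norm (v x) \<le> norm (F x)"
      using that(3,4)
    proof eventually_elim
      case (elim x)
      have "\<bar>v x\<bar> \<le> F x" using tendsto_rabs[OF elim(1)] by (rule LIMSEQ_le_const2) (use elim in auto)
      then show ?case by simp
    qed
  qed
  show ?thesis unfolding has_weak_pderiv_def
  proof (intro conjI ballI)
    show "locally_integrable \<Omega> u" by (rule integrable_imp_locally_integrable[OF \<Omega> dom[OF um G ul ud]])
    show "locally_integrable \<Omega> g" by (rule integrable_imp_locally_integrable[OF \<Omega> dom[OF gm H gl gd]])
    fix \<psi> assume \<psi>: "\<psi> \<in> test_functions \<Omega>"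
    have e: "(\<integral>x. \<phi> n x * pderiv_at i \<psi> x \<partial>lebesgue_on \<Omega>) = - (\<integral>x. pderiv_at i (\<phi> n) x * \<psi> x \<partial>lebesgue_on \<Omega>)" for n
      using test_function_has_weak_pderiv[OF \<Omega> \<phi>[of n], of i] \<psi> by (simp add: has_weak_pderiv_def)
    have l1: "(\<lambda>n. \<integral>x. \<phi> n x * pderiv_at i \<psi> x \<partial>lebesgue_on \<Omega>) \<longlonglongrightarrow> (\<integral>x. u x * pderiv_at i \<psi> x \<partial>lebesgue_on \<Omega>)"
      by (rule lim[OF \<phi>m um G ul ud test_function_pderiv_at[OF \<psi>]])
    have l2: "(\<lambda>n. - (\<integral>x. pderiv_at i (\<phi> n) x * \<psi> x \<partial>lebesgue_on \<Omega>)) \<longlonglongrightarrow> - (\<integral>x. g x * \<psi> x \<partial>lebesgue_on \<Omega>)"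
      by (intro tendsto_minus lim[OF \<phi>dm gm H gl gd \<psi>])
    show "(\<integral>x. u x * pderiv_at i \<psi> x \<partial>lebesgue_on \<Omega>) = - (\<integral>x. g x * \<psi> x \<partial>lebesgue_on \<Omega>)"
      by (rule LIMSEQ_unique[OF l1[unfolded e] l2])
  qed
qed

section \<open>Compactness of test functions in \<open>L\<^sup>1\<close>\<close>

definition grid_index :: "real \<Rightarrow> real^'n::finite \<Rightarrow> 'n \<Rightarrow> int" where
  "grid_index c x = (\<lambda>i. \<lfloor>c * x $ i\<rfloor>)"

definition grid_cell :: "real \<Rightarrow> ('n::finite \<Rightarrow> int) \<Rightarrow> (real^'n) set" where
  "grid_cell c \<nu> = {y. grid_index c y = \<nu>}"

lemma grid_cell_borel [measurable]: "grid_cell c \<nu> \<in> sets borel"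
proof -
  have "grid_cell c \<nu> = (\<Inter>i\<in>UNIV. {y. real_of_int (\<nu> i) \<le> c * y $ i \<and> c * y $ i < real_of_int (\<nu> i) + 1})"
    by (auto simp: grid_cell_def grid_index_def fun_eq_iff floor_eq_iff)
  also have "\<dots> \<in> sets borel"
  proof (intro sets.finite_INT)
    fix i
    have "open {y::real^'a. c * y $ i < real_of_int (\<nu> i) + 1}" "closed {y::real^'a. real_of_int (\<nu> i) \<le> c * y $ i}"
      by (intro open_Collect_less closed_Collect_le continuous_intros)+
    then have "{y::real^'a. real_of_int (\<nu> i) \<le> c * y $ i} \<inter> {y. c * y $ i < real_of_int (\<nu> i) + 1} \<in> sets borel"
      by auto
    then show "{y. real_of_int (\<nu> i) \<le> c * y $ i \<and> c * y $ i < real_of_int (\<nu> i) + 1} \<in> sets borel"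
      by (simp add: Collect_conj_eq)
  qed auto
  finally show ?thesis .
qed

lemma prod_Basis_vec: "(\<Prod>b\<in>Basis. (f::real^'n::finite \<Rightarrow> real) b) = (\<Prod>i\<in>UNIV. f (axis i 1))"
proof -
  have "(Basis :: (real^'n) set) = (\<lambda>i. axis i 1) ` UNIV" by (auto simp: Basis_vec_def)
  moreover have inj: "inj (\<lambda>i::'n. axis i (1::real))" by (simp add: inj_on_def axis_eq_axis)
  have "prod f (range (\<lambda>i::'n. axis i (1::real))) = (\<Prod>i\<in>UNIV. f (axis i 1))"
    by (subst prod.reindex[OF inj]) (simp add: o_def)
  ultimately show ?thesis by simp
qed

lemma emeasure_grid_cell:
  assumes c: "0 < c"
  shows "emeasure lborel (grid_cell c \<nu> :: (real^'n::finite) set) = ennreal ((1 / c) ^ CARD('n))"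
proof -
  define a b :: "real^'n" where "a = (\<chi> i. real_of_int (\<nu> i) / c)" and "b = (\<chi> i. (real_of_int (\<nu> i) + 1) / c)"
  have le: "a $ i \<le> b $ i" for i using c by (simp add: a_def b_def divide_right_mono)
  then have leB: "\<And>e. e \<in> Basis \<Longrightarrow> a \<bullet> e \<le> b \<bullet> e" by (auto simp: Basis_vec_def inner_axis)
  have d: "b $ i - a $ i = 1 / c" for i by (simp add: a_def b_def diff_divide_distrib[symmetric])
  have p: "(\<Prod>e\<in>Basis. (b - a) \<bullet> e) = (1 / c) ^ CARD('n)"
    unfolding prod_Basis_vec by (simp add: inner_axis d)
  have "box a b \<subseteq> grid_cell c \<nu>" "grid_cell c \<nu> \<subseteq> cbox a b"
    using c by (auto simp: mem_box_cart grid_cell_def grid_index_def fun_eq_iff floor_eq_iff a_def b_def field_simps less_imp_le)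
  then have "emeasure lborel (box a b) \<le> emeasure lborel (grid_cell c \<nu>)"
    "emeasure lborel (grid_cell c \<nu>) \<le> emeasure lborel (cbox a b)" by (auto intro!: emeasure_mono)
  then show ?thesis
    using emeasure_lborel_box[OF leB] emeasure_lborel_cbox[OF leB] p by simp
qed

lemma grid_index_measurable:
  fixes h :: "('n::finite \<Rightarrow> int) \<Rightarrow> real"
  shows "(\<lambda>x::real^'n. h (grid_index c x)) \<in> borel_measurable borel"
proof -
  have "grid_index c \<in> measurable borel (count_space (UNIV :: ('n \<Rightarrow> int) set))"
  proof (rule measurable_count_space_eq_countable[THEN iffD2])
    show "countable (UNIV :: ('n \<Rightarrow> int) set)" by (rule countableI_type)
    show "grid_index c \<in> space borel \<rightarrow> UNIV \<and> (\<forall>a\<in>(UNIV :: ('n \<Rightarrow> int) set). grid_index c -` {a} \<inter> space borel \<in> sets borel)"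
    proof (intro conjI ballI)
      fix \<nu> :: "'n \<Rightarrow> int"
      have "grid_index c -` {\<nu>} \<inter> space borel = grid_cell c \<nu>" by (auto simp: grid_cell_def)
      then show "grid_index c -` {\<nu>} \<inter> space borel \<in> sets borel" by simp
    qed auto
  qed
  then show ?thesis by (rule measurable_compose) simp
qed

definition cell_integral :: "real \<Rightarrow> (real^'n::finite \<Rightarrow> real) \<Rightarrow> ('n \<Rightarrow> int) \<Rightarrow> real" where
  "cell_integral c \<phi> \<nu> = (\<integral>y. indicator (grid_cell c \<nu>) y * \<phi> y \<partial>lborel)"

text \<open>The average over the grid cell of side \<open>1/c\<close> that contains \<open>x\<close>.\<close>

definition cell_average :: "real \<Rightarrow> (real^'n::finite \<Rightarrow> real) \<Rightarrow> real^'n \<Rightarrow> real" where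
  "cell_average c \<phi> x = c ^ CARD('n) * cell_integral c \<phi> (grid_index c x)"

lemma cell_average_borel [measurable]: "cell_average c \<phi> \<in> borel_measurable borel"
  unfolding cell_average_def[abs_def] using grid_index_measurable[of "\<lambda>\<nu>. c ^ CARD('a) * cell_integral c \<phi> \<nu>" c] .

lemma cell_integral_bound:
  assumes "integrable lborel \<phi>"
  shows "\<bar>cell_integral c \<phi> \<nu>\<bar> \<le> (\<integral>y. \<bar>\<phi> y\<bar> \<partial>lborel)"
proof -
  have "\<bar>cell_integral c \<phi> \<nu>\<bar> \<le> (\<integral>y. \<bar>indicator (grid_cell c \<nu>) y * \<phi> y\<bar> \<partial>lborel)"
    unfolding cell_integral_def by (rule integral_abs_bound)
  also have "\<dots> \<le> (\<integral>y. \<bar>\<phi> y\<bar> \<partial>lborel)"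
  proof (rule integral_mono)
    have "integrable lborel (\<lambda>y. indicator (grid_cell c \<nu>) y *\<^sub>R \<phi> y)"
      by (intro integrable_mult_indicator assms) simp
    then show "integrable lborel (\<lambda>y. \<bar>indicator (grid_cell c \<nu>) y * \<phi> y\<bar>)" by simp
  qed (use assms in \<open>auto simp: indicator_def\<close>)
  finally show ?thesis .
qed

text \<open>The difference of \<open>\<phi> x\<close> and its cell average is at most \<open>c\<^sup>n\<close> times the integral of \<open>|\<phi> (x + z) - \<phi> x|\<close> over
\<open>|z\<^sub>i| \<le> 1/c\<close>, because a cell has side \<open>1/c\<close>. After exchanging the integrals, every shift \<open>z\<close> contributes at
most \<open>n K / c\<close>. The factor \<open>2\<^sup>n\<close> is the ratio of the volumes of the cube of shifts and of a cell.\<close>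

lemma nn_integral_cell_average_close:
  fixes \<phi> :: "real^'n::finite \<Rightarrow> real"
  assumes \<phi>: "\<phi> \<in> test_functions \<Omega>" and c: "0 < c"
    and K: "\<And>i. (\<integral>x. \<bar>pderiv_at i \<phi> x\<bar> \<partial>lborel) \<le> K"
  shows "(\<integral>\<^sup>+x. ennreal \<bar>cell_average c \<phi> x - \<phi> x\<bar> \<partial>lborel)
    \<le> ennreal (2 ^ CARD('n) * (real CARD('n) * K / c))"
proof -
  have mphi: "\<phi> \<in> borel_measurable borel" by (rule test_function_borel[OF \<phi>])
  note [measurable] = mphi
  define a1 :: "real^'n" where "a1 = (\<chi> i. 1 / c)"
  define Q where "Q = cbox (- a1) a1"
  have Qs [measurable]: "Q \<in> sets borel" by (simp add: Q_def)
  have K0: "0 \<le> K" by (rule order_trans[OF _ K[of undefined]]) simp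
  have Qm: "emeasure lborel Q = ennreal ((2 / c) ^ CARD('n))"
  proof -
    have leB: "\<And>e. e \<in> Basis \<Longrightarrow> - a1 \<bullet> e \<le> a1 \<bullet> e"
      using c by (auto simp: a1_def Basis_vec_def inner_axis intro: order_trans[of _ 0])
    have "(\<Prod>e\<in>Basis. (a1 - - a1) \<bullet> e) = (2 / c) ^ CARD('n)"
      unfolding prod_Basis_vec by (simp add: inner_axis a1_def)
    then show ?thesis unfolding Q_def using emeasure_lborel_cbox[OF leB] by simp
  qed
  have diff: "ennreal \<bar>cell_average c \<phi> x - \<phi> x\<bar> \<le>
     ennreal (c ^ CARD('n)) * (\<integral>\<^sup>+z. indicator Q z * ennreal \<bar>\<phi> (x + z) - \<phi> x\<bar> \<partial>lborel)" for x
  proof -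
    define S where "S = grid_cell c (grid_index c x)"
    have [measurable]: "S \<in> sets borel" by (simp add: S_def)
    have Sm: "emeasure lborel S = ennreal ((1 / c) ^ CARD('n))" unfolding S_def by (rule emeasure_grid_cell[OF c])
    have Si: "integrable lborel (indicator S :: _ \<Rightarrow> real)" using Sm by (intro integrable_real_indicator) auto
    have S\<phi>: "integrable lborel (\<lambda>y. indicator S y * \<phi> y)"
      using integrable_mult_indicator[OF _ test_function_integrable[OF \<phi>], of S] by simp
    have "measure lborel S = (1 / c) ^ CARD('n)" using Sm c by (simp add: measure_def)
    then have "\<phi> x = c ^ CARD('n) * (\<integral>y. indicator S y * \<phi> x \<partial>lborel)"
      using c by (simp add: power_one_over)
    then have "cell_average c \<phi> x - \<phi> x = c ^ CARD('n) * ((\<integral>y. indicator S y * \<phi> y \<partial>lborel) - (\<integral>y. indicator S y * \<phi> x \<partial>lborel))"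
      unfolding cell_average_def cell_integral_def S_def[symmetric] by (simp add: right_diff_distrib)
    also have "\<dots> = c ^ CARD('n) * (\<integral>y. indicator S y * (\<phi> y - \<phi> x) \<partial>lborel)"
      using S\<phi> Si by (simp add: right_diff_distrib)
    finally have "\<bar>cell_average c \<phi> x - \<phi> x\<bar> = c ^ CARD('n) * \<bar>\<integral>y. indicator S y * (\<phi> y - \<phi> x) \<partial>lborel\<bar>"
      using c by (simp add: abs_mult)
    also have "ennreal \<dots> = ennreal (c ^ CARD('n)) * ennreal (norm (\<integral>y. indicator S y * (\<phi> y - \<phi> x) \<partial>lborel))"
      using c by (subst ennreal_mult) auto
    also have "\<dots> \<le> ennreal (c ^ CARD('n)) * (\<integral>\<^sup>+y. ennreal (norm (indicator S y * (\<phi> y - \<phi> x))) \<partial>lborel)"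
      using S\<phi> Si by (intro mult_left_mono integral_norm_bound_ennreal) (auto simp: right_diff_distrib)
    also have "(\<integral>\<^sup>+y. ennreal (norm (indicator S y * (\<phi> y - \<phi> x))) \<partial>lborel)
        = (\<integral>\<^sup>+y. ennreal (norm (indicator S y * (\<phi> y - \<phi> x))) \<partial>distr lborel borel ((+) x))"
      by (simp add: lborel_distr_plus)
    also have "\<dots> = (\<integral>\<^sup>+z. ennreal (norm (indicator S (x + z) * (\<phi> (x + z) - \<phi> x))) \<partial>lborel)"
      by (subst nn_integral_distr) auto
    also have "\<dots> \<le> (\<integral>\<^sup>+z. indicator Q z * ennreal \<bar>\<phi> (x + z) - \<phi> x\<bar> \<partial>lborel)"
    proof (rule nn_integral_mono)
      fix z
      have "z \<in> Q" if "x + z \<in> S"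
      proof -
        have "\<lfloor>c * (x $ i + z $ i)\<rfloor> = \<lfloor>c * x $ i\<rfloor>" for i
          using that by (auto simp: S_def grid_cell_def grid_index_def fun_eq_iff)
        then have "\<bar>c * (x $ i + z $ i) - c * x $ i\<bar> \<le> 1" for i
          using floor_correct[of "c * (x $ i + z $ i)"] floor_correct[of "c * x $ i"] by (simp only: abs_le_iff) linarith
        then have "\<bar>c * z $ i\<bar> \<le> 1" for i by (simp add: distrib_left)
        then have "c * \<bar>z $ i\<bar> \<le> 1" for i using c by (simp add: abs_mult)
        then have "\<bar>z $ i\<bar> \<le> 1 / c" for i using c by (simp add: field_simps)
        then show ?thesis by (auto simp: Q_def a1_def mem_box_cart abs_le_iff minus_le_iff)
      qed
      then show "ennreal (norm (indicator S (x + z) * (\<phi> (x + z) - \<phi> x))) \<le> indicator Q z * ennreal \<bar>\<phi> (x + z) - \<phi> x\<bar>"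
        by (cases "x + z \<in> S") auto
    qed
    finally show ?thesis by - (erule meta_mp, rule mult_left_mono, assumption, simp)
  qed
  have "(\<integral>\<^sup>+x. ennreal \<bar>cell_average c \<phi> x - \<phi> x\<bar> \<partial>lborel)
     \<le> (\<integral>\<^sup>+x. ennreal (c ^ CARD('n)) * (\<integral>\<^sup>+z. indicator Q z * ennreal \<bar>\<phi> (x + z) - \<phi> x\<bar> \<partial>lborel) \<partial>lborel)"
    by (intro nn_integral_mono diff)
  also have "\<dots> = ennreal (c ^ CARD('n)) * (\<integral>\<^sup>+x. (\<integral>\<^sup>+z. indicator Q z * ennreal \<bar>\<phi> (x + z) - \<phi> x\<bar> \<partial>lborel) \<partial>lborel)"
    by (subst nn_integral_cmult) measurable
  also have "(\<integral>\<^sup>+x. (\<integral>\<^sup>+z. indicator Q z * ennreal \<bar>\<phi> (x + z) - \<phi> x\<bar> \<partial>lborel) \<partial>lborel)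
      = (\<integral>\<^sup>+z. (\<integral>\<^sup>+x. indicator Q z * ennreal \<bar>\<phi> (x + z) - \<phi> x\<bar> \<partial>lborel) \<partial>lborel)"
    by (subst lborel_pair.Fubini') (auto simp: split_beta')
  also have "\<dots> \<le> (\<integral>\<^sup>+z. indicator Q z * ennreal (real CARD('n) * K / c) \<partial>lborel)"
  proof (rule nn_integral_mono)
    fix z :: "real^'n"
    show "(\<integral>\<^sup>+x. indicator Q z * ennreal \<bar>\<phi> (x + z) - \<phi> x\<bar> \<partial>lborel) \<le> indicator Q z * ennreal (real CARD('n) * K / c)"
    proof (cases "z \<in> Q")
      case True
      have zi: "\<bar>z $ i\<bar> \<le> 1 / c" for i using True by (auto simp: Q_def a1_def mem_box_cart abs_le_iff minus_le_iff)
      have "(\<integral>\<^sup>+x. ennreal \<bar>\<phi> (x + z) - \<phi> x\<bar> \<partial>lborel) = ennreal (shift_L1 \<phi> z)"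
        unfolding shift_L1_def using integrable_shift[OF \<phi>] test_function_integrable[OF \<phi>]
        by (intro nn_integral_eq_integral) auto
      also have "shift_L1 \<phi> z \<le> (\<Sum>i\<in>UNIV. \<bar>z $ i\<bar> * (\<integral>x. \<bar>pderiv_at i \<phi> x\<bar> \<partial>lborel))" by (rule shift_L1_le[OF \<phi>])
      also have "\<dots> \<le> (\<Sum>i\<in>(UNIV :: 'n set). 1 / c * K)" using zi K c by (intro sum_mono mult_mono) auto
      also have "\<dots> = real CARD('n) * K / c" by simp
      finally show ?thesis using True by (simp add: ennreal_leI)
    qed simp
  qed
  also have "\<dots> = emeasure lborel Q * ennreal (real CARD('n) * K / c)"
    by (simp add: nn_integral_multc)
  also have "ennreal (c ^ CARD('n)) * (emeasure lborel Q * ennreal (real CARD('n) * K / c))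
     = ennreal (c ^ CARD('n) * ((2 / c) ^ CARD('n) * (real CARD('n) * K / c)))"
  proof -
    have "ennreal a * (ennreal b * ennreal d) = ennreal (a * (b * d))" if "0 \<le> a" "0 \<le> b" "0 \<le> d" for a b d
      using that by (simp add: ennreal_mult)
    then show ?thesis unfolding Qm using c K0 by simp
  qed
  also have "c ^ CARD('n) * ((2 / c) ^ CARD('n) * (real CARD('n) * K / c)) = 2 ^ CARD('n) * (real CARD('n) * K / c)"
    using c by (simp add: power_divide)
  finally show ?thesis by - (erule meta_mp, rule mult_left_mono, assumption, simp)
qed

lemma cell_average_L1_close:
  fixes \<phi> :: "real^'n::finite \<Rightarrow> real"
  assumes \<phi>: "\<phi> \<in> test_functions \<Omega>" and c: "0 < c"
    and K: "\<And>i. (\<integral>x. \<bar>pderiv_at i \<phi> x\<bar> \<partial>lborel) \<le> K"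
  shows "integrable lborel (\<lambda>x. cell_average c \<phi> x - \<phi> x)"
    "(\<integral>x. \<bar>cell_average c \<phi> x - \<phi> x\<bar> \<partial>lborel) \<le> 2 ^ CARD('n) * (real CARD('n) * K / c)"
proof -
  note [measurable] = test_function_borel[OF \<phi>]
  have le: "(\<integral>\<^sup>+x. ennreal (norm (cell_average c \<phi> x - \<phi> x)) \<partial>lborel) \<le> ennreal (2 ^ CARD('n) * (real CARD('n) * K / c))"
    using nn_integral_cell_average_close[OF assms] by simp
  show i: "integrable lborel (\<lambda>x. cell_average c \<phi> x - \<phi> x)"
    by (rule integrableI_bounded) (use le in \<open>auto intro: order_le_less_trans\<close>)
  have K0: "0 \<le> K" by (rule order_trans[OF _ K[of undefined]]) simp
  have "ennreal (\<integral>x. \<bar>cell_average c \<phi> x - \<phi> x\<bar> \<partial>lborel) \<le> ennreal (2 ^ CARD('n) * (real CARD('n) * K / c))"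
    using le i by (subst nn_integral_eq_integral[symmetric]) auto
  then show "(\<integral>x. \<bar>cell_average c \<phi> x - \<phi> x\<bar> \<partial>lborel) \<le> 2 ^ CARD('n) * (real CARD('n) * K / c)"
    using K0 c by (subst (asm) ennreal_le_iff) auto
qed

text \<open>On a fixed grid, convergence of the countably many cell integrals is pointwise convergence of the cell averages,
and these are uniformly bounded.\<close>

lemma Cauchy_cell_average_L1:
  fixes \<phi> :: "nat \<Rightarrow> real^'n::finite \<Rightarrow> real"
  assumes \<Omega>: "bounded \<Omega>" "open \<Omega>" and \<phi>: "\<And>m. integrable lborel (\<phi> m)"
    and K: "\<And>m. (\<integral>x. \<bar>\<phi> m x\<bar> \<partial>lborel) \<le> K" and c: "0 < c"
    and conv: "\<And>\<nu>. convergent (\<lambda>m. cell_integral c (\<phi> m) \<nu>)" and e: "0 < e"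
  shows "\<exists>N. \<forall>m\<ge>N. \<forall>n\<ge>N. (\<integral>x. indicator \<Omega> x * \<bar>cell_average c (\<phi> m) x - cell_average c (\<phi> n) x\<bar> \<partial>lborel) < e"
proof -
  have [measurable]: "\<Omega> \<in> sets borel" using \<Omega> by simp
  obtain l where l: "\<And>\<nu>. (\<lambda>m. cell_integral c (\<phi> m) \<nu>) \<longlonglongrightarrow> l \<nu>" using conv unfolding convergent_def by metis
  define L where "L x = c ^ CARD('n) * l (grid_index c x)" for x :: "real^'n"
  have Lm [measurable]: "L \<in> borel_measurable borel"
    unfolding L_def using grid_index_measurable[of "\<lambda>\<nu>. c ^ CARD('n) * l \<nu>" c] .
  have cL: "(\<lambda>m. cell_average c (\<phi> m) x) \<longlonglongrightarrow> L x" for x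
    unfolding cell_average_def L_def by (intro tendsto_intros l)
  define b where "b = c ^ CARD('n) * K"
  have ab: "\<bar>cell_average c (\<phi> m) x\<bar> \<le> b" for m x
    unfolding cell_average_def b_def abs_mult
    using order_trans[OF cell_integral_bound[OF \<phi>[of m], of c "grid_index c x"] K[of m]] c
    by (simp add: mult_left_mono)
  have Lb: "\<bar>L x\<bar> \<le> b" for x
    using tendsto_rabs[OF cL[of x]] by (rule LIMSEQ_le_const2) (use ab in auto)
  have fin: "emeasure lborel \<Omega> < \<infinity>" by (rule emeasure_bounded_finite[OF \<Omega>(1)])
  have i\<Omega>: "integrable lborel (\<lambda>x. indicator \<Omega> x * (2 * b))"
    using fin by (intro integrable_mult_left integrable_real_indicator) auto
  have bnd: "\<bar>indicator \<Omega> x * \<bar>cell_average c (\<phi> m) x - L x\<bar>\<bar> \<le> indicator \<Omega> x * (2 * b)" for m x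
    using ab[of m x] Lb[of x] by (cases "x \<in> \<Omega>") auto
  have i: "integrable lborel (\<lambda>x. indicator \<Omega> x * \<bar>cell_average c (\<phi> m) x - L x\<bar>)" for m
  proof (rule Bochner_Integration.integrable_bound[OF i\<Omega>])
    show "AE x in lborel. norm (indicator \<Omega> x * \<bar>cell_average c (\<phi> m) x - L x\<bar>) \<le> norm (indicator \<Omega> x * (2 * b))"
      using bnd[of _ m] by (intro AE_I2) (auto intro: order_trans[OF _ abs_ge_self])
  qed measurable
  have "(\<lambda>m. \<integral>x. indicator \<Omega> x * \<bar>cell_average c (\<phi> m) x - L x\<bar> \<partial>lborel) \<longlonglongrightarrow> (\<integral>x. 0 \<partial>(lborel :: (real^'n) measure))"
  proof (rule integral_dominated_convergence[OF _ _ i\<Omega>])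
    show "AE x in lborel. (\<lambda>m. indicator \<Omega> x * \<bar>cell_average c (\<phi> m) x - L x\<bar>) \<longlonglongrightarrow> 0"
    proof (rule AE_I2)
      fix x
      have "(\<lambda>m. indicator \<Omega> x * \<bar>cell_average c (\<phi> m) x - L x\<bar>) \<longlonglongrightarrow> indicator \<Omega> x * \<bar>L x - L x\<bar>"
        by (intro tendsto_intros cL)
      then show "(\<lambda>m. indicator \<Omega> x * \<bar>cell_average c (\<phi> m) x - L x\<bar>) \<longlonglongrightarrow> 0" by simp
    qed
    show "AE x in lborel. norm (indicator \<Omega> x * \<bar>cell_average c (\<phi> m) x - L x\<bar>) \<le> indicator \<Omega> x * (2 * b)" for m
      using bnd[of _ m] by (intro AE_I2) simp
  qed measurable
  then have "\<forall>\<^sub>F m in sequentially. (\<integral>x. indicator \<Omega> x * \<bar>cell_average c (\<phi> m) x - L x\<bar> \<partial>lborel) < e / 2"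
    by (rule order_tendstoD) (use e in simp)
  then obtain N where N: "\<And>m. m \<ge> N \<Longrightarrow> (\<integral>x. indicator \<Omega> x * \<bar>cell_average c (\<phi> m) x - L x\<bar> \<partial>lborel) < e / 2"
    by (auto simp: eventually_sequentially)
  have "(\<integral>x. indicator \<Omega> x * \<bar>cell_average c (\<phi> m) x - cell_average c (\<phi> n) x\<bar> \<partial>lborel) < e" if "m \<ge> N" "n \<ge> N" for m n
  proof -
    have pw: "indicator \<Omega> x * \<bar>cell_average c (\<phi> m) x - cell_average c (\<phi> n) x\<bar>
       \<le> indicator \<Omega> x * \<bar>cell_average c (\<phi> m) x - L x\<bar> + indicator \<Omega> x * \<bar>cell_average c (\<phi> n) x - L x\<bar>" for x
      by (cases "x \<in> \<Omega>") auto
    have "(\<integral>x. indicator \<Omega> x * \<bar>cell_average c (\<phi> m) x - cell_average c (\<phi> n) x\<bar> \<partial>lborel)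
      \<le> (\<integral>x. indicator \<Omega> x * \<bar>cell_average c (\<phi> m) x - L x\<bar> + indicator \<Omega> x * \<bar>cell_average c (\<phi> n) x - L x\<bar> \<partial>lborel)"
    proof (rule integral_mono[OF _ _ pw])
      show "integrable lborel (\<lambda>x. indicator \<Omega> x * \<bar>cell_average c (\<phi> m) x - L x\<bar> + indicator \<Omega> x * \<bar>cell_average c (\<phi> n) x - L x\<bar>)"
        by (intro Bochner_Integration.integrable_add i)
      then show "integrable lborel (\<lambda>x. indicator \<Omega> x * \<bar>cell_average c (\<phi> m) x - cell_average c (\<phi> n) x\<bar>)"
      proof (rule Bochner_Integration.integrable_bound)
        show "AE x in lborel. norm (indicator \<Omega> x * \<bar>cell_average c (\<phi> m) x - cell_average c (\<phi> n) x\<bar>)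
          \<le> norm (indicator \<Omega> x * \<bar>cell_average c (\<phi> m) x - L x\<bar> + indicator \<Omega> x * \<bar>cell_average c (\<phi> n) x - L x\<bar>)"
        proof (rule AE_I2)
          fix x
          show "norm (indicator \<Omega> x * \<bar>cell_average c (\<phi> m) x - cell_average c (\<phi> n) x\<bar>)
          \<le> norm (indicator \<Omega> x * \<bar>cell_average c (\<phi> m) x - L x\<bar> + indicator \<Omega> x * \<bar>cell_average c (\<phi> n) x - L x\<bar>)"
            by (cases "x \<in> \<Omega>") auto
        qed
      qed measurable
    qed
    also have "\<dots> = (\<integral>x. indicator \<Omega> x * \<bar>cell_average c (\<phi> m) x - L x\<bar> \<partial>lborel) + (\<integral>x. indicator \<Omega> x * \<bar>cell_average c (\<phi> n) x - L x\<bar> \<partial>lborel)"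
      by (rule Bochner_Integration.integral_add[OF i i])
    also have "\<dots> < e" using N[OF that(1)] N[OF that(2)] by linarith
    finally show ?thesis .
  qed
  then show ?thesis by blast
qed

text \<open>A diagonal sequence makes the integrals over all cells of all grids converge. Cell averages on a fine grid are
close to the functions uniformly in \<open>m\<close>, and on that grid they form a Cauchy sequence.\<close>

proposition rellich:
  fixes \<phi> :: "nat \<Rightarrow> real^'n::finite \<Rightarrow> real"
  assumes \<Omega>: "bounded \<Omega>" "open \<Omega>" and \<phi>: "\<And>m. \<phi> m \<in> test_functions \<Omega>"
    and K: "\<And>m. (\<integral>x. \<bar>\<phi> m x\<bar> \<partial>lborel) \<le> K" "\<And>m i. (\<integral>x. \<bar>pderiv_at i (\<phi> m) x\<bar> \<partial>lborel) \<le> K"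
  obtains k where "strict_mono (k :: nat \<Rightarrow> nat)"
    "\<And>e. 0 < e \<Longrightarrow> \<exists>N. \<forall>m\<ge>N. \<forall>n\<ge>N. (\<integral>x. \<bar>\<phi> (k m) x - \<phi> (k n) x\<bar> \<partial>lborel) < e"
proof -
  note \<phi>i = test_function_integrable[OF \<phi>]
  have K0: "0 \<le> K" by (rule order_trans[OF _ K(1)[of 0]]) simp
  have "norm (cell_integral (real (Suc l)) (\<phi> m) \<nu>) \<le> K" for m l \<nu>
    using order_trans[OF cell_integral_bound[OF \<phi>i[of m]] K(1)[of m]] by simp
  then have bnd: "norm (case z of (l, \<nu>) \<Rightarrow> cell_integral (real (Suc l)) (\<phi> m) \<nu>) \<le> K" for m z
    by (cases z) (simp del: of_nat_Suc)
  obtain k where k: "strict_mono (k::nat\<Rightarrow>nat)"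
    and kl: "\<And>z. z \<in> UNIV \<Longrightarrow> \<exists>l. (\<lambda>m. (case z of (l, \<nu>) \<Rightarrow> cell_integral (real (Suc l)) (\<phi> (k m)) \<nu>)) \<longlonglongrightarrow> l"
    using function_convergent_subsequence[of "UNIV :: (nat \<times> ('n \<Rightarrow> int)) set"
        "\<lambda>m (l, \<nu>). cell_integral (real (Suc l)) (\<phi> m) \<nu>" K, OF countableI_type bnd] by blast
  show thesis
  proof (rule that[OF k])
    fix e :: real assume e: "0 < e"
    define A where "A = 2 ^ CARD('n) * (real CARD('n) * K)"
    have A0: "0 \<le> A" using K0 by (simp add: A_def)
    obtain l :: nat where l: "A * 3 / e < real l" using reals_Archimedean2 by blast
    define c where "c = real (Suc l)"
    have c: "0 < c" "A / c < e / 3"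
    proof -
      show "0 < c" by (simp add: c_def)
      have "A * 3 / e < c" using l by (simp add: c_def)
      then show "A / c < e / 3" using e \<open>0 < c\<close> by (simp add: field_simps)
    qed
    have conv: "convergent (\<lambda>m. cell_integral c (\<phi> (k m)) \<nu>)" for \<nu>
      using kl[of "(l, \<nu>)"] by (auto simp: convergent_def c_def)
    obtain N where N: "\<And>m n. m \<ge> N \<Longrightarrow> n \<ge> N \<Longrightarrow>
       (\<integral>x. indicator \<Omega> x * \<bar>cell_average c (\<phi> (k m)) x - cell_average c (\<phi> (k n)) x\<bar> \<partial>lborel) < e / 3"
      using Cauchy_cell_average_L1[OF \<Omega> \<phi>i K(1) c(1) conv, of "e / 3"] e by auto
    note ca = cell_average_L1_close[OF \<phi> c(1) K(2)]
    have ca2: "(\<integral>x. \<bar>cell_average c (\<phi> m) x - \<phi> m x\<bar> \<partial>lborel) < e / 3" for m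
    proof -
      have "2 ^ CARD('n) * (real CARD('n) * K / c) = A / c" by (simp add: A_def)
      then show ?thesis using ca(2)[of m] c(2) by linarith
    qed
    have [measurable]: "\<Omega> \<in> sets borel" using \<Omega> by simp
    have "(\<integral>x. \<bar>\<phi> (k m) x - \<phi> (k n) x\<bar> \<partial>lborel) < e" if mn: "m \<ge> N" "n \<ge> N" for m n
    proof -
      have pw: "\<bar>\<phi> (k m) x - \<phi> (k n) x\<bar> \<le> \<bar>cell_average c (\<phi> (k m)) x - \<phi> (k m) x\<bar>
         + indicator \<Omega> x * \<bar>cell_average c (\<phi> (k m)) x - cell_average c (\<phi> (k n)) x\<bar>
         + \<bar>cell_average c (\<phi> (k n)) x - \<phi> (k n) x\<bar>" for x
        using test_function_0[OF \<phi>, of x] by (cases "x \<in> \<Omega>") auto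
      have i1: "integrable lborel (\<lambda>x. \<bar>cell_average c (\<phi> m) x - \<phi> m x\<bar>)" for m using ca(1)[of m] by simp
      have i2: "integrable lborel (\<lambda>x. indicator \<Omega> x * \<bar>cell_average c (\<phi> (k m)) x - cell_average c (\<phi> (k n)) x\<bar>)"
      proof -
        have "integrable lborel (\<lambda>x. (cell_average c (\<phi> (k m)) x - \<phi> (k m) x) - (cell_average c (\<phi> (k n)) x - \<phi> (k n) x) + \<phi> (k m) x - \<phi> (k n) x)"
          by (intro Bochner_Integration.integrable_add Bochner_Integration.integrable_diff ca(1) \<phi>i)
        then have "integrable lborel (\<lambda>x. cell_average c (\<phi> (k m)) x - cell_average c (\<phi> (k n)) x)" by simp
        then have "integrable lborel (\<lambda>x. indicator \<Omega> x *\<^sub>R \<bar>cell_average c (\<phi> (k m)) x - cell_average c (\<phi> (k n)) x\<bar>)"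
          by (intro integrable_mult_indicator integrable_abs) auto
        then show ?thesis by simp
      qed
      have "(\<integral>x. \<bar>\<phi> (k m) x - \<phi> (k n) x\<bar> \<partial>lborel) \<le> (\<integral>x. \<bar>cell_average c (\<phi> (k m)) x - \<phi> (k m) x\<bar>
         + indicator \<Omega> x * \<bar>cell_average c (\<phi> (k m)) x - cell_average c (\<phi> (k n)) x\<bar>
         + \<bar>cell_average c (\<phi> (k n)) x - \<phi> (k n) x\<bar> \<partial>lborel)"
        using \<phi>i by (intro integral_mono[OF _ _ pw] Bochner_Integration.integrable_add i1 i2 integrable_abs Bochner_Integration.integrable_diff)
      also have "\<dots> = (\<integral>x. \<bar>cell_average c (\<phi> (k m)) x - \<phi> (k m) x\<bar> \<partial>lborel)
         + (\<integral>x. indicator \<Omega> x * \<bar>cell_average c (\<phi> (k m)) x - cell_average c (\<phi> (k n)) x\<bar> \<partial>lborel)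
         + (\<integral>x. \<bar>cell_average c (\<phi> (k n)) x - \<phi> (k n) x\<bar> \<partial>lborel)"
        by (simp only: Bochner_Integration.integral_add[OF Bochner_Integration.integrable_add[OF i1 i2] i1]
            Bochner_Integration.integral_add[OF i1 i2])
      also have "\<dots> < e" using N[OF mn] ca2[of "k m"] ca2[of "k n"] by linarith
      finally show ?thesis .
    qed
    then show "\<exists>N. \<forall>m\<ge>N. \<forall>n\<ge>N. (\<integral>x. \<bar>\<phi> (k m) x - \<phi> (k n) x\<bar> \<partial>lborel) < e" by blast
  qed
qed

section \<open>A countable dense family of test functions\<close>

text \<open>A function together with its partial derivatives; the index \<open>None\<close> stands for the function itself.\<close>

definition jet :: "(real^'n::finite \<Rightarrow> real) \<Rightarrow> 'n option \<Rightarrow> real^'n \<Rightarrow> real" where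
  "jet \<phi> j = (case j of None \<Rightarrow> \<phi> | Some i \<Rightarrow> pderiv_at i \<phi>)"

lemma jet_simps [simp]: "jet \<phi> None = \<phi>" "jet \<phi> (Some i) = pderiv_at i \<phi>"
  by (simp_all add: jet_def)

lemma test_function_jet: "\<phi> \<in> test_functions \<Omega> \<Longrightarrow> jet \<phi> j \<in> test_functions \<Omega>"
  by (cases j) (auto intro: test_function_pderiv_at)

lemma zero_test_function: "(\<lambda>x. 0) \<in> test_functions \<Omega>"
  by (simp add: test_functions_def smooth_const)

text \<open>Equicontinuity turns pointwise convergence on a countable dense set into pointwise convergence everywhere, and
the common bound makes dominated convergence available. Every test function lies in one of these countably
many classes.\<close>

definition lipschitz_class :: "(real^'n::finite) set \<Rightarrow> nat \<Rightarrow> (real^'n \<Rightarrow> real) set" where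
  "lipschitz_class \<Omega> N = {\<phi> \<in> test_functions \<Omega>. \<forall>j. (\<forall>x. \<bar>jet \<phi> j x\<bar> \<le> real N) \<and>
      (\<forall>x y. \<bar>jet \<phi> j x - jet \<phi> j y\<bar> \<le> real N * norm (x - y))}"

lemma test_function_in_lipschitz_class:
  assumes "\<phi> \<in> test_functions \<Omega>"
  obtains N where "\<phi> \<in> lipschitz_class \<Omega> N"
proof -
  have "\<forall>j. \<exists>C. (\<forall>x. \<bar>jet \<phi> j x\<bar> \<le> C) \<and> (\<forall>x y. \<bar>jet \<phi> j x - jet \<phi> j y\<bar> \<le> C * norm (x - y))"
  proof
    fix j
    obtain B where B: "\<And>x. \<bar>jet \<phi> j x\<bar> \<le> B" using test_function_bounded[OF test_function_jet[OF assms]] by blast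
    obtain L where L: "\<And>x y. \<bar>jet \<phi> j x - jet \<phi> j y\<bar> \<le> L * norm (x - y)"
      using test_function_Lipschitz[OF test_function_jet[OF assms]] by blast
    have "\<bar>jet \<phi> j x\<bar> \<le> max B L" for x using B[of x] by simp
    moreover have "\<bar>jet \<phi> j x - jet \<phi> j y\<bar> \<le> max B L * norm (x - y)" for x y
      by (rule order_trans[OF L]) (simp add: mult_right_mono)
    ultimately show "\<exists>C. (\<forall>x. \<bar>jet \<phi> j x\<bar> \<le> C) \<and> (\<forall>x y. \<bar>jet \<phi> j x - jet \<phi> j y\<bar> \<le> C * norm (x - y))" by blast
  qed
  then obtain C where C: "\<And>j x. \<bar>jet \<phi> j x\<bar> \<le> C j" "\<And>j x y. \<bar>jet \<phi> j x - jet \<phi> j y\<bar> \<le> C j * norm (x - y)" by metis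
  obtain N :: nat where N: "Max (range C) \<le> real N" using real_arch_simple by blast
  have CN: "C j \<le> real N" for j by (rule order_trans[OF Max_ge N]) auto
  have "\<bar>jet \<phi> j x\<bar> \<le> real N" for j x using C(1)[of j x] CN[of j] by linarith
  moreover have "\<bar>jet \<phi> j x - jet \<phi> j y\<bar> \<le> real N * norm (x - y)" for j x y
    by (rule order_trans[OF C(2) mult_right_mono[OF CN]]) simp
  ultimately have "\<phi> \<in> lipschitz_class \<Omega> N" using assms by (simp add: lipschitz_class_def)
  then show thesis by (rule that)
qed

text \<open>Record the values of a jet at a dense sequence of points. This embeds the class into a countable product of lines,
which is second countable, so the image has a countable dense subset.\<close>

lemma lipschitz_class_separable:
  obtains D where "countable D" "D \<subseteq> lipschitz_class \<Omega> N"
    "\<And>\<phi>. \<phi> \<in> lipschitz_class \<Omega> N \<Longrightarrow> \<exists>\<psi>. (\<forall>k::nat. \<psi> k \<in> D) \<and> (\<forall>j x. (\<lambda>k. jet (\<psi> k) j x) \<longlonglongrightarrow> jet \<phi> j x)"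
proof -
  obtain X :: "(real^'a) set" where X: "countable X" "\<And>U. open U \<Longrightarrow> U \<noteq> {} \<Longrightarrow> \<exists>d\<in>X. d \<in> U"
    using countable_dense_exists by blast
  have Xne: "X \<noteq> {}" using X(2)[of UNIV] by auto
  define d where "d = from_nat_into X"
  have drange: "range d = X" unfolding d_def using X(1) Xne by (rule range_from_nat_into[rotated])
  define F where "F \<phi> = (\<lambda>(m::nat, j). jet \<phi> j (d m))" for \<phi> :: "real^'a \<Rightarrow> real"
  define S where "S = lipschitz_class \<Omega> N"
  obtain T where T: "countable T" "T \<subseteq> F ` S" "F ` S \<subseteq> closure T" by (rule separable[of "F ` S"])
  define D where "D = inv_into S F ` T"
  have D: "countable D" "D \<subseteq> S" using T by (auto simp: D_def intro: inv_into_into)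
  show thesis
  proof (rule that[of D])
    fix \<phi> assume "\<phi> \<in> lipschitz_class \<Omega> N"
    then have \<phi>: "\<phi> \<in> S" by (simp add: S_def)
    then have "F \<phi> \<in> closure T" using T(3) by blast
    then obtain t where t: "\<And>k. t k \<in> T" "t \<longlonglongrightarrow> F \<phi>" by (auto simp: closure_sequential)
    define \<psi> where "\<psi> k = inv_into S F (t k)" for k
    have \<psi>D: "\<psi> k \<in> D" for k using t(1) by (simp add: \<psi>_def D_def)
    have F\<psi>: "F (\<psi> k) = t k" for k unfolding \<psi>_def by (rule f_inv_into_f[OF subsetD[OF T(2) t(1)]])
    have lim_d: "(\<lambda>k. jet (\<psi> k) j (d m)) \<longlonglongrightarrow> jet \<phi> j (d m)" for m j
    proof -
      have "(\<lambda>k. t k (m, j)) \<longlonglongrightarrow> F \<phi> (m, j)"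
        by (rule continuous_on_tendsto_compose[OF continuous_on_product_coordinates t(2)]) auto
      moreover have "t k (m, j) = jet (\<psi> k) j (d m)" for k unfolding F\<psi>[symmetric] by (simp add: F_def)
      ultimately show ?thesis by (simp add: F_def)
    qed
    have lip: "\<bar>jet \<phi> j x - jet \<phi> j y\<bar> \<le> real N * norm (x - y)" if "\<phi> \<in> S" for \<phi> j x y
      using that by (auto simp: S_def lipschitz_class_def)
    have "(\<lambda>k. jet (\<psi> k) j x) \<longlonglongrightarrow> jet \<phi> j x" for j x
    proof (rule LIMSEQ_I)
      fix e :: real assume e: "0 < e"
      define \<delta> where "\<delta> = e / (3 * (real N + 1))"
      have \<delta>: "0 < \<delta>" using e by (simp add: \<delta>_def)
      obtain y where "y \<in> X" "y \<in> ball x \<delta>" using X(2)[of "ball x \<delta>"] \<delta> by auto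
      then obtain m where m: "norm (x - d m) < \<delta>" using drange by (auto simp: dist_norm)
      have le: "real N * norm (x - d m) \<le> (real N + 1) * \<delta>" using m by (intro mult_mono) auto
      have "c * (e / (3 * c)) = e / 3" if "0 < c" for c :: real using that by simp
      from this[of "real N + 1"] have de: "(real N + 1) * \<delta> = e / 3" unfolding \<delta>_def by simp
      have 3: "real N * norm (x - d m) \<le> e / 3" using le unfolding de .
      obtain K where K: "\<And>k. k \<ge> K \<Longrightarrow> norm (jet (\<psi> k) j (d m) - jet \<phi> j (d m)) < e / 3"
        using LIMSEQ_D[OF lim_d, of "e / 3" j m] e by auto
      have "norm (jet (\<psi> k) j x - jet \<phi> j x) < e" if "k \<ge> K" for k
      proof -
        have "\<psi> k \<in> S" using \<psi>D D(2) by blast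
        from lip[OF this, of j x "d m"] lip[OF \<phi>, of j x "d m"] 3 K[OF that]
        show ?thesis unfolding real_norm_def by linarith
      qed
      then show "\<exists>K. \<forall>k\<ge>K. norm (jet (\<psi> k) j x - jet \<phi> j x) < e" by blast
    qed
    then show "\<exists>\<psi>. (\<forall>k::nat. \<psi> k \<in> D) \<and> (\<forall>j x. (\<lambda>k. jet (\<psi> k) j x) \<longlonglongrightarrow> jet \<phi> j x)" using \<psi>D by blast
  qed (use D in \<open>auto simp: S_def\<close>)
qed

proposition test_functions_separable:
  "\<exists>\<phi> :: nat \<Rightarrow> real^'n::finite \<Rightarrow> real. (\<forall>i. \<phi> i \<in> test_functions \<Omega>) \<and>
    (\<forall>\<psi>\<in>test_functions \<Omega>. \<exists>n B. (\<forall>k j x. \<bar>jet (\<phi> (n k)) j x\<bar> \<le> B) \<and>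
        (\<forall>j x. (\<lambda>k::nat. jet (\<phi> (n k)) j x) \<longlonglongrightarrow> jet \<psi> j x))"
proof -
  define good where "good N D \<longleftrightarrow> countable D \<and> D \<subseteq> lipschitz_class \<Omega> N \<and>
    (\<forall>\<phi>\<in>lipschitz_class \<Omega> N. \<exists>\<psi>. (\<forall>k::nat. \<psi> k \<in> D) \<and> (\<forall>j x. (\<lambda>k. jet (\<psi> k) j x) \<longlonglongrightarrow> jet \<phi> j x))" for N D
  have "\<exists>D. good N D" for N
    by (rule lipschitz_class_separable[of \<Omega> N]) (auto simp: good_def)
  then obtain D where D: "\<And>N. good N (D N)" by metis
  define E where "E = insert (\<lambda>x. 0) (\<Union>N. D N)"
  have E: "countable E" "E \<noteq> {}" using D by (auto simp: E_def good_def)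
  define \<phi> where "\<phi> = from_nat_into E"
  have range: "range \<phi> = E" unfolding \<phi>_def using E by (intro range_from_nat_into)
  have ET: "E \<subseteq> test_functions \<Omega>"
    using D zero_test_function by (auto simp: E_def good_def lipschitz_class_def)
  show ?thesis
  proof (intro exI[of _ \<phi>] conjI allI ballI)
    show "\<phi> i \<in> test_functions \<Omega>" for i using range ET by blast
    fix \<psi> assume "\<psi> \<in> test_functions \<Omega>"
    then obtain N where "\<psi> \<in> lipschitz_class \<Omega> N" by (rule test_function_in_lipschitz_class)
    then have "\<exists>\<theta>. (\<forall>k::nat. \<theta> k \<in> D N) \<and> (\<forall>j x. (\<lambda>k. jet (\<theta> k) j x) \<longlonglongrightarrow> jet \<psi> j x)"
      using D[of N] unfolding good_def by blast
    then obtain \<theta> where \<theta>: "\<And>k::nat. \<theta> k \<in> D N" "\<And>j x. (\<lambda>k. jet (\<theta> k) j x) \<longlonglongrightarrow> jet \<psi> j x"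
      by blast
    have "\<theta> k \<in> range \<phi>" for k using \<theta>(1)[of k] by (auto simp: range E_def)
    then have "\<forall>k. \<exists>i. \<theta> k = \<phi> i" by blast
    then obtain n where n: "\<And>k. \<theta> k = \<phi> (n k)" by metis
    have "\<bar>jet (\<theta> k) j x\<bar> \<le> real N" for k j x
      using \<theta>(1)[of k] D[of N] by (auto simp: good_def lipschitz_class_def)
    then show "\<exists>n B. (\<forall>k j x. \<bar>jet (\<phi> (n k)) j x\<bar> \<le> B) \<and>
        (\<forall>j x. (\<lambda>k::nat. jet (\<phi> (n k)) j x) \<longlonglongrightarrow> jet \<psi> j x)"
      using \<theta>(2) unfolding n by blast
  qed
qed

section \<open>Sobolev functions as limits of test functions\<close>

definition expo :: "('n::finite \<Rightarrow> real^'n \<Rightarrow> real) \<Rightarrow> 'n option \<Rightarrow> real^'n \<Rightarrow> real" where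
  "expo p j = (case j of None \<Rightarrow> p_Max p | Some i \<Rightarrow> p i)"

definition weak_jet :: "(real^'n::finite) set \<Rightarrow> (real^'n \<Rightarrow> real) \<Rightarrow> 'n option \<Rightarrow> real^'n \<Rightarrow> real" where
  "weak_jet \<Omega> u j = (case j of None \<Rightarrow> u | Some i \<Rightarrow> weak_pderiv \<Omega> i u)"

lemma expo_simps [simp]: "expo p None = p_Max p" "expo p (Some i) = p i"
  by (simp_all add: expo_def)

lemma weak_jet_simps [simp]: "weak_jet \<Omega> u None = u" "weak_jet \<Omega> u (Some i) = weak_pderiv \<Omega> i u"
  by (simp_all add: weak_jet_def)

lemma sum_option: "(\<Sum>j\<in>(UNIV :: 'n::finite option set). f j) = f None + (\<Sum>i\<in>UNIV. f (Some i))"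
  by (simp add: UNIV_option_conv sum.reindex)

context exponents
begin

lemma energy_cong_AE:
  assumes "\<And>j. U j \<in> borel_measurable M" "\<And>j. V j \<in> borel_measurable M" "\<And>j. AE x in M. U j x = V j x"
  shows "energy U = energy V"
proof -
  have "(\<integral>x. \<bar>U j x\<bar> powr P j x \<partial>M) = (\<integral>x. \<bar>V j x\<bar> powr P j x \<partial>M)" for j
  proof (rule integral_cong_AE)
    note [measurable] = assms(1,2)
    show "(\<lambda>x. \<bar>U j x\<bar> powr P j x) \<in> borel_measurable M" "(\<lambda>x. \<bar>V j x\<bar> powr P j x) \<in> borel_measurable M" by measurable
    show "AE x in M. \<bar>U j x\<bar> powr P j x = \<bar>V j x\<bar> powr P j x" using assms(3)[of j] by eventually_elim simp
  qed
  then show ?thesis by (simp add: energy_def)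
qed

lemma finite_energy_cong_AE:
  assumes "finite_energy V" "\<And>j. U j \<in> borel_measurable M" "\<And>j. AE x in M. U j x = V j x"
  shows "finite_energy U"
proof (rule finite_energy_dominated[OF assms(1,2)])
  show "AE x in M. \<bar>U j x\<bar> \<le> \<bar>V j x\<bar>" for j using assms(3)[of j] by eventually_elim simp
qed

end

text \<open>In the theorem \<open>lo\<close> is \<open>p\<^sub>m\<close>, and \<open>hi\<close> is a common bound for the exponents on the compact closure of \<open>\<Omega>\<close>.\<close>

locale anisotropic_domain =
  fixes \<Omega> :: "(real^'n::finite) set" and p :: "'n \<Rightarrow> real^'n \<Rightarrow> real" and lo hi :: real
  assumes \<Omega>_open: "open \<Omega>" and \<Omega>_bounded: "bounded \<Omega>"
    and p_measurable: "p i \<in> borel_measurable (lebesgue_on \<Omega>)"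
    and lo: "1 < lo" and p_bounds: "x \<in> \<Omega> \<Longrightarrow> lo \<le> p i x \<and> p i x \<le> hi"
begin

lemma p_Max_in: "\<exists>i. p_Max p x = p i x"
proof -
  have "p_Max p x \<in> range (\<lambda>i. p i x)" unfolding p_Max_def by (rule Max_in) auto
  then show ?thesis by auto
qed

lemma expo_measurable: "expo p j \<in> borel_measurable (lebesgue_on \<Omega>)"
proof (cases j)
  case None
  have "(\<lambda>x. Max ((\<lambda>i. p i x) ` UNIV)) \<in> borel_measurable (lebesgue_on \<Omega>)"
    by (rule borel_measurable_Max) (auto intro: p_measurable)
  then show ?thesis using None by (simp add: p_Max_def[abs_def])
qed (auto intro: p_measurable)

lemma expo_bounds: "x \<in> \<Omega> \<Longrightarrow> lo \<le> expo p j x \<and> expo p j x \<le> hi"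
  using p_bounds p_Max_in[of x] by (cases j) force+

end

sublocale anisotropic_domain \<subseteq> exponents "lebesgue_on \<Omega>" "expo p" lo hi
proof -
  have "\<Omega> \<in> lmeasurable" using \<Omega>_open \<Omega>_bounded by (intro bounded_set_imp_lmeasurable) auto
  then interpret finite_measure "lebesgue_on \<Omega>" by (rule finite_measure_lebesgue_on)
  show "exponents (lebesgue_on \<Omega>) (expo p) lo hi"
    by unfold_locales (use expo_measurable lo expo_bounds in auto)
qed

context anisotropic_domain
begin

lemma modular_eq:
  assumes "integrable (lebesgue_on \<Omega>) (\<lambda>x. \<bar>w x\<bar> powr s x)"
  shows "modular \<Omega> s w = ennreal (\<integral>x. \<bar>w x\<bar> powr s x \<partial>lebesgue_on \<Omega>)"
  unfolding modular_def by (rule nn_integral_eq_integral[OF assms]) auto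

lemma Lvar_iff: "w \<in> Lvar \<Omega> (expo p j) \<longleftrightarrow>
    w \<in> borel_measurable (lebesgue_on \<Omega>) \<and> integrable (lebesgue_on \<Omega>) (\<lambda>x. \<bar>w x\<bar> powr expo p j x)"
proof
  assume w: "w \<in> Lvar \<Omega> (expo p j)"
  then have [measurable]: "w \<in> borel_measurable (lebesgue_on \<Omega>)" by (simp add: Lvar_def)
  have "integrable (lebesgue_on \<Omega>) (\<lambda>x. \<bar>w x\<bar> powr expo p j x)"
  proof (rule integrableI_bounded)
    show "(\<integral>\<^sup>+x. ennreal (norm (\<bar>w x\<bar> powr expo p j x)) \<partial>lebesgue_on \<Omega>) < \<infinity>"
      using w by (simp add: Lvar_def modular_def)
  qed measurable
  then show "w \<in> borel_measurable (lebesgue_on \<Omega>) \<and> integrable (lebesgue_on \<Omega>) (\<lambda>x. \<bar>w x\<bar> powr expo p j x)" by simp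
next
  assume "w \<in> borel_measurable (lebesgue_on \<Omega>) \<and> integrable (lebesgue_on \<Omega>) (\<lambda>x. \<bar>w x\<bar> powr expo p j x)"
  then show "w \<in> Lvar \<Omega> (expo p j)" by (simp add: Lvar_def modular_eq)
qed

text \<open>Comparison of the modular with its rescalings. These inequalities replace homogeneity, which holds only for
constant exponents, in the comparison of Luxemburg norms with modulars.\<close>

lemma modular_scale:
  assumes w: "w \<in> borel_measurable (lebesgue_on \<Omega>)" "integrable (lebesgue_on \<Omega>) (\<lambda>x. \<bar>w x\<bar> powr expo p j x)" and l: "0 < l"
  shows "integrable (lebesgue_on \<Omega>) (\<lambda>x. \<bar>w x / l\<bar> powr expo p j x)"
    and "l \<le> 1 \<Longrightarrow> (\<integral>x. \<bar>w x\<bar> powr expo p j x \<partial>lebesgue_on \<Omega>) \<le> l * (\<integral>x. \<bar>w x / l\<bar> powr expo p j x \<partial>lebesgue_on \<Omega>)"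
    and "l \<le> 1 \<Longrightarrow> (\<integral>x. \<bar>w x / l\<bar> powr expo p j x \<partial>lebesgue_on \<Omega>) \<le> (\<integral>x. \<bar>w x\<bar> powr expo p j x \<partial>lebesgue_on \<Omega>) / l powr hi"
    and "1 \<le> l \<Longrightarrow> (\<integral>x. \<bar>w x / l\<bar> powr expo p j x \<partial>lebesgue_on \<Omega>) \<le> (\<integral>x. \<bar>w x\<bar> powr expo p j x \<partial>lebesgue_on \<Omega>) / l"
proof -
  have eq: "\<bar>w x / l\<bar> powr expo p j x = \<bar>w x\<bar> powr expo p j x / l powr expo p j x" for x
    using l by (simp add: powr_divide)
  have [measurable]: "w \<in> borel_measurable (lebesgue_on \<Omega>)" by (rule w)
  have lb: "min 1 l powr hi \<le> l powr expo p j x" if "x \<in> \<Omega>" for x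
  proof -
    have "min 1 l powr hi \<le> min 1 l powr expo p j x"
      using l expo_bounds[OF that, of j] by (intro powr_mono') auto
    also have "\<dots> \<le> l powr expo p j x" using l expo_bounds[OF that, of j] lo by (intro powr_mono2) auto
    finally show ?thesis .
  qed
  show i: "integrable (lebesgue_on \<Omega>) (\<lambda>x. \<bar>w x / l\<bar> powr expo p j x)"
  proof (rule Bochner_Integration.integrable_bound)
    show "integrable (lebesgue_on \<Omega>) (\<lambda>x. \<bar>w x\<bar> powr expo p j x / min 1 l powr hi)" using w by simp
    show "AE x in lebesgue_on \<Omega>. norm (\<bar>w x / l\<bar> powr expo p j x) \<le> norm (\<bar>w x\<bar> powr expo p j x / min 1 l powr hi)"
    proof (rule AE_I2)
      fix x assume "x \<in> space (lebesgue_on \<Omega>)"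
      then have "\<bar>w x\<bar> powr expo p j x / l powr expo p j x \<le> \<bar>w x\<bar> powr expo p j x / min 1 l powr hi"
        using l lb[of x] by (intro divide_left_mono) auto
      then show "norm (\<bar>w x / l\<bar> powr expo p j x) \<le> norm (\<bar>w x\<bar> powr expo p j x / min 1 l powr hi)"
        unfolding eq by simp
    qed
  qed measurable
  show "(\<integral>x. \<bar>w x\<bar> powr expo p j x \<partial>lebesgue_on \<Omega>) \<le> l * (\<integral>x. \<bar>w x / l\<bar> powr expo p j x \<partial>lebesgue_on \<Omega>)" if "l \<le> 1"
  proof -
    have "(\<integral>x. \<bar>w x\<bar> powr expo p j x \<partial>lebesgue_on \<Omega>) \<le> (\<integral>x. l * \<bar>w x / l\<bar> powr expo p j x \<partial>lebesgue_on \<Omega>)"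
    proof (rule integral_mono[OF w(2)])
      fix x assume "x \<in> space (lebesgue_on \<Omega>)"
      then have "l powr expo p j x \<le> l powr 1" using that l lo expo_bounds[of x j] by (intro powr_mono') auto
      then have "1 * \<bar>w x\<bar> powr expo p j x \<le> (l / l powr expo p j x) * \<bar>w x\<bar> powr expo p j x"
        using l by (intro mult_right_mono) auto
      then show "\<bar>w x\<bar> powr expo p j x \<le> l * \<bar>w x / l\<bar> powr expo p j x" unfolding eq by simp
    qed (use i in simp)
    then show ?thesis by simp
  qed
  show "(\<integral>x. \<bar>w x / l\<bar> powr expo p j x \<partial>lebesgue_on \<Omega>) \<le> (\<integral>x. \<bar>w x\<bar> powr expo p j x \<partial>lebesgue_on \<Omega>) / l powr hi" if "l \<le> 1"
  proof -
    have "(\<integral>x. \<bar>w x / l\<bar> powr expo p j x \<partial>lebesgue_on \<Omega>) \<le> (\<integral>x. \<bar>w x\<bar> powr expo p j x / l powr hi \<partial>lebesgue_on \<Omega>)"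
    proof (rule integral_mono[OF i])
      fix x assume "x \<in> space (lebesgue_on \<Omega>)"
      then show "\<bar>w x / l\<bar> powr expo p j x \<le> \<bar>w x\<bar> powr expo p j x / l powr hi"
        unfolding eq using l that lb[of x] by (intro divide_left_mono) (auto simp: min_def split: if_splits)
    qed (use w in simp)
    then show ?thesis by simp
  qed
  show "(\<integral>x. \<bar>w x / l\<bar> powr expo p j x \<partial>lebesgue_on \<Omega>) \<le> (\<integral>x. \<bar>w x\<bar> powr expo p j x \<partial>lebesgue_on \<Omega>) / l" if "1 \<le> l"
  proof -
    have "(\<integral>x. \<bar>w x / l\<bar> powr expo p j x \<partial>lebesgue_on \<Omega>) \<le> (\<integral>x. \<bar>w x\<bar> powr expo p j x / l \<partial>lebesgue_on \<Omega>)"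
    proof (rule integral_mono[OF i])
      fix x assume "x \<in> space (lebesgue_on \<Omega>)"
      then have "l powr 1 \<le> l powr expo p j x" using that l lo expo_bounds[of x j] by (intro powr_mono) auto
      then show "\<bar>w x / l\<bar> powr expo p j x \<le> \<bar>w x\<bar> powr expo p j x / l"
        unfolding eq using l by (intro divide_left_mono) auto
    qed (use w in simp)
    then show ?thesis by simp
  qed
qed

text \<open>The infimum of the empty set is an arbitrary number, so bounds on the Luxemburg norm are meaningful only with
this.\<close>

lemma lux_norm_set_nonempty:
  assumes "w \<in> Lvar \<Omega> (expo p j)"
  shows "{l. l > 0 \<and> modular \<Omega> (expo p j) (\<lambda>x. w x / l) \<le> 1} \<noteq> {}"
proof -
  have w: "w \<in> borel_measurable (lebesgue_on \<Omega>)" "integrable (lebesgue_on \<Omega>) (\<lambda>x. \<bar>w x\<bar> powr expo p j x)"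
    using assms by (auto simp: Lvar_iff)
  define l where "l = max 1 (\<integral>x. \<bar>w x\<bar> powr expo p j x \<partial>lebesgue_on \<Omega>)"
  have l: "1 \<le> l" "0 < l" by (auto simp: l_def)
  have "(\<integral>x. \<bar>w x / l\<bar> powr expo p j x \<partial>lebesgue_on \<Omega>) \<le> (\<integral>x. \<bar>w x\<bar> powr expo p j x \<partial>lebesgue_on \<Omega>) / l"
    by (rule modular_scale(4)[OF w l(2,1)])
  also have "\<dots> \<le> 1" using l by (simp add: divide_le_eq) (simp add: l_def)
  finally have "modular \<Omega> (expo p j) (\<lambda>x. w x / l) \<le> 1"
    by (simp add: modular_eq[OF modular_scale(1)[OF w l(2)]])
  then show ?thesis using l by blast
qed

lemma lux_norm_nonneg: "w \<in> Lvar \<Omega> (expo p j) \<Longrightarrow> 0 \<le> lux_norm \<Omega> (expo p j) w"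
  unfolding lux_norm_def by (rule cInf_greatest[OF lux_norm_set_nonempty]) auto

lemma lux_norm_less_imp_modular:
  assumes w: "w \<in> Lvar \<Omega> (expo p j)" and "lux_norm \<Omega> (expo p j) w < e" "e \<le> 1"
  shows "(\<integral>x. \<bar>w x\<bar> powr expo p j x \<partial>lebesgue_on \<Omega>) < e"
proof -
  have w': "w \<in> borel_measurable (lebesgue_on \<Omega>)" "integrable (lebesgue_on \<Omega>) (\<lambda>x. \<bar>w x\<bar> powr expo p j x)"
    using w by (auto simp: Lvar_iff)
  obtain l where l: "0 < l" "modular \<Omega> (expo p j) (\<lambda>x. w x / l) \<le> 1" "l < e"
    using cInf_lessD[OF lux_norm_set_nonempty[OF w] assms(2)[unfolded lux_norm_def]] by auto
  have "ennreal (\<integral>x. \<bar>w x / l\<bar> powr expo p j x \<partial>lebesgue_on \<Omega>) \<le> ennreal 1"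
    using l(2) by (simp add: modular_eq[OF modular_scale(1)[OF w' l(1)]])
  then have "(\<integral>x. \<bar>w x / l\<bar> powr expo p j x \<partial>lebesgue_on \<Omega>) \<le> 1" by (subst (asm) ennreal_le_iff) auto
  then have "l * (\<integral>x. \<bar>w x / l\<bar> powr expo p j x \<partial>lebesgue_on \<Omega>) \<le> l" using l by (simp add: mult_left_le)
  then show ?thesis using modular_scale(2)[OF w' l(1)] l(3) assms(3) by linarith
qed

lemma lux_norm_le:
  assumes w: "w \<in> Lvar \<Omega> (expo p j)" and e: "0 < e" "e \<le> 1"
    and le: "(\<integral>x. \<bar>w x\<bar> powr expo p j x \<partial>lebesgue_on \<Omega>) \<le> e powr hi"
  shows "lux_norm \<Omega> (expo p j) w \<le> e"
proof -
  have w': "w \<in> borel_measurable (lebesgue_on \<Omega>)" "integrable (lebesgue_on \<Omega>) (\<lambda>x. \<bar>w x\<bar> powr expo p j x)"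
    using w by (auto simp: Lvar_iff)
  have "(\<integral>x. \<bar>w x / e\<bar> powr expo p j x \<partial>lebesgue_on \<Omega>) \<le> (\<integral>x. \<bar>w x\<bar> powr expo p j x \<partial>lebesgue_on \<Omega>) / e powr hi"
    by (rule modular_scale(3)[OF w' e])
  also have "\<dots> \<le> 1" using le e by (simp add: divide_le_eq)
  finally have "modular \<Omega> (expo p j) (\<lambda>x. w x / e) \<le> 1"
    by (simp add: modular_eq[OF modular_scale(1)[OF w' e(1)]])
  then show ?thesis unfolding lux_norm_def
    by (intro cInf_lower bdd_belowI[of _ 0]) (use e in auto)
qed

lemma finite_energy_iff_Lvar: "finite_energy U \<longleftrightarrow> (\<forall>j. U j \<in> Lvar \<Omega> (expo p j))"
  by (simp add: finite_energy_def Lvar_iff)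

lemma W1_norm_eq: "W1_norm \<Omega> p u = (\<Sum>j\<in>UNIV. lux_norm \<Omega> (expo p j) (weak_jet \<Omega> u j))"
  by (simp add: W1_norm_def sum_option)

lemma W1_I:
  assumes "finite_energy U" "\<And>i. has_weak_pderiv \<Omega> i (U None) (U (Some i))"
  shows "U None \<in> W1 \<Omega> p" "AE x in lebesgue_on \<Omega>. weak_jet \<Omega> (U None) j x = U j x" "finite_energy (weak_jet \<Omega> (U None))"
proof -
  show "U None \<in> W1 \<Omega> p"
    using assms finite_energy_iff_Lvar[of U] unfolding W1_def by (auto simp flip: expo_simps)
  show ae: "AE x in lebesgue_on \<Omega>. weak_jet \<Omega> (U None) j x = U j x" for j
    using weak_pderiv_AE(2)[OF \<Omega>_open assms(2)] by (cases j) auto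
  have m: "weak_jet \<Omega> (U None) j \<in> borel_measurable (lebesgue_on \<Omega>)" for j
  proof (rule lebesgue_on_measurable_AE[OF \<Omega>_open finite_energyD[OF assms(1), of j]])
    show "AE x in lebesgue_on \<Omega>. U j x = weak_jet \<Omega> (U None) j x" using ae[of j] by eventually_elim simp
  qed
  show "finite_energy (weak_jet \<Omega> (U None))" by (rule finite_energy_cong_AE[OF assms(1) m ae])
qed

lemma W1_D:
  assumes "u \<in> W1 \<Omega> p"
  shows "finite_energy (weak_jet \<Omega> u)" "has_weak_pderiv \<Omega> i u (weak_pderiv \<Omega> i u)"
proof -
  obtain g where g: "\<And>i. g i \<in> Lvar \<Omega> (p i)" "\<And>i. has_weak_pderiv \<Omega> i u (g i)"
  proof -
    have "\<forall>i. \<exists>g. g \<in> Lvar \<Omega> (p i) \<and> has_weak_pderiv \<Omega> i u g" using assms unfolding W1_def by blast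
    from choice[OF this] obtain g where "\<forall>i. g i \<in> Lvar \<Omega> (p i) \<and> has_weak_pderiv \<Omega> i u (g i)" by (rule exE)
    then show ?thesis by (intro that[of g]) auto
  qed
  define U where "U j = (case j of None \<Rightarrow> u | Some i \<Rightarrow> g i)" for j
  have "U j \<in> Lvar \<Omega> (expo p j)" for j
    using assms g by (cases j) (auto simp: U_def W1_def)
  then have "finite_energy U" by (simp add: finite_energy_iff_Lvar)
  from W1_I(3)[OF this] g(2) show "finite_energy (weak_jet \<Omega> u)" by (simp add: U_def)
  show "has_weak_pderiv \<Omega> i u (weak_pderiv \<Omega> i u)" by (rule weak_pderiv_AE(1)[OF \<Omega>_open g(2)])
qed

lemma jet_measurable: "\<phi> \<in> test_functions \<Omega> \<Longrightarrow> jet \<phi> j \<in> borel_measurable (lebesgue_on \<Omega>)"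
  by (intro borel_measurable_lebesgue_on test_function_borel[of _ \<Omega>] test_function_jet)

lemma jet_bounded:
  assumes "\<phi> \<in> test_functions \<Omega>" obtains B where "0 < B" "\<And>j x. \<bar>jet \<phi> j x\<bar> \<le> B"
proof -
  obtain N where "\<phi> \<in> lipschitz_class \<Omega> N" using test_function_in_lipschitz_class[OF assms] by blast
  then have "\<bar>jet \<phi> j x\<bar> \<le> real N + 1" for j x
    by (force simp: lipschitz_class_def intro: order_trans[of _ "real N"])
  then show thesis by (intro that[of "real N + 1"]) auto
qed

lemma finite_energy_jet: "\<phi> \<in> test_functions \<Omega> \<Longrightarrow> finite_energy (jet \<phi>)"
  by (rule jet_bounded, assumption, rule finite_energy_bounded) (auto intro: jet_measurable)

lemma jet_has_weak_pderiv: "\<phi> \<in> test_functions \<Omega> \<Longrightarrow> has_weak_pderiv \<Omega> i (jet \<phi> None) (jet \<phi> (Some i))"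
  using test_function_has_weak_pderiv[OF \<Omega>_open] by simp

text \<open>The space \<open>W\<^sub>0\<^bsup>1,p(x)\<^esup>(\<Omega>)\<close> as a set of families \<open>(u, Du)\<close>: its elements carry their derivatives along.\<close>

definition test_closure :: "('n option \<Rightarrow> real^'n \<Rightarrow> real) set" where
  "test_closure = {V. finite_energy V \<and> (\<forall>e>0. \<exists>\<phi>\<in>test_functions \<Omega>. energy (\<lambda>j x. V j x - jet \<phi> j x) < e)}"

lemma weak_jet_diff:
  assumes "finite_energy V" "\<And>i. has_weak_pderiv \<Omega> i (V None) (V (Some i))" and \<phi>: "\<phi> \<in> test_functions \<Omega>"
  shows "finite_energy (weak_jet \<Omega> (\<lambda>x. V None x - \<phi> x))"
    "energy (weak_jet \<Omega> (\<lambda>x. V None x - \<phi> x)) = energy (\<lambda>j x. V j x - jet \<phi> j x)"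
proof -
  have f: "finite_energy (\<lambda>j x. V j x - jet \<phi> j x)"
    by (rule finite_energy_diff[OF assms(1) finite_energy_jet[OF \<phi>]])
  have d: "has_weak_pderiv \<Omega> i (\<lambda>x. V None x - jet \<phi> None x) (\<lambda>x. V (Some i) x - jet \<phi> (Some i) x)" for i
    by (rule has_weak_pderiv_diff[OF \<Omega>_open assms(2) jet_has_weak_pderiv[OF \<phi>]])
  note w = W1_I[OF f d]
  show fe: "finite_energy (weak_jet \<Omega> (\<lambda>x. V None x - \<phi> x))" using w(3) by simp
  show "energy (weak_jet \<Omega> (\<lambda>x. V None x - \<phi> x)) = energy (\<lambda>j x. V j x - jet \<phi> j x)"
    by (rule energy_cong_AE[OF finite_energyD[OF fe] finite_energyD[OF f]]) (use w(2) in simp)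
qed

text \<open>Approximate in energy by test functions, pass to a dominated subsequence that converges almost everywhere, and
take the limit in the integration by parts.\<close>

lemma test_closure_weak_pderiv:
  assumes "V \<in> test_closure"
  shows "has_weak_pderiv \<Omega> i (V None) (V (Some i))"
proof -
  have V: "finite_energy V" using assms by (simp add: test_closure_def)
  have "\<forall>n. \<exists>\<phi>\<in>test_functions \<Omega>. energy (\<lambda>j x. V j x - jet \<phi> j x) < 1 / real (Suc n)"
    using assms by (auto simp: test_closure_def simp del: of_nat_Suc)
  then obtain \<phi> where \<phi>: "\<And>n. \<phi> n \<in> test_functions \<Omega>" "\<And>n. energy (\<lambda>j x. V j x - jet (\<phi> n) j x) < 1 / real (Suc n)"
    by metis
  have "(\<lambda>n. energy (\<lambda>j x. jet (\<phi> n) j x - V j x)) \<longlonglongrightarrow> 0"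
  proof (rule Lim_null_comparison[OF _ LIMSEQ_Suc[OF lim_const_over_n[of 1]]], intro always_eventually allI)
    fix n show "norm (energy (\<lambda>j x. jet (\<phi> n) j x - V j x)) \<le> 1 / real (Suc n)"
      using \<phi>(2)[of n] energy_diff_commute[of V "jet (\<phi> n)"] energy_nonneg[of "\<lambda>j x. jet (\<phi> n) j x - V j x"]
      by (simp del: of_nat_Suc)
  qed
  then obtain k G where k: "strict_mono (k :: nat \<Rightarrow> nat)" and G: "finite_energy G"
    "\<And>j. AE x in lebesgue_on \<Omega>. (\<lambda>n. jet (\<phi> (k n)) j x) \<longlonglongrightarrow> V j x"
    "\<And>j. AE x in lebesgue_on \<Omega>. \<forall>n. \<bar>jet (\<phi> (k n)) j x\<bar> \<le> G j x"
    using energy_convergent_subsequence[of "\<lambda>n. jet (\<phi> n)" V, OF finite_energy_jet[OF \<phi>(1)] V] by blast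
  show ?thesis
    by (rule has_weak_pderiv_limit[OF \<Omega>_open \<phi>(1) finite_energyD[OF V] finite_energyD[OF V]
          finite_energy_component_integrable[OF G(1), of None] finite_energy_component_integrable[OF G(1), of "Some i"]])
       (use G(2)[of None] G(2)[of "Some i"] G(3)[of None] G(3)[of "Some i"] in auto)
qed

proposition test_closure_imp_W1_0:
  assumes V: "V \<in> test_closure"
  shows "V None \<in> W1_0 \<Omega> p" "AE x in lebesgue_on \<Omega>. weak_jet \<Omega> (V None) j x = V j x"
proof -
  have f: "finite_energy V" using V by (simp add: test_closure_def)
  note d = test_closure_weak_pderiv[OF V]
  show "AE x in lebesgue_on \<Omega>. weak_jet \<Omega> (V None) j x = V j x" by (rule W1_I(2)[OF f d])
  have "\<exists>\<phi>\<in>test_functions \<Omega>. W1_norm \<Omega> p (\<lambda>x. V None x - \<phi> x) < e" if e: "0 < e" for e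
  proof -
    define c where "c = real (CARD('n option))"
    have c: "0 < c" by (simp add: c_def)
    define e' where "e' = min 1 (e / (2 * c))"
    have e': "0 < e'" "e' \<le> 1" "c * e' < e"
    proof -
      show "0 < e'" "e' \<le> 1" using e c by (auto simp: e'_def)
      have "c * e' \<le> c * (e / (2 * c))" using c by (intro mult_left_mono) (auto simp: e'_def)
      also have "\<dots> = e / 2" using c by simp
      finally show "c * e' < e" using e by simp
    qed
    obtain \<phi> where \<phi>: "\<phi> \<in> test_functions \<Omega>" "energy (\<lambda>j x. V j x - jet \<phi> j x) < e' powr hi"
    proof -
      have "0 < e' powr hi" using e' by simp
      then have "\<exists>\<phi>\<in>test_functions \<Omega>. energy (\<lambda>j x. V j x - jet \<phi> j x) < e' powr hi"
        using V by (simp add: test_closure_def)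
      then show ?thesis using that by (elim bexE)
    qed
    note w = weak_jet_diff[OF f d \<phi>(1)]
    have "lux_norm \<Omega> (expo p j) (weak_jet \<Omega> (\<lambda>x. V None x - \<phi> x) j) \<le> e'" for j
    proof (rule lux_norm_le[OF _ e'(1,2)])
      show "weak_jet \<Omega> (\<lambda>x. V None x - \<phi> x) j \<in> Lvar \<Omega> (expo p j)" using w(1) by (simp add: finite_energy_iff_Lvar)
      show "(\<integral>x. \<bar>weak_jet \<Omega> (\<lambda>x. V None x - \<phi> x) j x\<bar> powr expo p j x \<partial>lebesgue_on \<Omega>) \<le> e' powr hi"
        using energy_component[of "weak_jet \<Omega> (\<lambda>x. V None x - \<phi> x)" j] w(2) \<phi>(2) by linarith
    qed
    then have "W1_norm \<Omega> p (\<lambda>x. V None x - \<phi> x) \<le> (\<Sum>j\<in>(UNIV :: 'n option set). e')"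
      unfolding W1_norm_eq by (intro sum_mono)
    also have "\<dots> = c * e'" by (simp add: c_def)
    also have "\<dots> < e" by (rule e')
    finally show ?thesis using \<phi>(1) by blast
  qed
  then show "V None \<in> W1_0 \<Omega> p" using W1_I(1)[OF f d] by (simp add: W1_0_def)
qed

proposition W1_0_imp_test_closure:
  assumes v: "v \<in> W1_0 \<Omega> p"
  shows "weak_jet \<Omega> v \<in> test_closure"
proof -
  have vW: "v \<in> W1 \<Omega> p" using v by (simp add: W1_0_def)
  note f = W1_D(1)[OF vW]
  have d: "has_weak_pderiv \<Omega> i (weak_jet \<Omega> v None) (weak_jet \<Omega> v (Some i))" for i using W1_D(2)[OF vW] by simp
  have "\<exists>\<phi>\<in>test_functions \<Omega>. energy (\<lambda>j x. weak_jet \<Omega> v j x - jet \<phi> j x) < e" if e: "0 < e" for e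
  proof -
    define c where "c = real (CARD('n option))"
    have c: "0 < c" by (simp add: c_def)
    define e' where "e' = min 1 (e / c)"
    have e': "0 < e'" "e' \<le> 1" "c * e' \<le> e"
    proof -
      show "0 < e'" "e' \<le> 1" using e c by (auto simp: e'_def)
      have "c * e' \<le> c * (e / c)" using c by (intro mult_left_mono) (auto simp: e'_def)
      then show "c * e' \<le> e" using c by simp
    qed
    obtain \<phi> where \<phi>: "\<phi> \<in> test_functions \<Omega>" "W1_norm \<Omega> p (\<lambda>x. v x - \<phi> x) < e'"
      using v e' by (auto simp: W1_0_def)
    have w: "finite_energy (weak_jet \<Omega> (\<lambda>x. v x - \<phi> x))"
       "energy (weak_jet \<Omega> (\<lambda>x. v x - \<phi> x)) = energy (\<lambda>j x. weak_jet \<Omega> v j x - jet \<phi> j x)"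
      using weak_jet_diff[OF f d \<phi>(1)] by simp_all
    have L: "weak_jet \<Omega> (\<lambda>x. v x - \<phi> x) j \<in> Lvar \<Omega> (expo p j)" for j using w(1) by (simp add: finite_energy_iff_Lvar)
    have "lux_norm \<Omega> (expo p j) (weak_jet \<Omega> (\<lambda>x. v x - \<phi> x) j) \<le> W1_norm \<Omega> p (\<lambda>x. v x - \<phi> x)" for j
      unfolding W1_norm_eq by (rule member_le_sum) (auto intro: lux_norm_nonneg L)
    then have "(\<integral>x. \<bar>weak_jet \<Omega> (\<lambda>x. v x - \<phi> x) j x\<bar> powr expo p j x \<partial>lebesgue_on \<Omega>) < e'" for j
      by (intro lux_norm_less_imp_modular[OF L]) (use \<phi>(2) e' in \<open>auto intro: order_le_less_trans\<close>)
    then have "energy (weak_jet \<Omega> (\<lambda>x. v x - \<phi> x)) < (\<Sum>j\<in>(UNIV :: 'n option set). e')"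
      unfolding energy_def by (intro sum_strict_mono) auto
    also have "\<dots> = c * e'" by (simp add: c_def)
    finally have "energy (\<lambda>j x. weak_jet \<Omega> v j x - jet \<phi> j x) < e" using w(2) e'(3) by linarith
    then show ?thesis using \<phi>(1) by blast
  qed
  then show ?thesis using f by (simp add: test_closure_def)
qed

end

section \<open>Structure of the convection term\<close>

lemma powr_sum_le:
  fixes a :: "'i \<Rightarrow> real"
  assumes "finite I" "I \<noteq> {}" "\<And>i. i \<in> I \<Longrightarrow> 0 \<le> a i" "0 \<le> s"
  shows "(\<Sum>i\<in>I. a i) powr s \<le> real (card I) powr s * (\<Sum>i\<in>I. a i powr s)"
proof -
  have "finite (a ` I)" "a ` I \<noteq> {}" using assms by auto
  then have "Max (a ` I) \<in> a ` I" by (rule Max_in)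
  then obtain i0 where i0: "i0 \<in> I" "a i0 = Max (a ` I)" by auto
  have "(\<Sum>i\<in>I. a i) \<le> (\<Sum>i\<in>I. a i0)" using i0 assms(1) by (intro sum_mono) auto
  then have "(\<Sum>i\<in>I. a i) powr s \<le> (real (card I) * a i0) powr s"
    using assms by (intro powr_mono2 sum_nonneg) auto
  also have "\<dots> = real (card I) powr s * a i0 powr s" using assms i0 by (simp add: powr_mult)
  also have "\<dots> \<le> real (card I) powr s * (\<Sum>i\<in>I. a i powr s)"
    using i0 assms(1) by (intro mult_left_mono member_le_sum) auto
  finally show ?thesis .
qed

lemma powr_le_1_add:
  fixes t :: real assumes "0 \<le> t" "0 \<le> a" "a \<le> b" shows "t powr a \<le> 1 + t powr b"
proof (cases "t \<le> 1")
  case True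
  then have "t powr a \<le> 1 powr a" using assms by (intro powr_mono2) auto
  then show ?thesis using powr_ge_zero[of t b] by (simp del: powr_ge_zero)
next
  case False
  then have "t powr a \<le> t powr b" using assms by (intro powr_mono) auto
  then show ?thesis by simp
qed

lemma borel_measurable_vec:
  assumes "\<And>i. f i \<in> borel_measurable M"
  shows "(\<lambda>x. \<chi> i. f i x :: real^'n::finite) \<in> borel_measurable M"
proof -
  have "(\<chi> i. f i x) = (\<Sum>i\<in>UNIV. f i x *\<^sub>R axis i 1)" for x :: 'a
    using basis_expansion[of "\<chi> i. f i x"] by (simp add: scalar_mult_eq_scaleR)
  then show ?thesis using assms by simp
qed

text \<open>For simple \<open>v\<close> the composition is measurable piece by piece. In general approximate \<open>v\<close> pointwise by simple
functions and use continuity in the second argument.\<close>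

lemma caratheodory_measurable:
  fixes F :: "'a \<Rightarrow> 'b::{metric_space, second_countable_topology} \<Rightarrow> real"
  assumes m: "\<And>z. (\<lambda>x. F x z) \<in> borel_measurable M" and c: "\<And>x. x \<in> space M \<Longrightarrow> continuous_on UNIV (F x)"
    and v: "v \<in> borel_measurable M"
  shows "(\<lambda>x. F x (v x)) \<in> borel_measurable M"
proof -
  obtain s where s: "\<And>n. simple_function M (s n)" "\<And>x. x \<in> space M \<Longrightarrow> (\<lambda>n. s n x) \<longlonglongrightarrow> v x"
    using borel_measurable_implies_sequence_metric[OF v, of undefined] by blast
  show ?thesis
  proof (rule borel_measurable_LIMSEQ_metric[where f = "\<lambda>n x. F x (s n x)"])
    fix n
    have fin: "finite (s n ` space M)" by (rule simple_functionD(1)[OF s(1)])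
    have "s n \<in> measurable M (count_space (s n ` space M))"
      unfolding measurable_count_space_eq2[OF fin] using simple_functionD(2)[OF s(1)] by auto
    then show "(\<lambda>x. F x (s n x)) \<in> borel_measurable M"
      by (rule measurable_compose_countable'[OF m _ countable_finite[OF fin]])
  next
    fix x assume x: "x \<in> space M"
    show "(\<lambda>n. F x (s n x)) \<longlonglongrightarrow> F x (v x)"
      by (rule continuous_on_tendsto_compose[OF c[OF x] s(2)[OF x]]) auto
  qed
qed

context anisotropic_domain
begin

text \<open>The growth condition splits into the two hypotheses on the convection term. For the first, raise the bound to
the power \<open>q'(x)\<close>: the exponents become \<open>(q - 1) q' = q \<le> p\<^sub>M\<close> and \<open>r\<^sub>i q' \<le> p\<^sub>i\<close>. For the second, multiply by
\<open>|u|\<close>. The terms \<open>|k| |u|\<close> and \<open>|u|\<^sup>q\<close> are absorbed because \<open>q\<^sup>+ < p\<^sub>m\<close>. Young's inequality with exponents \<open>p\<^sub>m\<close> and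
\<open>\<sigma> = p\<^sub>m / (p\<^sub>m - 1)\<close> splits \<open>|\<xi>\<^sub>i|\<^bsup>r\<^sub>i\<^esup> |u|\<close> into \<open>|u|\<^bsup>p\<^sub>m\<^esup>\<close> and \<open>|\<xi>\<^sub>i|\<^bsup>r\<^sub>i \<sigma>\<^esup>\<close>, and \<open>r\<^sub>i\<^sup>+ \<sigma> < p\<^sub>i\<^sup>-\<close> lets the latter be
absorbed as well.\<close>

lemma growth_structure:
  fixes f :: "real^'n \<Rightarrow> real \<Rightarrow> real^'n \<Rightarrow> real"
  assumes qm: "q \<in> borel_measurable (lebesgue_on \<Omega>)"
    and q: "\<And>x. x \<in> \<Omega> \<Longrightarrow> ql \<le> q x \<and> q x \<le> qh" and ql: "1 < ql" and qh: "qh < lo"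
    and k: "k \<in> Lvar \<Omega> (conj_exp q)"
    and r: "\<And>i x. x \<in> \<Omega> \<Longrightarrow> 0 \<le> r i x \<and> r i x \<le> R i \<and> r i x * conj_exp q x \<le> p i x"
    and R: "\<And>i. R i * (lo / (lo - 1)) < pl i" and pl: "\<And>i x. x \<in> \<Omega> \<Longrightarrow> pl i \<le> p i x"
    and C: "0 < C"
    and f: "AE x in lebesgue_on \<Omega>. \<forall>u \<xi>.
           \<bar>f x u \<xi>\<bar> \<le> C * (\<bar>k x\<bar> + \<bar>u\<bar> powr (q x - 1) + (\<Sum>i\<in>UNIV. \<bar>\<xi> $ i\<bar> powr r i x))"
  obtains h A where "integrable (lebesgue_on \<Omega>) h" "\<And>x. 0 \<le> h x" "0 < A"
    "AE x in lebesgue_on \<Omega>. \<forall>y. \<bar>f x (y None) (\<chi> i. y (Some i))\<bar> powr (q x / (q x - 1))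
       \<le> A * (h x + (\<Sum>j\<in>UNIV. \<bar>y j\<bar> powr expo p j x))"
    "AE x in lebesgue_on \<Omega>. \<forall>y. \<bar>f x (y None) (\<chi> i. y (Some i)) * y None\<bar>
       \<le> h x + (\<Sum>j\<in>UNIV. \<bar>y j\<bar> powr expo p j x) / 2"
proof -
  define n where "n = real CARD('n)"
  have n: "1 \<le> n" by (simp add: n_def Suc_leI)
  define s where "s x = q x / (q x - 1)" for x
  have sc: "s = conj_exp q" by (simp add: s_def conj_exp_def fun_eq_iff)
  define sh where "sh = ql / (ql - 1)"
  have s: "1 < s x" "s x \<le> sh" if "x \<in> \<Omega>" for x
  proof -
    show "1 < s x" using q[OF that] ql by (simp add: s_def)
    have "s x = 1 + 1 / (q x - 1)" using q[OF that] ql by (simp add: s_def field_simps)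
    also have "\<dots> \<le> 1 + 1 / (ql - 1)" using q[OF that] ql by (intro add_left_mono divide_left_mono) auto
    also have "\<dots> = sh" using ql by (simp add: sh_def field_simps)
    finally show "s x \<le> sh" .
  qed
  have P: "lo \<le> expo p j x" if "x \<in> \<Omega>" for j x using expo_bounds[OF that] by blast
  define \<kappa> where "\<kappa> x = \<bar>k x\<bar> powr s x" for x
  have km [measurable]: "k \<in> borel_measurable (lebesgue_on \<Omega>)" using k by (simp add: Lvar_def)
  note [measurable] = qm
  have \<kappa>i: "integrable (lebesgue_on \<Omega>) \<kappa>"
  proof (rule integrableI_bounded)
    show "\<kappa> \<in> borel_measurable (lebesgue_on \<Omega>)" unfolding \<kappa>_def s_def by measurable
    show "(\<integral>\<^sup>+x. ennreal (norm (\<kappa> x)) \<partial>lebesgue_on \<Omega>) < \<infinity>"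
      using k by (simp add: Lvar_def modular_def \<kappa>_def sc)
  qed
  have \<kappa>0: "0 \<le> \<kappa> x" for x by (simp add: \<kappa>_def)
  define \<sigma> where "\<sigma> = lo / (lo - 1)"
  have \<sigma>: "1 < \<sigma>" using lo by (simp add: \<sigma>_def)
  \<comment> \<open>These three weights leave \<open>1/2\<close> in front of every energy density: \<open>2 C \<epsilon> + C n \<delta>\<^bsup>lo\<^esup> = 1/2\<close> for \<open>u\<close> and \<open>C \<delta>\<^bsup>-\<sigma>\<^esup> \<eta> = 1/2\<close> for each \<open>\<xi>\<^sub>i\<close>.\<close>
  define \<epsilon> where "\<epsilon> = 1 / (8 * C)"
  define \<delta> where "\<delta> = (1 / (4 * C * n)) powr (1 / lo)"
  define \<eta> where "\<eta> = \<delta> powr \<sigma> / (2 * C)"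
  have \<delta>0: "0 < \<delta>" using C n by (simp add: \<delta>_def)
  have \<epsilon>0: "0 < \<epsilon>" using C by (simp add: \<epsilon>_def)
  have \<eta>0: "0 < \<eta>" using C \<delta>0 by (simp add: \<eta>_def)
  have \<delta>lo: "\<delta> powr lo = 1 / (4 * C * n)" using lo C n by (simp add: \<delta>_def powr_powr)
  obtain C1 where C1: "1 \<le> C1" "\<And>a b t. 0 \<le> a \<Longrightarrow> a \<le> qh \<Longrightarrow> lo \<le> b \<Longrightarrow> 0 \<le> t \<Longrightarrow> t powr a \<le> C1 + \<epsilon> * t powr b"
    using powr_absorb[OF qh \<epsilon>0] by blast
  have "\<forall>i. \<exists>D. 1 \<le> D \<and> (\<forall>a b t. 0 \<le> a \<longrightarrow> a \<le> R i * \<sigma> \<longrightarrow> pl i \<le> b \<longrightarrow> 0 \<le> t \<longrightarrow> t powr a \<le> D + \<eta> * t powr b)"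
  proof
    fix i
    obtain D where "1 \<le> D" "\<And>a b t. 0 \<le> a \<Longrightarrow> a \<le> R i * \<sigma> \<Longrightarrow> pl i \<le> b \<Longrightarrow> 0 \<le> t \<Longrightarrow> t powr a \<le> D + \<eta> * t powr b"
      using powr_absorb[OF R[of i, folded \<sigma>_def] \<eta>0] by blast
    then show "\<exists>D. 1 \<le> D \<and> (\<forall>a b t. 0 \<le> a \<longrightarrow> a \<le> R i * \<sigma> \<longrightarrow> pl i \<le> b \<longrightarrow> 0 \<le> t \<longrightarrow> t powr a \<le> D + \<eta> * t powr b)" by blast
  qed
  then obtain D where D: "\<And>i. 1 \<le> D i"
    "\<And>i a b t. 0 \<le> a \<Longrightarrow> a \<le> R i * \<sigma> \<Longrightarrow> pl i \<le> b \<Longrightarrow> 0 \<le> t \<Longrightarrow> t powr a \<le> D i + \<eta> * t powr b" by metis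
  define c0 where "c0 = C * (2 * C1 + (\<Sum>i\<in>UNIV. \<delta> powr (- \<sigma>) * D i + \<delta> powr lo))"
  have c0: "0 \<le> c0" unfolding c0_def using C C1 D(1)
    by (intro mult_nonneg_nonneg add_nonneg_nonneg sum_nonneg) (auto intro: order_trans[of 0 1])
  define h where "h x = (C + 1) * \<kappa> x + (c0 + 1 + n)" for x
  define N where "N = real CARD('n option option)"
  define A where "A = max 1 (C * N) powr sh"
  show thesis
  proof (rule that[of h A])
    show "integrable (lebesgue_on \<Omega>) h" unfolding h_def using \<kappa>i by simp
    show "0 \<le> h x" for x unfolding h_def using C \<kappa>0[of x] c0 n by simp
    show "0 < A" by (simp add: A_def)
    show "AE x in lebesgue_on \<Omega>. \<forall>y. \<bar>f x (y None) (\<chi> i. y (Some i))\<bar> powr (q x / (q x - 1))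
       \<le> A * (h x + (\<Sum>j\<in>UNIV. \<bar>y j\<bar> powr expo p j x))"
      using f AE_space
    proof eventually_elim
      case (elim x)
      then have x: "x \<in> \<Omega>" by simp
      show ?case
      proof
        fix y :: "'n option \<Rightarrow> real"
        \<comment> \<open>the three kinds of summands of the bound, indexed by one finite type\<close>
        define b where "b j = (case j of None \<Rightarrow> \<bar>k x\<bar> | Some None \<Rightarrow> \<bar>y None\<bar> powr (q x - 1)
           | Some (Some i) \<Rightarrow> \<bar>y (Some i)\<bar> powr r i x)" for j
        have bsum: "(\<Sum>j\<in>UNIV. b j) = \<bar>k x\<bar> + \<bar>y None\<bar> powr (q x - 1) + (\<Sum>i\<in>UNIV. \<bar>y (Some i)\<bar> powr r i x)"
          by (simp add: sum_option b_def)
        have b0: "0 \<le> b j" for j by (auto simp: b_def split: option.split)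
        have "\<bar>f x (y None) (\<chi> i. y (Some i))\<bar> \<le> C * (\<Sum>j\<in>UNIV. b j)"
          using elim(1)[rule_format, of "y None" "\<chi> i. y (Some i)"] unfolding bsum by simp
        then have "\<bar>f x (y None) (\<chi> i. y (Some i))\<bar> powr s x \<le> (C * (\<Sum>j\<in>UNIV. b j)) powr s x"
          using s[OF x] by (intro powr_mono2) auto
        also have "\<dots> = C powr s x * (\<Sum>j\<in>UNIV. b j) powr s x"
          using C b0 by (simp add: powr_mult sum_nonneg)
        also have "\<dots> \<le> C powr s x * (N powr s x * (\<Sum>j\<in>UNIV. b j powr s x))"
          unfolding N_def using b0 s[OF x] by (intro mult_left_mono powr_sum_le) auto
        also have "\<dots> = (C * N) powr s x * (\<Sum>j\<in>UNIV. b j powr s x)"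
          using C by (simp add: powr_mult N_def)
        also have "\<dots> \<le> A * (\<Sum>j\<in>UNIV. b j powr s x)"
        proof (rule mult_right_mono)
          have "(C * N) powr s x \<le> max 1 (C * N) powr s x" using s[OF x] C by (intro powr_mono2) (auto simp: N_def)
          also have "\<dots> \<le> A" unfolding A_def using s[OF x] by (intro powr_mono) auto
          finally show "(C * N) powr s x \<le> A" .
        qed (simp add: sum_nonneg)
        also have "\<dots> \<le> A * (h x + (\<Sum>j\<in>UNIV. \<bar>y j\<bar> powr expo p j x))"
        proof (rule mult_left_mono)
          have "(q x - 1) * s x = q x" using q[OF x] ql by (simp add: s_def)
          then have 1: "(\<bar>y None\<bar> powr (q x - 1)) powr s x \<le> 1 + \<bar>y None\<bar> powr expo p None x"
            using q[OF x] ql qh P[OF x, of None] by (simp only: powr_powr) (intro powr_le_1_add; simp)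
          have 2: "(\<bar>y (Some i)\<bar> powr r i x) powr s x \<le> 1 + \<bar>y (Some i)\<bar> powr expo p (Some i) x" for i
            using r[OF x, of i] s[OF x] unfolding powr_powr sc[symmetric] by (intro powr_le_1_add) auto
          have "(\<Sum>j\<in>UNIV. b j powr s x) = \<kappa> x + (\<bar>y None\<bar> powr (q x - 1)) powr s x + (\<Sum>i\<in>UNIV. (\<bar>y (Some i)\<bar> powr r i x) powr s x)"
            by (simp add: sum_option b_def \<kappa>_def)
          also have "\<dots> \<le> \<kappa> x + (1 + \<bar>y None\<bar> powr expo p None x) + (\<Sum>i\<in>UNIV. 1 + \<bar>y (Some i)\<bar> powr expo p (Some i) x)"
            by (intro add_mono sum_mono 1 2 order_refl)
          also have "\<dots> = \<kappa> x + 1 + n + (\<Sum>j\<in>UNIV. \<bar>y j\<bar> powr expo p j x)"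
            by (simp add: sum_option sum.distrib n_def)
          also have "\<dots> \<le> h x + (\<Sum>j\<in>UNIV. \<bar>y j\<bar> powr expo p j x)"
            unfolding h_def using C \<kappa>0[of x] c0 by (simp add: distrib_right)
          finally show "(\<Sum>j\<in>UNIV. b j powr s x) \<le> h x + (\<Sum>j\<in>UNIV. \<bar>y j\<bar> powr expo p j x)" .
        qed (simp add: A_def)
        finally show "\<bar>f x (y None) (\<chi> i. y (Some i))\<bar> powr (q x / (q x - 1)) \<le> A * (h x + (\<Sum>j\<in>UNIV. \<bar>y j\<bar> powr expo p j x))"
          by (simp add: s_def)
      qed
    qed
    show "AE x in lebesgue_on \<Omega>. \<forall>y. \<bar>f x (y None) (\<chi> i. y (Some i)) * y None\<bar>
       \<le> h x + (\<Sum>j\<in>UNIV. \<bar>y j\<bar> powr expo p j x) / 2"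
      using f AE_space
    proof eventually_elim
      case (elim x)
      then have x: "x \<in> \<Omega>" by simp
      show ?case
      proof
        fix y :: "'n option \<Rightarrow> real"
        define u where "u = \<bar>y None\<bar>"
        define U where "U = u powr expo p None x"
        define e where "e i = \<bar>y (Some i)\<bar> powr expo p (Some i) x" for i
        have u0: "0 \<le> u" by (simp add: u_def)
        have 1: "\<bar>k x\<bar> * u \<le> \<kappa> x + (C1 + \<epsilon> * U)"
        proof -
          have "\<bar>k x\<bar> * u \<le> \<bar>k x\<bar> powr (q x / (q x - 1)) + u powr q x"
            using q[OF x] ql u0 by (intro young_weak) auto
          also have "u powr q x \<le> C1 + \<epsilon> * U" unfolding U_def
            using q[OF x] ql u0 P[OF x, of None] by (intro C1(2)) auto
          finally show ?thesis by (simp add: \<kappa>_def s_def)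
        qed
        have 2: "u powr (q x - 1) * u \<le> C1 + \<epsilon> * U"
        proof -
          have "u powr (q x - 1) * u = u powr q x" using powr_mult_base[OF u0, of "q x - 1"] by (simp add: mult.commute)
          also have "\<dots> \<le> C1 + \<epsilon> * U" unfolding U_def
            using q[OF x] ql u0 P[OF x, of None] by (intro C1(2)) auto
          finally show ?thesis .
        qed
        have 3: "\<bar>y (Some i)\<bar> powr r i x * u \<le> \<delta> powr (- \<sigma>) * D i + \<delta> powr lo + e i / (2 * C) + \<delta> powr lo * U" for i
        proof -
          define t where "t = \<bar>y (Some i)\<bar>"
          have t0: "0 \<le> t" by (simp add: t_def)
          have "t powr r i x * u = (t powr r i x / \<delta>) * (\<delta> * u)" using \<delta>0 by simp
          also have "\<dots> \<le> (t powr r i x / \<delta>) powr (lo / (lo - 1)) + (\<delta> * u) powr lo"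
            using lo \<delta>0 u0 by (intro young_weak) auto
          also have "(t powr r i x / \<delta>) powr (lo / (lo - 1)) = \<delta> powr (- \<sigma>) * t powr (r i x * \<sigma>)"
            using \<delta>0 t0 by (simp add: \<sigma>_def[symmetric] powr_divide powr_powr powr_minus_divide)
          also have "(\<delta> * u) powr lo = \<delta> powr lo * u powr lo" using \<delta>0 u0 by (simp add: powr_mult)
          finally have a: "t powr r i x * u \<le> \<delta> powr (- \<sigma>) * t powr (r i x * \<sigma>) + \<delta> powr lo * u powr lo" .
          have "t powr (r i x * \<sigma>) \<le> D i + \<eta> * e i"
            unfolding e_def t_def using r[OF x, of i] pl[OF x, of i] \<sigma> by (intro D(2)) (auto intro: mult_right_mono)
          then have "\<delta> powr (- \<sigma>) * t powr (r i x * \<sigma>) \<le> \<delta> powr (- \<sigma>) * (D i + \<eta> * e i)"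
            by (rule mult_left_mono) simp
          also have "\<dots> = \<delta> powr (- \<sigma>) * D i + e i / (2 * C)"
            using \<delta>0 by (simp add: \<eta>_def distrib_left powr_minus)
          finally have b: "\<delta> powr (- \<sigma>) * t powr (r i x * \<sigma>) \<le> \<delta> powr (- \<sigma>) * D i + e i / (2 * C)" .
          have "u powr lo \<le> 1 + U" unfolding U_def using u0 lo P[OF x, of None] by (intro powr_le_1_add) auto
          then have "\<delta> powr lo * u powr lo \<le> \<delta> powr lo * (1 + U)" by (rule mult_left_mono) simp
          then have "\<delta> powr lo * u powr lo \<le> \<delta> powr lo + \<delta> powr lo * U" by (simp add: distrib_left)
          with a b show ?thesis unfolding t_def by linarith
        qed
        have "\<bar>f x (y None) (\<chi> i. y (Some i)) * y None\<bar> = \<bar>f x (y None) (\<chi> i. y (Some i))\<bar> * u"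
          by (simp add: abs_mult u_def)
        also have "\<dots> \<le> C * (\<bar>k x\<bar> + u powr (q x - 1) + (\<Sum>i\<in>UNIV. \<bar>y (Some i)\<bar> powr r i x)) * u"
          using elim(1)[rule_format, of "y None" "\<chi> i. y (Some i)"] u0 by (intro mult_right_mono) (auto simp: u_def)
        also have "\<dots> = C * (\<bar>k x\<bar> * u + u powr (q x - 1) * u + (\<Sum>i\<in>UNIV. \<bar>y (Some i)\<bar> powr r i x * u))"
          by (simp add: distrib_right sum_distrib_right mult.assoc)
        also have "\<dots> \<le> C * ((\<kappa> x + (C1 + \<epsilon> * U)) + (C1 + \<epsilon> * U) +
            (\<Sum>i\<in>UNIV. \<delta> powr (- \<sigma>) * D i + \<delta> powr lo + e i / (2 * C) + \<delta> powr lo * U))"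
          using C by (intro mult_left_mono add_mono sum_mono 1 2 3) auto
        also have "(\<Sum>i\<in>UNIV. \<delta> powr (- \<sigma>) * D i + \<delta> powr lo + e i / (2 * C) + \<delta> powr lo * U)
            = (\<Sum>i\<in>UNIV. \<delta> powr (- \<sigma>) * D i + \<delta> powr lo) + (\<Sum>i\<in>UNIV. e i) / (2 * C) + n * (\<delta> powr lo * U)"
          by (simp add: sum.distrib sum_divide_distrib n_def)
        also have "C * ((\<kappa> x + (C1 + \<epsilon> * U)) + (C1 + \<epsilon> * U) +
            ((\<Sum>i\<in>UNIV. \<delta> powr (- \<sigma>) * D i + \<delta> powr lo) + (\<Sum>i\<in>UNIV. e i) / (2 * C) + n * (\<delta> powr lo * U)))
            = C * \<kappa> x + c0 + (\<Sum>i\<in>UNIV. e i) / 2 + U / 2"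
          unfolding c0_def \<epsilon>_def \<delta>lo using C n by (simp add: field_simps)
        also have "\<dots> \<le> h x + (U + (\<Sum>i\<in>UNIV. e i)) / 2"
          unfolding h_def using \<kappa>0[of x] n by (simp add: distrib_right add_divide_distrib)
        also have "U + (\<Sum>i\<in>UNIV. e i) = (\<Sum>j\<in>UNIV. \<bar>y j\<bar> powr expo p j x)"
          by (simp add: sum_option U_def u_def e_def)
        finally show "\<bar>f x (y None) (\<chi> i. y (Some i)) * y None\<bar> \<le> h x + (\<Sum>j\<in>UNIV. \<bar>y j\<bar> powr expo p j x) / 2" .
      qed
    qed
  qed
qed

end

section \<open>Existence of a weak solution\<close>

lemma test_function_add:
  assumes "\<phi> \<in> test_functions \<Omega>" "\<psi> \<in> test_functions \<Omega>"
  shows "(\<lambda>x. \<phi> x + \<psi> x) \<in> test_functions \<Omega>"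
proof -
  let ?K = "closure {x. \<phi> x \<noteq> 0} \<union> closure {x. \<psi> x \<noteq> 0}"
  have K: "compact ?K" "?K \<subseteq> \<Omega>" using assms by (auto simp: test_functions_def)
  have "{x. \<phi> x + \<psi> x \<noteq> 0} \<subseteq> ?K"
  proof
    fix x assume "x \<in> {x. \<phi> x + \<psi> x \<noteq> 0}"
    then have "x \<in> {x. \<phi> x \<noteq> 0} \<or> x \<in> {x. \<psi> x \<noteq> 0}" by auto
    then show "x \<in> ?K" using closure_subset[of "{x. \<phi> x \<noteq> 0}"] closure_subset[of "{x. \<psi> x \<noteq> 0}"] by blast
  qed
  then have c: "closure {x. \<phi> x + \<psi> x \<noteq> 0} \<subseteq> ?K"
    using compact_imp_closed[OF K(1)] by (intro closure_minimal)
  then have "compact (closure {x. \<phi> x + \<psi> x \<noteq> 0})"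
    unfolding compact_eq_bounded_closed
    by (intro conjI bounded_subset[OF compact_imp_bounded[OF K(1)] c] closed_closure)
  moreover have "smooth (\<lambda>x. \<phi> x + \<psi> x)" using assms by (intro smooth_add test_function_smooth)
  ultimately show ?thesis using c K(2) unfolding test_functions_def by blast
qed

lemma test_function_lincomb:
  assumes "\<And>i. \<phi> i \<in> test_functions \<Omega>"
  shows "(\<lambda>x. \<Sum>i<(m::nat). c i * \<phi> i x) \<in> test_functions \<Omega>"
proof (induction m)
  case (Suc m)
  have "(\<lambda>x. c m * \<phi> m x) \<in> test_functions \<Omega>"
    using test_function_mult[OF assms smooth_const[of "c m"], of m] by (simp add: mult.commute)
  from test_function_add[OF Suc this] show ?case by simp
qed (simp add: zero_test_function)

lemma jet_lincomb:
  assumes "\<And>i. \<phi> i \<in> test_functions \<Omega>"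
  shows "jet (\<lambda>x. \<Sum>i<(m::nat). c i * \<phi> i x) j x = (\<Sum>i<m. c i * jet (\<phi> i) j x)"
  using pderiv_at_lincomb[of m \<phi> _ c x] test_function_smooth[OF assms] by (cases j) auto

context anisotropic_domain
begin

lemma integral_jet_le:
  assumes \<theta>: "\<theta> \<in> test_functions \<Omega>"
  shows "(\<integral>x. \<bar>jet \<theta> j x\<bar> \<partial>lborel) \<le> measure (lebesgue_on \<Omega>) \<Omega> + energy (jet \<theta>)"
proof -
  note f = finite_energy_jet[OF \<theta>] and t = test_function_jet[OF \<theta>, of j]
  have "(\<integral>x. \<bar>jet \<theta> j x\<bar> \<partial>lborel) = (\<integral>x. \<bar>jet \<theta> j x\<bar> \<partial>lebesgue_on \<Omega>)"
    by (rule integral_lebesgue_on_eq_lborel(1)[OF \<Omega>_open, symmetric])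
       (use test_function_borel[OF t] test_function_0[OF t] in auto)
  also have "\<dots> \<le> (\<integral>x. 1 + \<bar>jet \<theta> j x\<bar> powr expo p j x \<partial>lebesgue_on \<Omega>)"
  proof (rule integral_mono)
    show "integrable (lebesgue_on \<Omega>) (\<lambda>x. \<bar>jet \<theta> j x\<bar>)" using finite_energy_component_integrable[OF f] by simp
    show "integrable (lebesgue_on \<Omega>) (\<lambda>x. 1 + \<bar>jet \<theta> j x\<bar> powr expo p j x)" using finite_energy_integrable[OF f] by simp
    fix x assume "x \<in> space (lebesgue_on \<Omega>)"
    then have "1 < expo p j x" by (rule P_gt_1)
    then show "\<bar>jet \<theta> j x\<bar> \<le> 1 + \<bar>jet \<theta> j x\<bar> powr expo p j x"
      using powr_le_1_add[of "\<bar>jet \<theta> j x\<bar>" 1 "expo p j x"] by simp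
  qed
  also have "\<dots> = measure (lebesgue_on \<Omega>) \<Omega> + (\<integral>x. \<bar>jet \<theta> j x\<bar> powr expo p j x \<partial>lebesgue_on \<Omega>)"
    using finite_energy_integrable[OF f] by simp
  also have "\<dots> \<le> measure (lebesgue_on \<Omega>) \<Omega> + energy (jet \<theta>)" using energy_component[of "jet \<theta>" j] by simp
  finally show ?thesis .
qed

text \<open>On a set of finite measure a bound on the energy bounds the \<open>L\<^sup>1\<close> norms of the function and its derivatives, as
\<open>t \<le> 1 + t\<^bsup>p(x)\<^esup>\<close>.\<close>

lemma energy_bounded_L1_compact:
  assumes \<theta>: "\<And>n. \<theta> n \<in> test_functions \<Omega>" and E: "\<And>n. energy (jet (\<theta> n)) \<le> E"
  shows "\<exists>k. strict_mono (k :: nat \<Rightarrow> nat) \<and>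
    (\<forall>e>0. \<exists>N. \<forall>m\<ge>N. \<forall>n\<ge>N. (\<integral>x. \<bar>\<theta> (k m) x - \<theta> (k n) x\<bar> \<partial>lebesgue_on \<Omega>) < e)"
proof -
  define K where "K = measure (lebesgue_on \<Omega>) \<Omega> + E"
  have K: "(\<integral>x. \<bar>jet (\<theta> n) j x\<bar> \<partial>lborel) \<le> K" for n j
    using integral_jet_le[OF \<theta>, of n j] E[of n] by (simp add: K_def)
  obtain k where k: "strict_mono (k :: nat \<Rightarrow> nat)"
    "\<And>e. 0 < e \<Longrightarrow> \<exists>N. \<forall>m\<ge>N. \<forall>n\<ge>N. (\<integral>x. \<bar>\<theta> (k m) x - \<theta> (k n) x\<bar> \<partial>lborel) < e"
    using rellich[OF \<Omega>_bounded \<Omega>_open, of \<theta> K, OF \<theta>] K[of _ None] K[of _ "Some _"] by auto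
  have "(\<integral>x. \<bar>\<theta> m x - \<theta> n x\<bar> \<partial>lebesgue_on \<Omega>) = (\<integral>x. \<bar>\<theta> m x - \<theta> n x\<bar> \<partial>lborel)" for m n
  proof (rule integral_lebesgue_on_eq_lborel(1)[OF \<Omega>_open])
    show "(\<lambda>x. \<bar>\<theta> m x - \<theta> n x\<bar>) \<in> borel_measurable borel"
      using test_function_borel[OF \<theta>] by (intro borel_measurable_abs borel_measurable_diff)
  qed (simp add: test_function_0[OF \<theta>])
  then show ?thesis using k by auto
qed

text \<open>The abstract theorem with a dense sequence of test functions as the Galerkin basis. Its closure space is the
closure of the test functions, that is \<open>W\<^sub>0\<^bsup>1,p(x)\<^esup>(\<Omega>)\<close>, and its solution changes only on null sets when the components
are replaced by the chosen weak derivatives.\<close>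

theorem weak_solution_exists:
  fixes f :: "real^'n \<Rightarrow> real \<Rightarrow> real^'n \<Rightarrow> real"
  assumes car: "caratheodory \<Omega> f"
    and q: "\<And>x. x \<in> \<Omega> \<Longrightarrow> 1 < q x \<and> q x \<le> qh" "0 < qh" "qh < lo"
    and h: "integrable (lebesgue_on \<Omega>) h" "\<And>x. 0 \<le> h x" and A: "0 < A"
    and growth: "AE x in lebesgue_on \<Omega>. \<forall>y. \<bar>f x (y None) (\<chi> i. y (Some i))\<bar> powr (q x / (q x - 1))
       \<le> A * (h x + (\<Sum>j\<in>UNIV. \<bar>y j\<bar> powr expo p j x))"
    and coercive: "AE x in lebesgue_on \<Omega>. \<forall>y. \<bar>f x (y None) (\<chi> i. y (Some i)) * y None\<bar>
       \<le> h x + (\<Sum>j\<in>UNIV. \<bar>y j\<bar> powr expo p j x) / 2"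
  shows "\<exists>u. weak_solution \<Omega> p f u"
proof -
  define g where "g x y = f x (y None) (\<chi> i. y (Some i))" for x and y :: "'n option \<Rightarrow> real"
  from test_functions_separable[of \<Omega>] obtain \<phi> where \<phi>': "\<forall>i::nat. \<phi> i \<in> test_functions \<Omega>"
    and dense: "\<forall>\<psi>\<in>test_functions \<Omega>. \<exists>n B. (\<forall>k j x. \<bar>jet (\<phi> (n k)) j x\<bar> \<le> B) \<and>
        (\<forall>j x. (\<lambda>k::nat. jet (\<phi> (n k)) j x) \<longlonglongrightarrow> jet \<psi> j x)"
    by (elim exE conjE)
  have \<phi>: "\<phi> i \<in> test_functions \<Omega>" for i using \<phi>' by simp
  have "\<forall>i. \<exists>B. \<forall>j x. \<bar>jet (\<phi> i) j x\<bar> \<le> B"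
  proof
    fix i show "\<exists>B. \<forall>j x. \<bar>jet (\<phi> i) j x\<bar> \<le> B"
    proof (rule jet_bounded[OF \<phi>[of i]])
      fix B assume "\<And>j x. \<bar>jet (\<phi> i) j x\<bar> \<le> B"
      then show "\<exists>B. \<forall>j x. \<bar>jet (\<phi> i) j x\<bar> \<le> B" by (intro exI[of _ B] allI)
    qed
  qed
  from choice[OF this] obtain B where B: "\<forall>i j x. \<bar>jet (\<phi> i) j x\<bar> \<le> B i" by (rule exE)
  interpret convection_problem "lebesgue_on \<Omega>" "expo p" lo hi None q qh g h A "\<lambda>i. jet (\<phi> i)" B
  proof unfold_locales
    show "(\<lambda>x. g x (\<lambda>j. U j x)) \<in> borel_measurable (lebesgue_on \<Omega>)"
      if U: "\<And>j. U j \<in> borel_measurable (lebesgue_on \<Omega>)" for U :: "'n option \<Rightarrow> real^'n \<Rightarrow> real"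
    proof -
      have "(\<lambda>x. (\<lambda>z. f x (fst z) (snd z)) (U None x, \<chi> i. U (Some i) x)) \<in> borel_measurable (lebesgue_on \<Omega>)"
      proof (rule caratheodory_measurable[where F = "\<lambda>x z. f x (fst z) (snd z)"
            and v = "\<lambda>x. (U None x, \<chi> i. U (Some i) x)"])
        show "(\<lambda>x. f x (fst z) (snd z)) \<in> borel_measurable (lebesgue_on \<Omega>)" for z
          using car by (simp add: caratheodory_def)
        show "continuous_on UNIV (\<lambda>z. f x (fst z) (snd z))" if "x \<in> space (lebesgue_on \<Omega>)" for x
          using car that by (simp add: caratheodory_def split_beta')
        show "(\<lambda>x. (U None x, \<chi> i. U (Some i) x)) \<in> borel_measurable (lebesgue_on \<Omega>)"
          by (intro borel_measurable_Pair U borel_measurable_vec)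
      qed
      then show ?thesis by (simp add: g_def)
    qed
    show "(\<lambda>n. g x (y n)) \<longlonglongrightarrow> g x z"
      if x: "x \<in> space (lebesgue_on \<Omega>)" and y: "\<And>j. (\<lambda>n. y n j) \<longlonglongrightarrow> z j" for x y z
    proof -
      have lim: "(\<lambda>n. (y n None, \<chi> i. y n (Some i))) \<longlonglongrightarrow> (z None, \<chi> i. z (Some i))"
        by (intro tendsto_Pair y vec_tendstoI) (simp add: y)
      have cont: "continuous_on UNIV (\<lambda>(u, \<xi>). f x u \<xi>)" using car x by (simp add: caratheodory_def)
      have "(\<lambda>n. (\<lambda>(u, \<xi>). f x u \<xi>) (y n None, \<chi> i. y n (Some i))) \<longlonglongrightarrow> (\<lambda>(u, \<xi>). f x u \<xi>) (z None, \<chi> i. z (Some i))"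
        by (rule continuous_on_tendsto_compose[OF cont lim]) simp_all
      then show ?thesis by (simp add: g_def)
    qed
    show "jet (\<phi> i) j \<in> borel_measurable (lebesgue_on \<Omega>)" for i j by (rule jet_measurable[OF \<phi>])
  qed (use q h A growth coercive B in \<open>auto simp: g_def\<close>)
  have comb_jet: "comb m c = jet (\<lambda>x. \<Sum>i<m. c i * \<phi> i x)" for m c
    by (auto simp: comb_def fun_eq_iff jet_lincomb[OF \<phi>])
  note lin = test_function_lincomb[OF \<phi>]
  have trial_test: "V \<in> test_closure" if "V \<in> trial_closure" for V
    unfolding test_closure_def
  proof (intro CollectI conjI allI impI)
    show "finite_energy V" using that by (simp add: trial_closure_def)
    fix e :: real assume "0 < e"
    then have "\<exists>m c. energy (\<lambda>j x. V j x - comb m c j x) < e" using that by (simp add: trial_closure_def)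
    then obtain m c where "energy (\<lambda>j x. V j x - jet (\<lambda>x. \<Sum>i<m. c i * \<phi> i x) j x) < e"
      unfolding comb_jet by (elim exE)
    then show "\<exists>\<theta>\<in>test_functions \<Omega>. energy (\<lambda>j x. V j x - jet \<theta> j x) < e" by (rule bexI[OF _ lin])
  qed
  have test_trial: "V \<in> trial_closure" if V: "V \<in> test_closure" for V
    unfolding trial_closure_def
  proof (intro CollectI conjI allI impI)
    show f: "finite_energy V" using V by (simp add: test_closure_def)
    fix e :: real assume e: "0 < e"
    define e' where "e' = e / (2 * 2 powr hi)"
    have e': "0 < e'" using e by (simp add: e'_def)
    have "\<exists>\<psi>\<in>test_functions \<Omega>. energy (\<lambda>j x. V j x - jet \<psi> j x) < e'" using V e' by (simp add: test_closure_def)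
    then obtain \<psi> where \<psi>: "\<psi> \<in> test_functions \<Omega>" "energy (\<lambda>j x. V j x - jet \<psi> j x) < e'" by (elim bexE)
    obtain n b where nb: "\<And>k j x. \<bar>jet (\<phi> (n k)) j x\<bar> \<le> b" "\<And>j x. (\<lambda>k::nat. jet (\<phi> (n k)) j x) \<longlonglongrightarrow> jet \<psi> j x"
    proof -
      from bspec[OF dense \<psi>(1)] obtain n b where "(\<forall>k j x. \<bar>jet (\<phi> (n k)) j x\<bar> \<le> b) \<and>
        (\<forall>j x. (\<lambda>k::nat. jet (\<phi> (n k)) j x) \<longlonglongrightarrow> jet \<psi> j x)" by (elim exE)
      then show ?thesis by (intro that[of n b]) auto
    qed
    have "finite_energy (\<lambda>j x. b)"
      by (rule finite_energy_bounded[of _ "\<bar>b\<bar>"]) auto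
    then have "(\<lambda>k. energy (\<lambda>j x. jet (\<phi> (n k)) j x - jet \<psi> j x)) \<longlonglongrightarrow> 0"
      by (intro energy_tendsto_0_dominated[where G = "\<lambda>j x. b"] jet_measurable \<phi> \<psi>) (auto intro!: AE_I2 nb)
    then have "\<forall>\<^sub>F k in sequentially. energy (\<lambda>j x. jet (\<phi> (n k)) j x - jet \<psi> j x) < e'"
      using e' by (rule order_tendstoD)
    then obtain k where k: "energy (\<lambda>j x. jet (\<phi> (n k)) j x - jet \<psi> j x) < e'"
      by (auto simp: eventually_sequentially)
    have "energy (\<lambda>j x. V j x - jet (\<phi> (n k)) j x) \<le>
        2 powr hi * (energy (\<lambda>j x. V j x - jet \<psi> j x) + energy (\<lambda>j x. jet \<psi> j x - jet (\<phi> (n k)) j x))"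
      by (rule energy_triangle[OF f finite_energy_jet[OF \<psi>(1)] finite_energy_jet[OF \<phi>]])
    also have "\<dots> < 2 powr hi * (e' + e')"
      using \<psi>(2) k energy_diff_commute[of "jet \<psi>" "jet (\<phi> (n k))"] by (intro mult_strict_left_mono add_strict_mono) auto
    also have "\<dots> = e" by (simp add: e'_def)
    finally have lt: "energy (\<lambda>j x. V j x - jet (\<phi> (n k)) j x) < e" .
    have eq: "jet (\<phi> (n k)) = comb (Suc (n k)) (\<lambda>i. if i = n k then 1 else 0)"
      by (auto simp: comb_def fun_eq_iff if_distrib[of "\<lambda>z. z * _"] cong: if_cong)
    show "\<exists>m c. energy (\<lambda>j x. V j x - comb m c j x) < e"
      by (intro exI) (rule lt[unfolded eq])
  qed
  have compact: "\<exists>k. strict_mono (k :: nat \<Rightarrow> nat) \<and> (\<forall>e>0. \<exists>N. \<forall>m\<ge>N. \<forall>n\<ge>N.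
      (\<integral>x. \<bar>w (k m) None x - w (k n) None x\<bar> \<partial>lebesgue_on \<Omega>) < e)"
    if w: "\<And>n::nat. \<exists>m c. w n = comb m c" and E: "\<And>n. energy (w n) \<le> E" for w E
  proof -
    have "\<forall>n. \<exists>\<theta>. \<theta> \<in> test_functions \<Omega> \<and> w n = jet \<theta>"
    proof
      fix n
      obtain m c where "w n = comb m c" using w[of n] by blast
      then have "w n = jet (\<lambda>x. \<Sum>i<m. c i * \<phi> i x)" by (simp only: comb_jet)
      with lin show "\<exists>\<theta>. \<theta> \<in> test_functions \<Omega> \<and> w n = jet \<theta>" by (intro exI conjI)
    qed
    from choice[OF this] obtain \<theta> where \<theta>: "\<forall>n. \<theta> n \<in> test_functions \<Omega> \<and> w n = jet (\<theta> n)" by (rule exE)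
    have "energy (jet (\<theta> n)) \<le> E" for n using E[of n] \<theta> by simp
    from energy_bounded_L1_compact[of \<theta> E, OF _ this] \<theta> show ?thesis by simp
  qed
  have "\<exists>U\<in>trial_closure. \<forall>V\<in>trial_closure. principal U V = convection U V"
  proof (rule convection_problem_solvable)
    fix w E assume "\<And>n::nat. \<exists>m c. w n = comb m c" "\<And>n. energy (w n) \<le> E"
    then show "\<exists>k. strict_mono (k :: nat \<Rightarrow> nat) \<and> (\<forall>e>0. \<exists>N. \<forall>m\<ge>N. \<forall>n\<ge>N.
      (\<integral>x. \<bar>w (k m) None x - w (k n) None x\<bar> \<partial>lebesgue_on \<Omega>) < e)" by (rule compact)
  next
    fix U assume "U \<in> trial_closure" "\<And>V. V \<in> trial_closure \<Longrightarrow> principal U V = convection U V"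
    then show ?thesis by (intro bexI[of _ U] ballI)
  qed
  then obtain U where U: "U \<in> trial_closure" and sol: "\<forall>V\<in>trial_closure. principal U V = convection U V"
    by (elim bexE)
  define u where "u = U None"
  have uW: "u \<in> W1_0 \<Omega> p" and ae: "AE x in lebesgue_on \<Omega>. weak_jet \<Omega> u j x = U j x" for j
    using test_closure_imp_W1_0[OF trial_test[OF U]] by (simp_all add: u_def)
  have fU: "finite_energy U" using U by (simp add: trial_closure_def)
  have fu: "finite_energy (weak_jet \<Omega> u)" using W1_0_imp_test_closure[OF uW] by (simp add: test_closure_def)
  have all: "AE x in lebesgue_on \<Omega>. \<forall>j. weak_jet \<Omega> u j x = U j x" using ae by (intro eventually_all_finite)
  have pr: "principal (weak_jet \<Omega> u) V = principal U V" if "finite_energy V" for V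
    unfolding principal_def
  proof (intro sum.cong refl integral_cong_AE)
    fix j
    show "(\<lambda>x. signed_pow (expo p j x) (weak_jet \<Omega> u j x) * V j x) \<in> borel_measurable (lebesgue_on \<Omega>)"
      "(\<lambda>x. signed_pow (expo p j x) (U j x) * V j x) \<in> borel_measurable (lebesgue_on \<Omega>)"
      using integrable_principal[OF fu that] integrable_principal[OF fU that] by auto
    show "AE x in lebesgue_on \<Omega>. signed_pow (expo p j x) (weak_jet \<Omega> u j x) * V j x = signed_pow (expo p j x) (U j x) * V j x"
      using ae[of j] by eventually_elim simp
  qed
  have co: "convection (weak_jet \<Omega> u) V = convection U V" if "finite_energy V" for V
    unfolding convection_def
  proof (rule integral_cong_AE)
    show "(\<lambda>x. g x (\<lambda>j. weak_jet \<Omega> u j x) * V None x) \<in> borel_measurable (lebesgue_on \<Omega>)"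
      "(\<lambda>x. g x (\<lambda>j. U j x) * V None x) \<in> borel_measurable (lebesgue_on \<Omega>)"
      using integrable_convection[OF fu that] integrable_convection[OF fU that] by auto
    show "AE x in lebesgue_on \<Omega>. g x (\<lambda>j. weak_jet \<Omega> u j x) * V None x = g x (\<lambda>j. U j x) * V None x"
      using all by eventually_elim simp
  qed
  have geq: "g x (\<lambda>j. weak_jet \<Omega> u j x) = f x (u x) (weak_grad \<Omega> u x)" for x
    by (simp add: g_def weak_grad_def)
  have "weak_solution \<Omega> p f u"
    unfolding weak_solution_def
  proof (intro conjI ballI allI uW)
    fix v assume v: "v \<in> W1_0 \<Omega> p"
    define V where "V = weak_jet \<Omega> v"
    have Vt: "V \<in> test_closure" unfolding V_def by (rule W1_0_imp_test_closure[OF v])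
    have fV: "finite_energy V" using Vt by (simp add: test_closure_def)
    show "integrable (lebesgue_on \<Omega>) (\<lambda>x. signed_pow (p i x) (weak_pderiv \<Omega> i u x) * weak_pderiv \<Omega> i v x)" for i
      using integrable_principal[OF fu fV, of "Some i"] by (simp add: V_def)
    show "integrable (lebesgue_on \<Omega>) (\<lambda>x. signed_pow (p_Max p x) (u x) * v x)"
      using integrable_principal[OF fu fV, of None] by (simp add: V_def)
    show "integrable (lebesgue_on \<Omega>) (\<lambda>x. f x (u x) (weak_grad \<Omega> u x) * v x)"
      using integrable_convection[OF fu fV] by (simp add: V_def geq)
    have "principal (weak_jet \<Omega> u) V = convection (weak_jet \<Omega> u) V"
      using bspec[OF sol test_trial[OF Vt]] pr[OF fV] co[OF fV] by simp
    then show "(\<Sum>i\<in>UNIV. \<integral>x. signed_pow (p i x) (weak_pderiv \<Omega> i u x) * weak_pderiv \<Omega> i v x \<partial>lebesgue_on \<Omega>)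
          + (\<integral>x. signed_pow (p_Max p x) (u x) * v x \<partial>lebesgue_on \<Omega>)
        = (\<integral>x. f x (u x) (weak_grad \<Omega> u x) * v x \<partial>lebesgue_on \<Omega>)"
      by (simp add: principal_def convection_def sum_option V_def geq add.commute)
  qed
  then show ?thesis by blast
qed

end

theorem theorem1p1:
  fixes \<Omega> :: "(real^'n) set"
    and p :: "'n \<Rightarrow> real^'n \<Rightarrow> real"
    and f :: "real^'n \<Rightarrow> real \<Rightarrow> real^'n \<Rightarrow> real"
  assumes "CARD('n) \<ge> 3"
    and "bounded_smooth_domain \<Omega>"
    and "\<And>i. continuous_on (closure \<Omega>) (p i)"
    and "\<And>i. exp_inf \<Omega> (p i) > 1"
    and "caratheodory \<Omega> f"
    and "growth_condition \<Omega> p f"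
  shows "\<exists>u. weak_solution \<Omega> p f u"
proof -
  have \<Omega>: "\<Omega> \<noteq> {}" "open \<Omega>" "bounded \<Omega>" using assms(2) by (auto simp: bounded_smooth_domain_def)
  have K: "compact (closure \<Omega>)" "closure \<Omega> \<noteq> {}" using \<Omega> by auto
  have bounds: "\<exists>a b. \<forall>x\<in>closure \<Omega>. a \<le> F x \<and> F x \<le> b" if "continuous_on (closure \<Omega>) F" for F :: "real^'n \<Rightarrow> real"
    using continuous_attains_inf[OF K that] continuous_attains_sup[OF K that] by blast
  have sub: "\<Omega> \<subseteq> closure \<Omega>" by (rule closure_subset)
  have exp_inf_le: "exp_inf \<Omega> F \<le> F x" if "\<And>y. y \<in> \<Omega> \<Longrightarrow> a \<le> F y" "x \<in> \<Omega>" for F :: "real^'n \<Rightarrow> real" and a x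
    unfolding exp_inf_def using that by (intro cINF_lower bdd_belowI2[of _ a]) auto
  have le_exp_sup: "F x \<le> exp_sup \<Omega> F" if "\<And>y. y \<in> \<Omega> \<Longrightarrow> F y \<le> a" "x \<in> \<Omega>" for F :: "real^'n \<Rightarrow> real" and a x
    unfolding exp_sup_def using that by (intro cSUP_upper bdd_aboveI2[of _ _ a]) auto
  have "\<forall>i. \<exists>a b. \<forall>x\<in>closure \<Omega>. a \<le> p i x \<and> p i x \<le> b" using bounds assms(3) by blast
  then obtain pa pb where pab: "\<And>i x. x \<in> closure \<Omega> \<Longrightarrow> pa i \<le> p i x \<and> p i x \<le> pb i" by metis
  define hi where "hi = Max (range pb)"
  have pb_hi: "pb i \<le> hi" for i unfolding hi_def by (rule Max_ge) auto
  define lo where "lo = p_min \<Omega> p"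
  have inf_le: "exp_inf \<Omega> (p i) \<le> p i x" if "x \<in> \<Omega>" for i x
    by (rule exp_inf_le[OF _ that, where a = "pa i"]) (use pab sub in blast)
  have lo_le: "lo \<le> exp_inf \<Omega> (p i)" for i unfolding lo_def p_min_def by (rule Min_le) auto
  have lo1: "1 < lo"
  proof -
    have "exp_inf \<Omega> (p i) \<le> exp_inf \<Omega> (p_Max p)" for i
      unfolding exp_inf_def[of \<Omega> "p_Max p"]
    proof (rule cINF_greatest[OF \<Omega>(1)])
      fix x assume "x \<in> \<Omega>"
      then show "exp_inf \<Omega> (p i) \<le> p_Max p x"
        by (rule order_trans[OF inf_le]) (auto simp: p_Max_def)
    qed
    then have "1 < exp_inf \<Omega> (p_Max p)" using assms(4) by (meson less_le_trans)
    then show ?thesis unfolding lo_def p_min_def using assms(4) by (subst Min_gr_iff) auto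
  qed
  interpret anisotropic_domain \<Omega> p lo hi
  proof
    show "p i \<in> borel_measurable (lebesgue_on \<Omega>)" for i
      by (rule continuous_imp_measurable_on_sets_lebesgue[OF continuous_on_subset[OF assms(3) sub]]) (use \<Omega> in simp)
    show "lo \<le> p i x \<and> p i x \<le> hi" if "x \<in> \<Omega>" for i x
      using inf_le[OF that, of i] lo_le[of i] pab[of x i] pb_hi[of i] that sub by fastforce
  qed (use \<Omega> lo1 in auto)
  obtain q k r C where qc: "continuous_on (closure \<Omega>) q" and q1: "\<forall>x\<in>closure \<Omega>. 1 < q x"
    and k: "k \<in> Lvar \<Omega> (conj_exp q)"
    and r0: "\<forall>i. r i \<in> borel_measurable (lebesgue_on \<Omega>) \<and> (\<forall>x\<in>\<Omega>. 0 \<le> r i x)"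
    and C: "C > 0"
    and bound: "AE x in lebesgue_on \<Omega>. \<forall>u \<xi>.
           \<bar>f x u \<xi>\<bar> \<le> C * (\<bar>k x\<bar> + \<bar>u\<bar> powr (q x - 1) + (\<Sum>i\<in>UNIV. \<bar>\<xi> $ i\<bar> powr r i x))"
    and qs: "exp_sup \<Omega> q < p_min \<Omega> p"
    and rr: "\<forall>i. (\<forall>x\<in>\<Omega>. 1 < r i x * conj_exp q x \<and> r i x * conj_exp q x \<le> p i x) \<and>
             exp_sup \<Omega> (r i) < exp_inf \<Omega> (p i) / p_min \<Omega> p * (p_min \<Omega> p - 1)"
    using assms(6) unfolding growth_condition_def by (elim exE conjE) (rule that)
  obtain x0 where x0: "x0 \<in> closure \<Omega>" "\<And>x. x \<in> closure \<Omega> \<Longrightarrow> q x0 \<le> q x"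
    using continuous_attains_inf[OF K qc] by blast
  obtain a b where ab: "\<And>x. x \<in> closure \<Omega> \<Longrightarrow> a \<le> q x \<and> q x \<le> b" using bounds[OF qc] by blast
  have q_sup: "q x \<le> exp_sup \<Omega> q" if "x \<in> \<Omega>" for x
    by (rule le_exp_sup[OF _ that, where a = b]) (use ab sub in blast)
  have qq: "q x0 \<le> q x \<and> q x \<le> exp_sup \<Omega> q" if "x \<in> \<Omega>" for x using x0(2) q_sup[OF that] that sub by blast
  have ql: "1 < q x0" using q1 x0(1) by blast
  have r_le_p: "r i x \<le> pb i" if x: "x \<in> \<Omega>" for i x
  proof -
    have "1 < q x" using q1 x sub by blast
    then have "1 \<le> conj_exp q x" by (simp add: conj_exp_def)
    then have "r i x * 1 \<le> r i x * conj_exp q x" using r0 x by (intro mult_left_mono) auto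
    also have "\<dots> \<le> p i x" using rr x by blast
    also have "\<dots> \<le> pb i" using pab x sub by blast
    finally show ?thesis by simp
  qed
  have r_sup: "r i x \<le> exp_sup \<Omega> (r i)" if "x \<in> \<Omega>" for i x
    by (rule le_exp_sup[OF r_le_p that])
  have R: "exp_sup \<Omega> (r i) * (lo / (lo - 1)) < exp_inf \<Omega> (p i)" for i
  proof -
    have "exp_sup \<Omega> (r i) * (lo / (lo - 1)) < (exp_inf \<Omega> (p i) / lo * (lo - 1)) * (lo / (lo - 1))"
      using rr lo1 unfolding lo_def[symmetric] by (intro mult_strict_right_mono) auto
    also have "\<dots> = exp_inf \<Omega> (p i)" using lo1 by simp
    finally show ?thesis .
  qed
  have qm: "q \<in> borel_measurable (lebesgue_on \<Omega>)"
    by (rule continuous_imp_measurable_on_sets_lebesgue[OF continuous_on_subset[OF qc sub]]) (use \<Omega> in simp)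
  obtain x1 where x1: "x1 \<in> \<Omega>" using \<Omega>(1) by blast
  show ?thesis
  proof (rule growth_structure[OF qm qq ql _ k _ R inf_le C bound])
    show "exp_sup \<Omega> q < lo" using qs by (simp add: lo_def)
    show "0 \<le> r i x \<and> r i x \<le> exp_sup \<Omega> (r i) \<and> r i x * conj_exp q x \<le> p i x" if "x \<in> \<Omega>" for i x
      using r0 rr r_sup[OF that] that by blast
    fix h A
    assume hA: "integrable (lebesgue_on \<Omega>) h" "\<And>x. 0 \<le> h x" "0 < A"
      "AE x in lebesgue_on \<Omega>. \<forall>y. \<bar>f x (y None) (\<chi> i. y (Some i))\<bar> powr (q x / (q x - 1))
         \<le> A * (h x + (\<Sum>j\<in>UNIV. \<bar>y j\<bar> powr expo p j x))"
      "AE x in lebesgue_on \<Omega>. \<forall>y. \<bar>f x (y None) (\<chi> i. y (Some i)) * y None\<bar>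
         \<le> h x + (\<Sum>j\<in>UNIV. \<bar>y j\<bar> powr expo p j x) / 2"
    show ?thesis
    proof (rule weak_solution_exists[OF assms(5) _ _ _ hA])
      show "1 < q x \<and> q x \<le> exp_sup \<Omega> q" if "x \<in> \<Omega>" for x using qq[OF that] ql by linarith
      show "0 < exp_sup \<Omega> q" using qq[OF x1] ql by linarith
      show "exp_sup \<Omega> q < lo" using qs by (simp add: lo_def)
    qed
  qed
qed

end
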